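(* None of the spaces $\bigcirc$, $\bigcirc^*$, $\wedge$ and $\wedge^*$ is isomorphic to a subspace or to a quotient of $Z_2$.
   Context: All spaces are complex. For the couple $(X_0,X_1)=(\ell_\infty,\ell_1)$ put $\Sigma=\ell_\infty+\ell_1$. The Calderón space $\mathcal C$ of the couple is the Banach space of bounded continuous functions $F:\{z\in\mathbb C:0\le \mathrm{Re}\,z\le 1\}\to\Sigma$, analytic on the open strip, such that for $j=0,1$ the map $t\mapsto F(j+it)$ is continuous from $\mathbb R$ into $X_j$ and tends to $0$ as $|t|\to\infty$, with norm $\|F\|=\max_{j=0,1}\sup_{t}\|F(j+it)\|_{X_j}$. For $k=0,1,2$ let $\Delta_k:\mathcal C\to\Sigma$, $\Delta_k(F)=F^{(k)}(1/2)/k!$, and for distinct indices $\langle\Delta_a,\Delta_b\rangle(F)=(\Delta_aF,\Delta_bF)$. For a closed subspace $K\subset\mathcal C$ and one of these maps $T$, the space $T(K)$ carries the quotient norm $\|x\|=\inf\{\|F\|:F\in K,\ TF=x\}$. Put $Z_2=\langle\Delta_1,\Delta_0\rangle(\mathcal C)$ (the Kalton-Peck space), $\wedge=\langle\Delta_2,\Delta_0\rangle(\ker\Delta_1)$ and $\bigcirc=\langle\Delta_0,\Delta_1\rangle(\ker\Delta_2)$. Stars denote dual spaces; subspaces are closed. *)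

theory Defs
  imports "HOL-Analysis.Analysis"
begin

section \<open>Complex normed spaces with explicit carrier\<close>

record 'a cnormed =
  vcarrier :: "'a set"
  vadd :: "'a \<Rightarrow> 'a \<Rightarrow> 'a"
  vscale :: "complex \<Rightarrow> 'a \<Rightarrow> 'a"
  vnorm :: "'a \<Rightarrow> real"

definition vsub :: "'a cnormed \<Rightarrow> 'a \<Rightarrow> 'a \<Rightarrow> 'a" where
  "vsub X x y = vadd X x (vscale X (-1) y)"

definition closed_subspace :: "'a set \<Rightarrow> 'a cnormed \<Rightarrow> bool" where
  "closed_subspace M X \<longleftrightarrow>
     M \<subseteq> vcarrier X \<and> M \<noteq> {} \<and>
     (\<forall>x\<in>M. \<forall>y\<in>M. vadd X x y \<in> M) \<and>
     (\<forall>c. \<forall>x\<in>M. vscale X c x \<in> M) \<and>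
     (\<forall>x\<in>vcarrier X. (\<forall>e>0. \<exists>y\<in>M. vnorm X (vsub X x y) < e) \<longrightarrow> x \<in> M)"

definition subspace_of :: "'a cnormed \<Rightarrow> 'a set \<Rightarrow> 'a cnormed" where
  "subspace_of X M = X\<lparr>vcarrier := M\<rparr>"

text \<open>In the scalar multiplication below, adding \<open>M\<close> matters only for \<open>c = 0\<close>, where
  \<open>{c a | a \<in> A}\<close> alone would be \<open>{0}\<close> instead of the coset \<open>M\<close>.\<close>

definition quotient_of :: "'a cnormed \<Rightarrow> 'a set \<Rightarrow> 'a set cnormed" where
  "quotient_of X M =
     \<lparr>vcarrier = {{vadd X x m |m. m \<in> M} |x. x \<in> vcarrier X},
      vadd = (\<lambda>A B. {vadd X a b |a b. a \<in> A \<and> b \<in> B}),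
      vscale = (\<lambda>c A. {vadd X (vscale X c a) m |a m. a \<in> A \<and> m \<in> M}),
      vnorm = (\<lambda>A. Inf (vnorm X ` A))\<rparr>"

definition bounded_operator :: "'a cnormed \<Rightarrow> 'b cnormed \<Rightarrow> ('a \<Rightarrow> 'b) \<Rightarrow> bool" where
  "bounded_operator X Y T \<longleftrightarrow>
     (\<forall>x\<in>vcarrier X. T x \<in> vcarrier Y) \<and>
     (\<forall>x\<in>vcarrier X. \<forall>y\<in>vcarrier X. T (vadd X x y) = vadd Y (T x) (T y)) \<and>
     (\<forall>c. \<forall>x\<in>vcarrier X. T (vscale X c x) = vscale Y c (T x)) \<and>
     (\<exists>B. \<forall>x\<in>vcarrier X. vnorm Y (T x) \<le> B * vnorm X x)"

definition isomorphic :: "'a cnormed \<Rightarrow> 'b cnormed \<Rightarrow> bool" where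
  "isomorphic X Y \<longleftrightarrow>
     (\<exists>T. bounded_operator X Y T \<and> bij_betw T (vcarrier X) (vcarrier Y) \<and>
          bounded_operator Y X (inv_into (vcarrier X) T))"

definition isomorphic_to_subspace :: "'a cnormed \<Rightarrow> 'b cnormed \<Rightarrow> bool" where
  "isomorphic_to_subspace X Y \<longleftrightarrow>
     (\<exists>M. closed_subspace M Y \<and> isomorphic X (subspace_of Y M))"

definition isomorphic_to_quotient :: "'a cnormed \<Rightarrow> 'b cnormed \<Rightarrow> bool" where
  "isomorphic_to_quotient X Y \<longleftrightarrow>
     (\<exists>M. closed_subspace M Y \<and> isomorphic X (quotient_of Y M))"

definition scalars :: "complex cnormed" where
  "scalars = \<lparr>vcarrier = UNIV, vadd = (+), vscale = (*), vnorm = cmod\<rparr>"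

text \<open>Functionals are extended by \<open>0\<close> off the carrier, so that equal functionals
  are equal as HOL functions.\<close>

definition dual_space :: "'a cnormed \<Rightarrow> ('a \<Rightarrow> complex) cnormed" where
  "dual_space X =
     \<lparr>vcarrier = {f. bounded_operator X scalars f \<and> (\<forall>x. x \<notin> vcarrier X \<longrightarrow> f x = 0)},
      vadd = (\<lambda>f g x. f x + g x),
      vscale = (\<lambda>c f x. c * f x),
      vnorm = (\<lambda>f. Sup {cmod (f x) |x. x \<in> vcarrier X \<and> vnorm X x \<le> 1})\<rparr>"


section \<open>The couple of sequence spaces\<close>

type_synonym cseq = "nat \<Rightarrow> complex"

definition seq_space :: "cseq set \<Rightarrow> (cseq \<Rightarrow> real) \<Rightarrow> cseq cnormed" where
  "seq_space S N =
     \<lparr>vcarrier = S, vadd = (\<lambda>x y n. x n + y n), vscale = (\<lambda>c x n. c * x n), vnorm = N\<rparr>"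

definition linf :: "cseq cnormed" where
  "linf = seq_space {x. bounded (range x)} (\<lambda>x. SUP n. cmod (x n))"

definition l1 :: "cseq cnormed" where
  "l1 = seq_space {x. summable (\<lambda>n. cmod (x n))} (\<lambda>x. \<Sum>n. cmod (x n))"

definition Sigma_space :: "cseq cnormed" where
  "Sigma_space =
     seq_space {\<lambda>n. a n + b n |a b. a \<in> vcarrier linf \<and> b \<in> vcarrier l1}
       (\<lambda>x. Inf {vnorm linf a + vnorm l1 b |a b.
                   a \<in> vcarrier linf \<and> b \<in> vcarrier l1 \<and> x = (\<lambda>n. a n + b n)})"


section \<open>The Calderon space\<close>

definition has_vderiv :: "'a cnormed \<Rightarrow> (complex \<Rightarrow> 'a) \<Rightarrow> 'a \<Rightarrow> complex \<Rightarrow> bool" where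
  "has_vderiv Y F D z \<longleftrightarrow> D \<in> vcarrier Y \<and>
     ((\<lambda>w. vnorm Y (vsub Y (vscale Y (1 / (w - z)) (vsub Y (F w) (F z))) D)) \<longlongrightarrow> 0) (at z)"

definition vderiv :: "'a cnormed \<Rightarrow> (complex \<Rightarrow> 'a) \<Rightarrow> complex \<Rightarrow> 'a" where
  "vderiv Y F z = (THE D. has_vderiv Y F D z)"

definition strip :: "complex set" where
  "strip = {z. 0 \<le> Re z \<and> Re z \<le> 1}"

definition open_strip :: "complex set" where
  "open_strip = {z. 0 < Re z \<and> Re z < 1}"

definition C0_curve :: "'a cnormed \<Rightarrow> (real \<Rightarrow> 'a) \<Rightarrow> bool" where
  "C0_curve X f \<longleftrightarrow>
     (\<forall>t. f t \<in> vcarrier X) \<and>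
     (\<forall>t. ((\<lambda>s. vnorm X (vsub X (f s) (f t))) \<longlongrightarrow> 0) (at t)) \<and>
     ((\<lambda>t. vnorm X (f t)) \<longlongrightarrow> 0) at_infinity"

text \<open>A function on the closed strip is represented by its extension by zero to the plane.\<close>

definition calderon :: "(complex \<Rightarrow> cseq) cnormed" where
  "calderon =
     \<lparr>vcarrier = {F.
        (\<forall>z. z \<notin> strip \<longrightarrow> F z = (\<lambda>n. 0)) \<and>
        (\<forall>z\<in>strip. F z \<in> vcarrier Sigma_space) \<and>
        (\<exists>B. \<forall>z\<in>strip. vnorm Sigma_space (F z) \<le> B) \<and>
        (\<forall>z\<in>strip. ((\<lambda>w. vnorm Sigma_space (vsub Sigma_space (F w) (F z))) \<longlongrightarrow> 0)
                      (at z within strip)) \<and>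
        (\<forall>z\<in>open_strip. \<exists>D. has_vderiv Sigma_space F D z) \<and>
        C0_curve linf (\<lambda>t. F (Complex 0 t)) \<and>
        C0_curve l1 (\<lambda>t. F (Complex 1 t))},
      vadd = (\<lambda>F G z n. F z n + G z n),
      vscale = (\<lambda>c F z n. c * F z n),
      vnorm = (\<lambda>F. max (SUP t. vnorm linf (F (Complex 0 t)))
                        (SUP t. vnorm l1 (F (Complex 1 t))))\<rparr>"

definition Delta :: "nat \<Rightarrow> (complex \<Rightarrow> cseq) \<Rightarrow> cseq" where
  "Delta k F = vscale Sigma_space (1 / fact k) ((vderiv Sigma_space ^^ k) F (1/2))"

definition ker_Delta :: "nat \<Rightarrow> (complex \<Rightarrow> cseq) cnormed" where
  "ker_Delta k = subspace_of calderon {F \<in> vcarrier calderon. Delta k F = (\<lambda>n. 0)}"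

text \<open>\<open>pair_image a b K\<close> is the image of \<open>K\<close> under \<open>F \<mapsto> (Delta a F, Delta b F)\<close>, with the
  quotient norm.\<close>

definition pair_image ::
  "nat \<Rightarrow> nat \<Rightarrow> (complex \<Rightarrow> cseq) cnormed \<Rightarrow> (cseq \<times> cseq) cnormed" where
  "pair_image a b K =
     \<lparr>vcarrier = (\<lambda>F. (Delta a F, Delta b F)) ` vcarrier K,
      vadd = (\<lambda>p q. (vadd Sigma_space (fst p) (fst q), vadd Sigma_space (snd p) (snd q))),
      vscale = (\<lambda>c p. (vscale Sigma_space c (fst p), vscale Sigma_space c (snd p))),
      vnorm = (\<lambda>p. Inf {vnorm K F |F. F \<in> vcarrier K \<and> (Delta a F, Delta b F) = p})\<rparr>"

definition Z2_space :: "(cseq \<times> cseq) cnormed" where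
  "Z2_space = pair_image 1 0 calderon"

definition wedge_space :: "(cseq \<times> cseq) cnormed" where
  "wedge_space = pair_image 2 0 (ker_Delta 1)"

definition bigcirc_space :: "(cseq \<times> cseq) cnormed" where
  "bigcirc_space = pair_image 0 1 (ker_Delta 2)"

end

theory Submission
  imports Defs "HOL-Complex_Analysis.Complex_Analysis"
begin

text \<open>The gap comes from the order of differentiation. A function on the strip that
  interpolates N coordinates carries the factor N^z, and each derivative at 1/2 costs one factor ln
  N. The norm of \<open>Z2_space\<close> sees one derivative. The other two spaces see a jet of
  order two with one entry forced to vanish, so a second factor ln N appears.

  Only an upper bound is proved for \<open>Z2_space\<close> and only lower bounds for the other
  spaces; explicit bounded functionals stand in for a description of the latter norms. A fixed
  matrix helps here: every row has unimodular coefficients, and the functional with the conjugate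
  coefficients bounds that single row from below, with no averaging.

  The obstacle on the upper side is that the explicit functions which realise a prescribed value and
  derivative have finitely many coordinates, whereas elements of the Calderon space have infinitely
  many. It is overcome by showing that tails of such elements are small in norm, which rests on
  compactness of the boundary curves and on the decay of coordinates even on the boundary line that
  carries the norm of ell_infty.\<close>

text \<open>Every twisted Hilbert space has type 2 on \<open>N\<close> vectors up to a factor of order \<open>log N\<close>. Averaging over
  the rows of the discrete Fourier matrix instead of over random signs turns this into an inequality
  for one \<open>N \<times> N\<close> matrix which passes to subspaces and to quotients. For \<open>Z\<^sub>2\<close> it follows from the
  description of the norm of \<open>(y, x)\<close> by \<open>\<parallel>x\<parallel> + \<parallel>y - 2 x ln |x|\<parallel>\<close> in \<open>\<ell>\<^sub>2\<close>.

  In \<open>\<wedge>\<close> and \<open>\<circle>\<close> the unit vectors of the coordinate \<open>\<Delta>\<^sub>0\<close> span the Orlicz space of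
  \<open>t\<^sup>2 ln\<^sup>4 t\<close>, so that \<open>N\<close> of them with unimodular coefficients have norm of order
  \<open>sqrt N ln\<^sup>2 N\<close>, which exceeds the bound by a factor \<open>log N\<close>. The functionals that
  witness this lower bound depend linearly on the coefficients and, by the orthogonality of the Fourier
  matrix, violate the same inequality in the dual spaces.\<close>

section \<open>Logarithmic type 2 under subspaces and quotients\<close>

text \<open>The record names no zero vector, so a combination starts with the term of index 0.
  Throughout, \<open>n\<close> stands for N = n + 1 vectors.\<close>

primrec vcomb :: "'a cnormed \<Rightarrow> (nat \<Rightarrow> complex) \<Rightarrow> (nat \<Rightarrow> 'a) \<Rightarrow> nat \<Rightarrow> 'a" where
  "vcomb X c v 0 = vscale X (c 0) (v 0)"
| "vcomb X c v (Suc n) = vadd X (vcomb X c v n) (vscale X (c (Suc n)) (v (Suc n)))"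

definition vclosed :: "'a cnormed \<Rightarrow> bool" where
  "vclosed X \<longleftrightarrow> (\<forall>x\<in>vcarrier X. \<forall>y\<in>vcarrier X. vadd X x y \<in> vcarrier X) \<and>
     (\<forall>c. \<forall>x\<in>vcarrier X. vscale X c x \<in> vcarrier X)"

lemma vcomb_cong: "(\<And>k. k \<le> n \<Longrightarrow> v k = w k) \<Longrightarrow> vcomb X c v n = vcomb X c w n"
  by (induction n) auto

lemma vcomb_in_carrier:
  assumes "vclosed X" "\<And>k. k \<le> n \<Longrightarrow> v k \<in> vcarrier X"
  shows "vcomb X c v n \<in> vcarrier X"
  using assms(2) by (induction n) (use assms(1) in \<open>auto simp: vclosed_def\<close>)

lemma bounded_operator_vcomb:
  assumes T: "bounded_operator X Y T" and X: "vclosed X"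
    and v: "\<And>k. k \<le> n \<Longrightarrow> v k \<in> vcarrier X"
  shows "T (vcomb X c v n) = vcomb Y c (\<lambda>k. T (v k)) n"
  using v
proof (induction n)
  case 0
  then show ?case using T by (simp add: bounded_operator_def)
next
  case (Suc n)
  have "vcomb X c v n \<in> vcarrier X" "vscale X (c (Suc n)) (v (Suc n)) \<in> vcarrier X"
    using vcomb_in_carrier[OF X, of n v c] X Suc.prems by (auto simp: vclosed_def)
  then show ?case using T Suc by (simp add: bounded_operator_def)
qed

text \<open>Says that the matrix divided by sqrt N, with N = n + 1, is a contraction of ell_2^N.
  Upper estimates use only this; the lower ones take the Fourier matrix.\<close>

definition bessel_matrix :: "nat \<Rightarrow> (nat \<Rightarrow> nat \<Rightarrow> complex) \<Rightarrow> bool" where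
  "bessel_matrix n \<theta> \<longleftrightarrow>
     (\<forall>x. (\<Sum>j\<le>n. (cmod (\<Sum>k\<le>n. \<theta> j k * x k))\<^sup>2) \<le> real (Suc n) * (\<Sum>k\<le>n. (cmod (x k))\<^sup>2))"

text \<open>The growth \<open>N\<^bsup>3/2\<^esup>\<close>, \<open>N = n + 1\<close>, is that of a Hilbert space; the logarithm is the loss
  allowed for a twisted Hilbert space.\<close>

definition log_type2 :: "'a cnormed \<Rightarrow> bool" where
  "log_type2 Y \<longleftrightarrow> (\<forall>b. \<exists>C. \<forall>n \<theta> v. bessel_matrix n \<theta> \<longrightarrow>
     (\<forall>k\<le>n. v k \<in> vcarrier Y \<and> vnorm Y (v k) \<le> b) \<longrightarrow>
     (\<Sum>j\<le>n. vnorm Y (vcomb Y (\<theta> j) v n)) \<le>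
       C * (real (Suc n) * sqrt (real (Suc n)) * (1 + ln (real (Suc n)))))"

text \<open>\<open>R x y\<close> is to be read as: \<open>y\<close> is a lift of \<open>x\<close>.
  It is the graph of the embedding for subspaces and membership in a coset for quotients. The
  inequality in \<open>Y\<close>, applied to bounded lifts, descends to \<open>X\<close> because a
  combination in \<open>X\<close> is dominated by the same combination of lifts.\<close>

lemma log_type2_transfer:
  assumes Y: "log_type2 Y" and nonneg: "\<And>y. y \<in> vcarrier Y \<Longrightarrow> 0 \<le> vnorm Y y" "vclosed Y"
    and lift: "\<And>(b::real). \<exists>b'. \<forall>x\<in>vcarrier X. vnorm X x \<le> b \<longrightarrow> (\<exists>y\<in>vcarrier Y. R x y \<and> vnorm Y y \<le> b')"
    and R: "\<And>n c v w. (\<And>k. k \<le> n \<Longrightarrow> v k \<in> vcarrier X \<and> w k \<in> vcarrier Y \<and> R (v k) (w k)) \<Longrightarrow>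
       vnorm X (vcomb X c v n) \<le> B * vnorm Y (vcomb Y c w n)"
  shows "log_type2 X"
  unfolding log_type2_def
proof
  fix b :: real
  from lift[of b] obtain b' where b': "\<And>x. x \<in> vcarrier X \<Longrightarrow> vnorm X x \<le> b \<Longrightarrow>
      \<exists>y\<in>vcarrier Y. R x y \<and> vnorm Y y \<le> b'" by blast
  from Y obtain C where C: "\<And>n \<theta> v. bessel_matrix n \<theta> \<Longrightarrow>
     (\<And>k. k \<le> n \<Longrightarrow> v k \<in> vcarrier Y \<and> vnorm Y (v k) \<le> b') \<Longrightarrow>
     (\<Sum>j\<le>n. vnorm Y (vcomb Y (\<theta> j) v n)) \<le>
       C * (real (Suc n) * sqrt (real (Suc n)) * (1 + ln (real (Suc n))))"
    unfolding log_type2_def by meson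
  show "\<exists>C. \<forall>n \<theta> v. bessel_matrix n \<theta> \<longrightarrow>
     (\<forall>k\<le>n. v k \<in> vcarrier X \<and> vnorm X (v k) \<le> b) \<longrightarrow>
     (\<Sum>j\<le>n. vnorm X (vcomb X (\<theta> j) v n)) \<le>
       C * (real (Suc n) * sqrt (real (Suc n)) * (1 + ln (real (Suc n))))"
  proof (intro exI[of _ "\<bar>B\<bar> * C"] allI impI)
    fix n \<theta> v
    assume \<theta>: "bessel_matrix n \<theta>" and v: "\<forall>k\<le>n. v k \<in> vcarrier X \<and> vnorm X (v k) \<le> b"
    have "\<forall>k. \<exists>y. k \<le> n \<longrightarrow> y \<in> vcarrier Y \<and> R (v k) y \<and> vnorm Y y \<le> b'"
      using b' v by blast
    then obtain w where w: "\<And>k. k \<le> n \<Longrightarrow> w k \<in> vcarrier Y \<and> R (v k) (w k) \<and> vnorm Y (w k) \<le> b'"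
      by metis
    have "vnorm X (vcomb X (\<theta> j) v n) \<le> \<bar>B\<bar> * vnorm Y (vcomb Y (\<theta> j) w n)" for j
    proof -
      have "vnorm X (vcomb X (\<theta> j) v n) \<le> B * vnorm Y (vcomb Y (\<theta> j) w n)"
        by (rule R) (use v w in auto)
      also have "\<dots> \<le> \<bar>B\<bar> * vnorm Y (vcomb Y (\<theta> j) w n)"
        by (intro mult_right_mono nonneg(1) vcomb_in_carrier nonneg(2)) (use w in auto)
      finally show ?thesis .
    qed
    hence "(\<Sum>j\<le>n. vnorm X (vcomb X (\<theta> j) v n)) \<le> \<bar>B\<bar> * (\<Sum>j\<le>n. vnorm Y (vcomb Y (\<theta> j) w n))"
      by (simp add: sum_distrib_left sum_mono)
    also have "\<dots> \<le> \<bar>B\<bar> * (C * (real (Suc n) * sqrt (real (Suc n)) * (1 + ln (real (Suc n)))))"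
      by (intro mult_left_mono C \<theta>) (use w in auto)
    finally show "(\<Sum>j\<le>n. vnorm X (vcomb X (\<theta> j) v n)) \<le>
       \<bar>B\<bar> * C * (real (Suc n) * sqrt (real (Suc n)) * (1 + ln (real (Suc n))))" by (simp only: mult.assoc)
  qed
qed

section \<open>Passage to subspaces and quotients\<close>

lemma isomorphicE:
  assumes "isomorphic X Y"
  obtains T B B' where "bounded_operator X Y T"
    "\<And>x. x \<in> vcarrier X \<Longrightarrow> T x \<in> vcarrier Y \<and> vnorm Y (T x) \<le> B * vnorm X x \<and> vnorm X x \<le> B' * vnorm Y (T x)"
proof -
  from assms obtain T where T: "bounded_operator X Y T" "bij_betw T (vcarrier X) (vcarrier Y)"
    "bounded_operator Y X (inv_into (vcarrier X) T)" unfolding isomorphic_def by blast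
  from T(1) obtain B where B: "\<And>x. x \<in> vcarrier X \<Longrightarrow> vnorm Y (T x) \<le> B * vnorm X x"
    unfolding bounded_operator_def by blast
  from T(3) obtain B' where B': "\<And>y. y \<in> vcarrier Y \<Longrightarrow> vnorm X (inv_into (vcarrier X) T y) \<le> B' * vnorm Y y"
    unfolding bounded_operator_def by blast
  have mem: "T x \<in> vcarrier Y" if "x \<in> vcarrier X" for x
    using T(1) that unfolding bounded_operator_def by blast
  have "vnorm X x \<le> B' * vnorm Y (T x)" if "x \<in> vcarrier X" for x
    using B'[OF mem[OF that]] bij_betw_inv_into_left[OF T(2) that] by simp
  with B mem T(1) that show ?thesis by blast
qed

lemma vcomb_subspace_of [simp]: "vcomb (subspace_of Y M) c v n = vcomb Y c v n"
  by (induction n) (simp_all add: subspace_of_def)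

lemma log_type2_subspace:
  assumes Y: "log_type2 Y" "\<And>y. y \<in> vcarrier Y \<Longrightarrow> 0 \<le> vnorm Y y" "vclosed Y"
    and X: "vclosed X" "\<And>x. x \<in> vcarrier X \<Longrightarrow> 0 \<le> vnorm X x" and iso: "isomorphic_to_subspace X Y"
  shows "log_type2 X"
proof -
  from iso obtain M where M: "closed_subspace M Y" "isomorphic X (subspace_of Y M)"
    unfolding isomorphic_to_subspace_def by blast
  have MY: "M \<subseteq> vcarrier Y" using M(1) unfolding closed_subspace_def by blast
  obtain T B B' where T: "bounded_operator X (subspace_of Y M) T"
    and TB: "\<And>x. x \<in> vcarrier X \<Longrightarrow> T x \<in> M \<and> vnorm Y (T x) \<le> B * vnorm X x \<and> vnorm X x \<le> B' * vnorm Y (T x)"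
    using isomorphicE[OF M(2)] by (auto simp: subspace_of_def)
  show ?thesis
  proof (rule log_type2_transfer[OF Y, where R="\<lambda>x y. y = T x" and B=B'])
    fix b :: real
    show "\<exists>b'. \<forall>x\<in>vcarrier X. vnorm X x \<le> b \<longrightarrow> (\<exists>y\<in>vcarrier Y. y = T x \<and> vnorm Y y \<le> b')"
    proof (intro exI[of _ "\<bar>B\<bar> * b"] ballI impI)
      fix x assume x: "x \<in> vcarrier X" "vnorm X x \<le> b"
      have "vnorm Y (T x) \<le> B * vnorm X x" using TB x by blast
      also have "\<dots> \<le> \<bar>B\<bar> * vnorm X x" by (intro mult_right_mono X x) auto
      also have "\<dots> \<le> \<bar>B\<bar> * b" by (intro mult_left_mono x) auto
      finally show "\<exists>y\<in>vcarrier Y. y = T x \<and> vnorm Y y \<le> \<bar>B\<bar> * b" using TB x MY by auto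
    qed
  next
    fix n :: nat and c v w
    assume A: "\<And>k. k \<le> n \<Longrightarrow> v k \<in> vcarrier X \<and> w k \<in> vcarrier Y \<and> w k = T (v k)"
    have "T (vcomb X c v n) = vcomb Y c (\<lambda>k. T (v k)) n"
      using bounded_operator_vcomb[OF T X(1), of n v c] A by simp
    also have "\<dots> = vcomb Y c w n" using A by (intro vcomb_cong) simp
    finally show "vnorm X (vcomb X c v n) \<le> B' * vnorm Y (vcomb Y c w n)"
      using TB[OF vcomb_in_carrier[OF X(1), of n v c]] A by auto
  qed
qed

text \<open>Coset operations can be followed on representatives. Since the quotient norm is an
  infimum over the coset, it is then at most the norm of the combined representatives.\<close>

lemma vcomb_quotient_mem:
  assumes M: "closed_subspace M Y" and zero: "\<And>y z. y \<in> vcarrier Y \<Longrightarrow> z \<in> vcarrier Y \<Longrightarrow> vadd Y y (vscale Y 0 z) = y"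
    and Y: "vclosed Y" and w: "\<And>k. k \<le> n \<Longrightarrow> w k \<in> vcarrier Y \<and> w k \<in> A k"
  shows "vcomb Y c w n \<in> vcomb (quotient_of Y M) c A n"
proof -
  from M obtain m where m: "m \<in> M" "m \<in> vcarrier Y" "vscale Y 0 m \<in> M" unfolding closed_subspace_def by blast
  have sc: "vscale Y d y \<in> vscale (quotient_of Y M) d S" if "y \<in> S" "y \<in> vcarrier Y" for d y S
  proof -
    \<comment> \<open>Scaling a coset adds an element of \<open>M\<close>; here
      \<open>vscale Y 0 m\<close> serves as the zero vector of \<open>M\<close>.\<close>
    have "vscale Y d y = vadd Y (vscale Y d y) (vscale Y 0 m)"
      using zero[of "vscale Y d y" m] that m Y by (simp add: vclosed_def)
    then show ?thesis using that m by (auto simp: quotient_of_def)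
  qed
  show ?thesis using w
  proof (induction n)
    case 0
    then show ?case using sc by simp
  next
    case (Suc n)
    have "vcomb Y c w n \<in> vcomb (quotient_of Y M) c A n" using Suc by simp
    moreover have "vscale Y (c (Suc n)) (w (Suc n)) \<in> vscale (quotient_of Y M) (c (Suc n)) (A (Suc n))"
      using sc Suc.prems by simp
    ultimately show ?case by (simp add: quotient_of_def) blast
  qed
qed

lemma log_type2_quotient:
  assumes Y: "log_type2 Y" "\<And>y. y \<in> vcarrier Y \<Longrightarrow> 0 \<le> vnorm Y y" "vclosed Y"
    and zero: "\<And>y z. y \<in> vcarrier Y \<Longrightarrow> z \<in> vcarrier Y \<Longrightarrow> vadd Y y (vscale Y 0 z) = y"
    and X: "vclosed X" "\<And>x. x \<in> vcarrier X \<Longrightarrow> 0 \<le> vnorm X x" and iso: "isomorphic_to_quotient X Y"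
  shows "log_type2 X"
proof -
  from iso obtain M where M: "closed_subspace M Y" "isomorphic X (quotient_of Y M)"
    unfolding isomorphic_to_quotient_def by blast
  have MY: "M \<subseteq> vcarrier Y" "M \<noteq> {}" using M(1) unfolding closed_subspace_def by auto
  obtain T B B' where T: "bounded_operator X (quotient_of Y M) T"
    and TB: "\<And>x. x \<in> vcarrier X \<Longrightarrow> T x \<in> vcarrier (quotient_of Y M) \<and>
      vnorm (quotient_of Y M) (T x) \<le> B * vnorm X x \<and> vnorm X x \<le> B' * vnorm (quotient_of Y M) (T x)"
    using isomorphicE[OF M(2)] by blast
  have qnorm: "vnorm (quotient_of Y M) A = Inf (vnorm Y ` A)" for A by (simp add: quotient_of_def)
  have coset: "A \<subseteq> vcarrier Y \<and> A \<noteq> {}" if "A \<in> vcarrier (quotient_of Y M)" for A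
    using that MY Y(3) unfolding quotient_of_def vclosed_def by auto
  show ?thesis
  proof (rule log_type2_transfer[OF Y(1-3), where R="\<lambda>x y. y \<in> T x" and B="\<bar>B'\<bar>"])
    fix b :: real
    show "\<exists>b'. \<forall>x\<in>vcarrier X. vnorm X x \<le> b \<longrightarrow> (\<exists>y\<in>vcarrier Y. y \<in> T x \<and> vnorm Y y \<le> b')"
    \<comment> \<open>The infimum in the quotient norm need not be attained, hence the added
      1.\<close>
    proof (intro exI[of _ "\<bar>B\<bar> * b + 1"] ballI impI)
      fix x assume x: "x \<in> vcarrier X" "vnorm X x \<le> b"
      have "Inf (vnorm Y ` T x) \<le> B * vnorm X x" using TB x qnorm by metis
      also have "\<dots> \<le> \<bar>B\<bar> * vnorm X x" by (intro mult_right_mono X x) auto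
      also have "\<dots> \<le> \<bar>B\<bar> * b" by (intro mult_left_mono x) auto
      finally have "Inf (vnorm Y ` T x) < \<bar>B\<bar> * b + 1" by simp
      moreover have "vnorm Y ` T x \<noteq> {}" using coset TB x by auto
      ultimately obtain y where "y \<in> T x" "vnorm Y y < \<bar>B\<bar> * b + 1"
        using cInf_lessD[of "vnorm Y ` T x" "\<bar>B\<bar> * b + 1"] by auto
      then show "\<exists>y\<in>vcarrier Y. y \<in> T x \<and> vnorm Y y \<le> \<bar>B\<bar> * b + 1"
        using coset TB x by (meson less_imp_le subsetD)
    qed
  next
    fix n :: nat and c v w
    assume A: "\<And>k. k \<le> n \<Longrightarrow> v k \<in> vcarrier X \<and> w k \<in> vcarrier Y \<and> w k \<in> T (v k)"
    have mem: "vcomb X c v n \<in> vcarrier X" using vcomb_in_carrier[OF X(1), of n v c] A by blast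
    have "T (vcomb X c v n) = vcomb (quotient_of Y M) c (\<lambda>k. T (v k)) n"
      using bounded_operator_vcomb[OF T X(1), of n v c] A by simp
    moreover have "vcomb Y c w n \<in> vcomb (quotient_of Y M) c (\<lambda>k. T (v k)) n"
      by (rule vcomb_quotient_mem[OF M(1) zero Y(3)]) (use A in auto)
    ultimately have in_T: "vcomb Y c w n \<in> T (vcomb X c v n)" by simp
    have sub: "T (vcomb X c v n) \<subseteq> vcarrier Y" using coset TB[OF mem] by blast
    have "bdd_below (vnorm Y ` T (vcomb X c v n))"
      by (rule bdd_belowI[of _ 0]) (use sub Y(2) in auto)
    then have le: "Inf (vnorm Y ` T (vcomb X c v n)) \<le> vnorm Y (vcomb Y c w n)"
      by (rule cInf_lower[rotated]) (use in_T in auto)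
    have ge: "0 \<le> Inf (vnorm Y ` T (vcomb X c v n))"
      by (rule cInf_greatest) (use in_T sub Y(2) in auto)
    have "vnorm X (vcomb X c v n) \<le> B' * Inf (vnorm Y ` T (vcomb X c v n))"
      using TB[OF mem] qnorm by metis
    also have "\<dots> \<le> \<bar>B'\<bar> * Inf (vnorm Y ` T (vcomb X c v n))" by (intro mult_right_mono ge) auto
    also have "\<dots> \<le> \<bar>B'\<bar> * vnorm Y (vcomb Y c w n)" by (intro mult_left_mono le) auto
    finally show "vnorm X (vcomb X c v n) \<le> \<bar>B'\<bar> * vnorm Y (vcomb Y c w n)" .
  qed
qed

section \<open>Functions on the strip\<close>

lemma strip_iff: "Complex a b \<in> strip \<longleftrightarrow> 0 \<le> a \<and> a \<le> 1"
  by (simp add: strip_def)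

lemma open_strip_subset: "open_strip \<subseteq> strip"
  by (auto simp: strip_def open_strip_def)

lemma open_open_strip: "open open_strip"
  unfolding open_strip_def
  by (intro open_Collect_conj open_halfspace_Re_gt open_halfspace_Re_lt)

lemma half_in_open_strip [simp]: "1/2 \<in> open_strip"
  by (simp add: open_strip_def)

lemma half_in_strip [simp]: "1/2 \<in> strip"
  by (simp add: strip_def)

text \<open>The Cauchy estimates at 1/2 are made on this disc; its radius is the origin of the
  factor 4^n in \<open>strip_cauchy\<close>.\<close>

lemma cball_half_subset: "cball (1/2) (1/4) \<subseteq> open_strip"
proof
  fix z :: complex assume "z \<in> cball (1/2) (1/4)"
  then have "\<bar>Re (z - 1/2)\<bar> \<le> 1/4"
    by (metis abs_Re_le_cmod dist_commute dist_norm mem_cball order_trans)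
  then have "\<bar>Re z - 1/2\<bar> \<le> 1/4" by simp
  then show "z \<in> open_strip" unfolding open_strip_def mem_Collect_eq by linarith
qed

text \<open>The factor \<open>exp (\<delta> (z - z0)\<^sup>2)\<close> makes the maximum principle applicable on large
  rectangles; then \<open>\<delta> \<rightarrow> 0\<close>.\<close>

lemma strip_max:
  fixes S :: "complex \<Rightarrow> complex"
  assumes cont: "continuous_on strip S" and hol: "S holomorphic_on open_strip"
    and bnd: "\<And>z. z \<in> strip \<Longrightarrow> cmod (S z) \<le> B"
    and M0: "\<And>t. cmod (S (Complex 0 t)) \<le> M" and M1: "\<And>t. cmod (S (Complex 1 t)) \<le> M"
    and z0: "z0 \<in> strip"
  shows "cmod (S z0) \<le> M"
proof -
  define s0 t0 where "s0 = Re z0" and "t0 = Im z0"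
  have s0: "0 \<le> s0" "s0 \<le> 1" using z0 by (auto simp: s0_def strip_def)
  have M_nonneg: "0 \<le> M" using M0[of 0] norm_ge_zero order_trans by blast
  have B_nonneg: "0 \<le> B" using bnd[OF z0] norm_ge_zero order_trans by blast
  have main: "cmod (S z0) \<le> (M + \<delta>) * exp \<delta>" if \<delta>: "0 < \<delta>" for \<delta>
  proof -
    \<comment> \<open>On the horizontal sides the weight contributes exp (-\<delta> R^2). The choice
      gives B \<le> \<delta> (\<delta> R^2) \<le> \<delta> exp (\<delta> R^2), so the bound
      \<open>B\<close> is damped to \<delta> there. The added 1 keeps \<open>R\<close> positive when
      \<open>B\<close> is 0.\<close>
    define R where "R = sqrt B / \<delta> + 1"
    have R: "R > 0" "R\<^sup>2 \<ge> B / \<delta>\<^sup>2"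
    proof -
      show "R > 0" using \<delta> B_nonneg by (simp add: R_def add_nonneg_pos)
      have "(sqrt B / \<delta>)\<^sup>2 \<le> R\<^sup>2" unfolding R_def using \<delta> B_nonneg by (intro power_mono) auto
      then show "R\<^sup>2 \<ge> B / \<delta>\<^sup>2" using B_nonneg by (simp add: power_divide)
    qed
    define Q where "Q = cbox (Complex 0 (t0 - R)) (Complex 1 (t0 + R))"
    define g where "g z = S z * exp (of_real \<delta> * (z - z0)\<^sup>2)" for z
    have Qs: "Q \<subseteq> strip" by (auto simp: Q_def in_cbox_complex_iff strip_def)
    have Qi: "interior Q \<subseteq> open_strip"
      by (auto simp: Q_def interior_cbox in_box_complex_iff open_strip_def)
    \<comment> \<open>The real part of (z - z0)^2 is the difference of the squares of the two
      coordinates, and the horizontal one is at most 1 in the strip.\<close>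
    have ge: "cmod (exp (of_real \<delta> * (z - z0)\<^sup>2)) \<le> exp \<delta> * exp (- \<delta> * (Im z - t0)\<^sup>2)" if "z \<in> strip" for z
    proof -
      have "\<bar>Re z - s0\<bar> \<le> 1" using that s0 by (auto simp: strip_def)
      then have "(Re z - s0)\<^sup>2 \<le> 1" by (simp add: abs_square_le_1)
      then have "\<delta> * (Re z - s0)\<^sup>2 \<le> \<delta> * 1" using \<delta> by (intro mult_left_mono) auto
      then show ?thesis by (simp add: exp_add[symmetric] s0_def t0_def power2_eq_square algebra_simps)
    qed
    have "cmod (g z0) \<le> (M + \<delta>) * exp \<delta>"
    proof (rule maximum_modulus_frontier[of g Q])
      show "g holomorphic_on interior Q" unfolding g_def
        by (intro holomorphic_intros holomorphic_on_subset[OF hol] Qi)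
      show "continuous_on (closure Q) g" unfolding g_def
        by (intro continuous_intros continuous_on_subset[OF cont]) (use Qs in \<open>simp add: Q_def\<close>)
      show "bounded Q" by (simp add: Q_def bounded_cbox)
      show "z0 \<in> Q" using s0 R by (auto simp: Q_def in_cbox_complex_iff s0_def t0_def)
      fix z assume "z \<in> frontier Q"
      then have zQ: "z \<in> Q" and nb: "z \<notin> box (Complex 0 (t0 - R)) (Complex 1 (t0 + R))"
        unfolding Q_def frontier_cbox by auto
      then have zs: "z \<in> strip" using Qs by auto
      have e1: "exp (- \<delta> * (Im z - t0)\<^sup>2) \<le> 1" using \<delta> by simp
      from zQ nb consider "Re z = 0" | "Re z = 1" | "\<bar>Im z - t0\<bar> = R"
        unfolding Q_def in_cbox_complex_iff in_box_complex_iff by fastforce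
      then have "cmod (S z) * exp (- \<delta> * (Im z - t0)\<^sup>2) \<le> M + \<delta>"
      proof cases
        case 1
        then have "cmod (S z) \<le> M" using M0[of "Im z"] by (metis complex_surj)
        then have "cmod (S z) * exp (- \<delta> * (Im z - t0)\<^sup>2) \<le> M * 1" using e1 by (intro mult_mono M_nonneg) auto
        then show ?thesis using \<delta> by simp
      next
        case 2
        then have "cmod (S z) \<le> M" using M1[of "Im z"] by (metis complex_surj)
        then have "cmod (S z) * exp (- \<delta> * (Im z - t0)\<^sup>2) \<le> M * 1" using e1 by (intro mult_mono M_nonneg) auto
        then show ?thesis using \<delta> by simp
      next
        case 3
        then have "(Im z - t0)\<^sup>2 = R\<^sup>2" by (metis power2_abs)
        have "B \<le> \<delta> * (\<delta> * R\<^sup>2)" using R(2) \<delta> by (simp add: field_simps power2_eq_square)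
        also have "\<dots> \<le> \<delta> * exp (\<delta> * R\<^sup>2)"
          using \<delta> exp_ge_add_one_self[of "\<delta> * R\<^sup>2"] by (intro mult_left_mono) linarith+
        finally have "B * exp (- \<delta> * R\<^sup>2) \<le> \<delta>" by (simp add: exp_minus field_simps)
        moreover have "cmod (S z) * exp (- \<delta> * R\<^sup>2) \<le> B * exp (- \<delta> * R\<^sup>2)"
          using bnd[OF zs] by (intro mult_right_mono) auto
        ultimately show ?thesis unfolding \<open>(Im z - t0)\<^sup>2 = R\<^sup>2\<close> using M_nonneg by linarith
      qed
      then have "cmod (S z) * exp (- \<delta> * (Im z - t0)\<^sup>2) * exp \<delta> \<le> (M + \<delta>) * exp \<delta>"
        by (intro mult_right_mono) auto
      moreover have "cmod (g z) \<le> cmod (S z) * (exp \<delta> * exp (- \<delta> * (Im z - t0)\<^sup>2))"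
        unfolding g_def norm_mult using ge[OF zs] by (intro mult_left_mono) auto
      ultimately show "cmod (g z) \<le> (M + \<delta>) * exp \<delta>" by (simp add: algebra_simps)
    qed
    then show ?thesis by (simp add: g_def)
  qed
  have lim: "((\<lambda>\<delta>. (M + \<delta>) * exp \<delta>) \<longlongrightarrow> (M + 0) * exp 0) (at_right 0)"
    by (intro tendsto_intros)
  have "cmod (S z0) \<le> (M + 0) * exp 0"
    by (rule tendsto_lowerbound[OF lim]) (auto simp: eventually_at_filter main intro!: always_eventually)
  then show ?thesis by simp
qed

lemma strip_cauchy:
  fixes S :: "complex \<Rightarrow> complex"
  assumes cont: "continuous_on strip S" and hol: "S holomorphic_on open_strip"
    and bnd: "\<And>z. z \<in> strip \<Longrightarrow> cmod (S z) \<le> B"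
    and M: "\<And>t. cmod (S (Complex 0 t)) \<le> M" "\<And>t. cmod (S (Complex 1 t)) \<le> M"
  shows "cmod ((deriv ^^ n) S (1/2)) \<le> fact n * M * 4 ^ n"
proof -
  have le: "cmod (S z) \<le> M" if "z \<in> strip" for z
    by (rule strip_max[OF cont hol bnd M that])
  have "cmod ((deriv ^^ n) S (1/2)) \<le> fact n * M / (1/4) ^ n"
  proof (rule Cauchy_inequality)
    show "S holomorphic_on ball (1/2) (1/4)"
      by (rule holomorphic_on_subset[OF hol]) (use cball_half_subset ball_subset_cball in blast)
    show "continuous_on (cball (1/2) (1/4)) S"
      by (rule continuous_on_subset[OF cont]) (use cball_half_subset open_strip_subset in blast)
    fix x :: complex assume "cmod (1/2 - x) = 1/4"
    then have "x \<in> cball (1/2) (1/4)" by (simp add: dist_norm)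
    then show "cmod (S x) \<le> M" using cball_half_subset open_strip_subset le by blast
  qed auto
  then show ?thesis by (simp add: power_divide)
qed

text \<open>The complex method between ell_infty and ell_1 gives ell_2 at 1/2, proved by duality:
  the \<phi>_k are paired with the functions h_k |h_k|^(1 - 2z) for a unit vector h of ell_2, and
  the sum is bounded by \<open>A\<close> on both boundary lines. The value at 1/2 gives the first
  claim. The derivative gives the second, since only the terms \<phi>_k' h_k survive when all
  \<phi>_k vanish at 1/2; the 4 is that of \<open>strip_cauchy\<close>.\<close>

lemma strip_interpolation:
  fixes \<phi> :: "nat \<Rightarrow> complex \<Rightarrow> complex"
  assumes I: "finite I"
    and cont: "\<And>k. k \<in> I \<Longrightarrow> continuous_on strip (\<phi> k)"
    and hol: "\<And>k. k \<in> I \<Longrightarrow> \<phi> k holomorphic_on open_strip"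
    and bnd: "\<And>k z. k \<in> I \<Longrightarrow> z \<in> strip \<Longrightarrow> cmod (\<phi> k z) \<le> B"
    and A0: "\<And>k t. k \<in> I \<Longrightarrow> cmod (\<phi> k (Complex 0 t)) \<le> A"
    and A1: "\<And>t. (\<Sum>k\<in>I. cmod (\<phi> k (Complex 1 t))) \<le> A" and A: "0 \<le> A"
  shows "(\<Sum>k\<in>I. (cmod (\<phi> k (1/2)))\<^sup>2) \<le> A\<^sup>2"
    and "(\<And>k. k \<in> I \<Longrightarrow> \<phi> k (1/2) = 0) \<Longrightarrow> (\<Sum>k\<in>I. (cmod (deriv (\<phi> k) (1/2)))\<^sup>2) \<le> (4 * A)\<^sup>2"
proof -
  \<comment> \<open>This is h_k |h_k|^(1 - 2z): modulus |h_k|^2 on the left line, at most 1 on the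
    right line, and value h_k at 1/2. For h_k = 0 the prefactor makes it vanish, whatever the
    logarithm.\<close>
  define G where "G h k z = h k * exp ((1 - 2 * z) * of_real (ln (cmod (h k))))" for h :: "nat \<Rightarrow> complex" and k z
  define S where "S h z = (\<Sum>k\<in>I. \<phi> k z * G h k z)" for h z
  have Gabs: "cmod (G h k (Complex s t)) = cmod (h k) * exp ((1 - 2 * s) * ln (cmod (h k)))" for h k s t
    by (simp add: G_def norm_mult)
  have G0: "cmod (G h k (Complex 0 t)) = (cmod (h k))\<^sup>2" for h k t
    by (cases "h k = 0") (simp_all add: Gabs power2_eq_square)
  have G1: "cmod (G h k (Complex 1 t)) \<le> 1" for h k t
    by (cases "h k = 0") (simp_all add: Gabs exp_minus)
  have hol_G: "G h k holomorphic_on T" for h k T unfolding G_def by (intro holomorphic_intros)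
  have Gbnd: "cmod (G h k z) \<le> cmod (h k) * exp \<bar>ln (cmod (h k))\<bar>" if "z \<in> strip" for h k z
  proof -
    have "\<bar>1 - 2 * Re z\<bar> \<le> 1" using that by (auto simp: strip_def)
    then have "\<bar>(1 - 2 * Re z) * ln (cmod (h k))\<bar> \<le> 1 * \<bar>ln (cmod (h k))\<bar>" unfolding abs_mult by (intro mult_right_mono) auto
    then have "exp ((1 - 2 * Re z) * ln (cmod (h k))) \<le> exp \<bar>ln (cmod (h k))\<bar>" by simp
    moreover have "cmod (G h k z) = cmod (h k) * exp ((1 - 2 * Re z) * ln (cmod (h k)))"
      using Gabs[of h k "Re z" "Im z"] by simp
    ultimately show ?thesis by (simp add: mult_left_mono)
  qed
  have key: "cmod ((deriv ^^ n) (S h) (1/2)) \<le> fact n * A * 4 ^ n" if h: "(\<Sum>k\<in>I. (cmod (h k))\<^sup>2) = 1" for h n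
  proof (rule strip_cauchy)
    show "continuous_on strip (S h)" unfolding S_def
      by (intro continuous_intros cont holomorphic_on_imp_continuous_on hol_G)
    show "S h holomorphic_on open_strip" unfolding S_def
      by (intro holomorphic_intros hol hol_G)
    show "cmod (S h z) \<le> (\<Sum>k\<in>I. B * (cmod (h k) * exp \<bar>ln (cmod (h k))\<bar>))" if z: "z \<in> strip" for z
    proof -
      have "cmod (S h z) \<le> (\<Sum>k\<in>I. cmod (\<phi> k z * G h k z))" unfolding S_def by (rule norm_sum)
      also have "\<dots> \<le> (\<Sum>k\<in>I. B * (cmod (h k) * exp \<bar>ln (cmod (h k))\<bar>))"
      proof (intro sum_mono)
        fix k assume k: "k \<in> I"
        have "0 \<le> B" using bnd[OF k z] norm_ge_zero order_trans by blast
        then show "cmod (\<phi> k z * G h k z) \<le> B * (cmod (h k) * exp \<bar>ln (cmod (h k))\<bar>)"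
          unfolding norm_mult by (intro mult_mono bnd Gbnd k z) auto
      qed
      finally show ?thesis .
    qed
    show "cmod (S h (Complex 0 t)) \<le> A" for t
    proof -
      have "cmod (S h (Complex 0 t)) \<le> (\<Sum>k\<in>I. A * (cmod (h k))\<^sup>2)" unfolding S_def
        by (intro sum_norm_le) (simp add: norm_mult G0 A0 mult_right_mono)
      then show ?thesis using h by (simp add: sum_distrib_left[symmetric])
    qed
    show "cmod (S h (Complex 1 t)) \<le> A" for t
    proof -
      have "cmod (S h (Complex 1 t)) \<le> (\<Sum>k\<in>I. cmod (\<phi> k (Complex 1 t)))" unfolding S_def
        by (intro sum_norm_le) (simp add: norm_mult G1 mult_left_le)
      then show ?thesis using A1[of t] by simp
    qed
  qed
  \<comment> \<open>Converse of the Cauchy-Schwarz inequality; the extremal h is the conjugate of x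
    divided by its norm.\<close>
  have dual: "(\<Sum>k\<in>I. (cmod (x k))\<^sup>2) \<le> C\<^sup>2"
    if C: "0 \<le> C" and le: "\<And>h. (\<Sum>k\<in>I. (cmod (h k))\<^sup>2) = 1 \<Longrightarrow> cmod (\<Sum>k\<in>I. x k * h k) \<le> C"
    for x :: "nat \<Rightarrow> complex" and C
  proof (cases "(\<Sum>k\<in>I. (cmod (x k))\<^sup>2) = 0")
    case False
    define R where "R = sqrt (\<Sum>k\<in>I. (cmod (x k))\<^sup>2)"
    have R2: "R\<^sup>2 = (\<Sum>k\<in>I. (cmod (x k))\<^sup>2)" unfolding R_def by (simp add: sum_nonneg)
    have "R \<ge> 0" unfolding R_def by (simp add: sum_nonneg)
    then have R: "R > 0" using R2 False by (cases "R = 0") auto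
    define h where "h k = cnj (x k) / of_real R" for k
    have "(\<Sum>k\<in>I. (cmod (h k))\<^sup>2) = (\<Sum>k\<in>I. (cmod (x k))\<^sup>2) / R\<^sup>2"
      using R by (simp add: h_def norm_divide power_divide sum_divide_distrib)
    also have "\<dots> = 1" using R unfolding R2[symmetric] by simp
    finally have "cmod (\<Sum>k\<in>I. x k * h k) \<le> C" by (rule le)
    moreover have "(\<Sum>k\<in>I. x k * h k) = of_real R"
    proof -
      have "(\<Sum>k\<in>I. x k * h k) = (\<Sum>k\<in>I. of_real ((cmod (x k))\<^sup>2)) / of_real R"
        by (simp add: h_def sum_divide_distrib flip: complex_norm_square)
      also have "\<dots> = of_real (R\<^sup>2 / R)" using R2 by simp
      finally show ?thesis using R by (simp add: power2_eq_square)
    qed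
    ultimately have "R \<le> C" using R by simp
    then show ?thesis using R2 R by (metis less_imp_le power_mono)
  qed (use C in simp)
  have Gh: "G h k (1/2) = h k" for h k by (simp add: G_def)
  show "(\<Sum>k\<in>I. (cmod (\<phi> k (1/2)))\<^sup>2) \<le> A\<^sup>2"
  proof (rule dual[OF A])
    fix h assume h: "(\<Sum>k\<in>I. (cmod (h k))\<^sup>2) = 1"
    show "cmod (\<Sum>k\<in>I. \<phi> k (1/2) * h k) \<le> A" using key[OF h, of 0] by (simp add: S_def Gh)
  qed
  show "(\<Sum>k\<in>I. (cmod (deriv (\<phi> k) (1/2)))\<^sup>2) \<le> (4 * A)\<^sup>2" if zero: "\<And>k. k \<in> I \<Longrightarrow> \<phi> k (1/2) = 0"
  proof (rule dual)
    show "0 \<le> 4 * A" using A by simp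
    fix h assume h: "(\<Sum>k\<in>I. (cmod (h k))\<^sup>2) = 1"
    have "(S h has_field_derivative (\<Sum>k\<in>I. \<phi> k (1/2) * deriv (G h k) (1/2) + deriv (\<phi> k) (1/2) * G h k (1/2))) (at (1/2))"
      unfolding S_def
    proof (rule DERIV_sum, rule DERIV_mult')
      fix k assume k: "k \<in> I"
      show "(\<phi> k has_field_derivative deriv (\<phi> k) (1/2)) (at (1/2))"
        using hol[OF k] open_open_strip half_in_open_strip by (rule holomorphic_derivI)
      show "(G h k has_field_derivative deriv (G h k) (1/2)) (at (1/2))"
        using hol_G[of h k UNIV] by (rule holomorphic_derivI) auto
    qed
    then have "deriv (S h) (1/2) = (\<Sum>k\<in>I. deriv (\<phi> k) (1/2) * h k)"
      by (simp add: DERIV_imp_deriv zero Gh)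
    then show "cmod (\<Sum>k\<in>I. deriv (\<phi> k) (1/2) * h k) \<le> 4 * A" using key[OF h, of 1] by simp
  qed
qed

section \<open>Sequence norms\<close>

definition supn :: "cseq \<Rightarrow> real" where "supn x = (SUP n. cmod (x n))"

definition sumn :: "cseq \<Rightarrow> real" where "sumn x = (\<Sum>n. cmod (x n))"

lemma bounded_range_cseq: "bounded (range (x :: cseq)) \<longleftrightarrow> (\<exists>B. \<forall>n. cmod (x n) \<le> B)"
  by (auto simp: bounded_iff)

lemma supn_upper: "bounded (range x) \<Longrightarrow> cmod (x n) \<le> supn x"
  unfolding supn_def by (rule cSUP_upper) (auto simp: bounded_range_cseq bdd_above_def)

lemma supn_least: "(\<And>n. cmod (x n) \<le> B) \<Longrightarrow> supn x \<le> B"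
  unfolding supn_def by (rule cSUP_least) auto

lemma supn_nonneg: "bounded (range x) \<Longrightarrow> 0 \<le> supn x"
  using supn_upper[of x 0] norm_ge_zero order_trans by blast

lemma vcarrier_linf [simp]: "vcarrier linf = {x. bounded (range x)}"
  and vnorm_linf [simp]: "vnorm linf = supn"
  and vsub_linf [simp]: "vsub linf x y = (\<lambda>n. x n - y n)"
  by (auto simp: linf_def seq_space_def supn_def vsub_def)

lemma vcarrier_l1 [simp]: "vcarrier l1 = {x. summable (\<lambda>n. cmod (x n))}"
  and vnorm_l1 [simp]: "vnorm l1 = sumn"
  and vsub_l1 [simp]: "vsub l1 x y = (\<lambda>n. x n - y n)"
  by (auto simp: l1_def seq_space_def sumn_def vsub_def)

lemma cmod_le_sumn: "summable (\<lambda>n. cmod (x n)) \<Longrightarrow> cmod (x n) \<le> sumn x"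
  unfolding sumn_def using sum_le_suminf[of "\<lambda>n. cmod (x n)" "{n}"] by simp

lemma sum_cmod_le_sumn: "summable (\<lambda>n. cmod (x n)) \<Longrightarrow> finite I \<Longrightarrow> (\<Sum>n\<in>I. cmod (x n)) \<le> sumn x"
  unfolding sumn_def by (rule sum_le_suminf) auto

lemma sumn_nonneg: "summable (\<lambda>n. cmod (x n)) \<Longrightarrow> 0 \<le> sumn x"
  using cmod_le_sumn[of x 0] norm_ge_zero order_trans by blast

lemma vcarrier_Sigma [simp]: "vcarrier Sigma_space = {x. bounded (range x)}"
proof -
  have "\<exists>a b. x = (\<lambda>n. a n + b n) \<and> bounded (range a) \<and> summable (\<lambda>n. cmod (b n))"
    if "bounded (range x)" for x :: cseq
    using that by (intro exI[of _ x] exI[of _ "\<lambda>n. 0"]) auto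
  moreover have "bounded (range (\<lambda>n. a n + b n))"
    if "bounded (range a)" "summable (\<lambda>n. cmod (b n))" for a b :: cseq
  proof -
    have "cmod (a n + b n) \<le> supn a + sumn b" for n
      using norm_triangle_ineq[of "a n" "b n"] supn_upper[OF that(1), of n] cmod_le_sumn[OF that(2), of n] by linarith
    then show ?thesis unfolding bounded_range_cseq by blast
  qed
  ultimately show ?thesis by (auto simp: Sigma_space_def seq_space_def)
qed

lemma vadd_Sigma [simp]: "vadd Sigma_space x y = (\<lambda>n. x n + y n)"
  and vscale_Sigma [simp]: "vscale Sigma_space c x = (\<lambda>n. c * x n)"
  and vsub_Sigma [simp]: "vsub Sigma_space x y = (\<lambda>n. x n - y n)"
  by (auto simp: Sigma_space_def seq_space_def vsub_def)

text \<open>The ell_1 norm dominates the sup norm, so the best decomposition leaves everything in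
  ell_infty. Hence convergence in \<open>Sigma_space\<close> is uniform convergence of the
  coordinates.\<close>

lemma vnorm_Sigma:
  assumes x: "bounded (range x)"
  shows "vnorm Sigma_space x = supn x"
proof -
  let ?S = "{supn a + sumn b |a b. bounded (range a) \<and> summable (\<lambda>n. cmod (b n)) \<and> x = (\<lambda>n. a n + b n)}"
  have "Inf ?S = supn x"
  proof (rule cInf_eq_minimum)
    have "x = (\<lambda>n. x n + 0) \<and> supn x = supn x + sumn (\<lambda>n. 0)" by (simp add: sumn_def)
    then show "supn x \<in> ?S" using x summable_zero
      by (intro CollectI exI[of _ x] exI[of _ "\<lambda>n. 0"]) auto
  next
    fix s assume "s \<in> ?S"
    then obtain a b where ab: "bounded (range a)" "summable (\<lambda>n. cmod (b n))" "x = (\<lambda>n. a n + b n)"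
      and s: "s = supn a + sumn b" by blast
    show "supn x \<le> s" unfolding s ab(3)
    proof (rule supn_least)
      fix n show "cmod (a n + b n) \<le> supn a + sumn b"
        using norm_triangle_ineq[of "a n" "b n"] supn_upper[OF ab(1), of n] cmod_le_sumn[OF ab(2), of n] by linarith
    qed
  qed
  then show ?thesis by (simp add: Sigma_space_def seq_space_def conj_commute conj_left_commute)
qed

lemma bounded_range_add [intro]: "bounded (range x) \<Longrightarrow> bounded (range y) \<Longrightarrow> bounded (range (\<lambda>n. x n + y n :: complex))"
  and bounded_range_diff [intro]: "bounded (range x) \<Longrightarrow> bounded (range y) \<Longrightarrow> bounded (range (\<lambda>n. x n - y n :: complex))"
  by (auto simp: bounded_plus_comp bounded_minus_comp)

lemma bounded_range_mult [intro]:
  fixes x :: cseq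
  assumes "bounded (range x)"
  shows "bounded (range (\<lambda>n. c * x n))"
proof -
  from assms
  obtain B where "\<And>n. cmod (x n) \<le> B" unfolding bounded_range_cseq by blast
  then have "cmod (c * x n) \<le> cmod c * B" for n by (simp add: norm_mult mult_left_mono)
  then show ?thesis unfolding bounded_range_cseq by blast
qed

section \<open>Differentiation\<close>

text \<open>Near \<open>z\<close> the difference quotients have bounded range, where the norm of
  \<open>Sigma_space\<close> is the sup norm and dominates each coordinate. The set \<open>U\<close>
  provides this neighbourhood.\<close>

lemma has_vderiv_coord:
  assumes D: "has_vderiv Sigma_space F D z" and bnd: "\<And>w. w \<in> U \<Longrightarrow> bounded (range (F w))"
    and U: "open U" "z \<in> U"
  shows "((\<lambda>w. F w n) has_field_derivative D n) (at z)"
proof -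
  let ?q = "\<lambda>w. (\<lambda>n. 1 / (w - z) * (F w n - F z n) - D n)"
  have D': "bounded (range D)" "((\<lambda>w. vnorm Sigma_space (?q w)) \<longlongrightarrow> 0) (at z)"
    using D by (auto simp: has_vderiv_def)
  have q: "bounded (range (?q w))" if "w \<in> U" for w
    by (intro bounded_range_diff bounded_range_mult bnd that U D')
  have evU: "\<forall>\<^sub>F w in at z. w \<in> U" using U eventually_at_in_open' by blast
  have "((\<lambda>w. ?q w n) \<longlongrightarrow> 0) (at z)"
  proof (rule Lim_null_comparison[OF _ D'(2)])
    show "\<forall>\<^sub>F w in at z. norm (?q w n) \<le> vnorm Sigma_space (?q w)" using evU
    proof eventually_elim
      case (elim w)
      show ?case unfolding vnorm_Sigma[OF q[OF elim]] by (rule supn_upper[OF q[OF elim]])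
    qed
  qed
  then have "((\<lambda>w. ?q w n + D n) \<longlongrightarrow> 0 + D n) (at z)" by (intro tendsto_intros)
  then show ?thesis by (simp add: has_field_derivative_iff)
qed

text \<open>Second order Taylor formula; the second derivative is at most 2 B / (r/2)^2 by Cauchy's
  estimate on discs of radius r/2. The bound depends on \<open>B\<close> and \<open>r\<close> alone
  and is therefore uniform over a family of coordinates.\<close>

lemma uniform_difference_quotient:
  fixes f :: "complex \<Rightarrow> complex"
  assumes hol: "f holomorphic_on ball z r" and bnd: "\<And>w. w \<in> ball z r \<Longrightarrow> cmod (f w) \<le> B"
    and r: "0 < r" and w: "w \<in> ball z (r/2)" "w \<noteq> z"
  shows "cmod (1 / (w - z) * (f w - f z) - deriv f z) \<le> 8 * B / r\<^sup>2 * cmod (w - z)"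
proof -
  have sub: "ball z (r/2) \<subseteq> ball z r" using r by (intro subset_ball) auto
  have hol1: "deriv f holomorphic_on ball z r" using hol by (intro holomorphic_deriv) auto
  have c: "cmod ((deriv ^^ 2) f u) \<le> 8 * B / r\<^sup>2" if u: "u \<in> ball z (r/2)" for u
  proof -
    have s: "cball u (r/2) \<subseteq> ball z r"
    proof
      fix x assume "x \<in> cball u (r/2)"
      then show "x \<in> ball z r" using u dist_triangle[of z x u] by simp
    qed
    have "cmod ((deriv ^^ 2) f u) \<le> fact 2 * B / (r/2)^2"
    proof (rule Cauchy_inequality)
      show "f holomorphic_on ball u (r/2)" using holomorphic_on_subset[OF hol] s ball_subset_cball by blast
      show "continuous_on (cball u (r/2)) f" using holomorphic_on_subset[OF hol s] holomorphic_on_imp_continuous_on by blast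
      show "0 < r/2" using r by simp
      fix x assume "cmod (u - x) = r/2"
      then show "cmod (f x) \<le> B" using s by (intro bnd) (auto simp: dist_norm)
    qed
    then show ?thesis by (simp add: power_divide algebra_simps)
  qed
  have "cmod ((deriv ^^ 0) f w - (\<Sum>i\<le>1. (deriv ^^ i) f z * (w - z) ^ i / fact i)) \<le> (8 * B / r\<^sup>2) * cmod (w - z) ^ Suc 1 / fact 1"
  proof (rule complex_Taylor[where S="ball z (r/2)"])
    fix i :: nat and x assume x: "x \<in> ball z (r/2)" "i \<le> 1"
    then have xr: "x \<in> ball z r" using sub by blast
    from x(2) consider "i = 0" | "i = 1" by linarith
    then have "((deriv ^^ i) f has_field_derivative (deriv ^^ (Suc i)) f x) (at x)"
      by cases (auto intro: holomorphic_derivI[OF hol _ xr] holomorphic_derivI[OF hol1 _ xr])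
    then show "((deriv ^^ i) f has_field_derivative (deriv ^^ (Suc i)) f x) (at x within ball z (r/2))"
      by (rule has_field_derivative_at_within)
  qed (use c w r in \<open>auto simp: numeral_2_eq_2\<close>)
  then have T: "cmod (f w - f z - deriv f z * (w - z)) \<le> 8 * B / r\<^sup>2 * (cmod (w - z))\<^sup>2"
    by (simp add: algebra_simps power2_eq_square)
  have "1 / (w - z) * (f w - f z) - deriv f z = (f w - f z - deriv f z * (w - z)) / (w - z)"
    using w by (simp add: field_simps)
  then have "cmod (1 / (w - z) * (f w - f z) - deriv f z) = cmod (f w - f z - deriv f z * (w - z)) / cmod (w - z)"
    by (simp add: norm_divide)
  also have "\<dots> \<le> (8 * B / r\<^sup>2 * (cmod (w - z))\<^sup>2) / cmod (w - z)" by (intro divide_right_mono T) auto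
  finally show ?thesis using w by (simp add: power2_eq_square)
qed

text \<open>A uniformly bounded family of holomorphic coordinates is differentiable in the sup norm,
  because the error of the difference quotients is uniform in the coordinate.\<close>

lemma has_vderivI:
  assumes hol: "\<And>n. (\<lambda>w. F w n) holomorphic_on ball z r" and r: "0 < r"
    and bnd: "\<And>w n. w \<in> ball z r \<Longrightarrow> cmod (F w n) \<le> B"
  shows "has_vderiv Sigma_space F (\<lambda>n. deriv (\<lambda>w. F w n) z) z"
proof -
  let ?D = "\<lambda>n. deriv (\<lambda>w. F w n) z"
  have "cmod (?D n) \<le> fact 1 * B / (r/2)^1" for n
  proof -
    have s: "cball z (r/2) \<subseteq> ball z r" using r by auto
    have "cmod ((deriv ^^ 1) (\<lambda>w. F w n) z) \<le> fact 1 * B / (r/2)^1"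
    proof (rule Cauchy_inequality)
      show "(\<lambda>w. F w n) holomorphic_on ball z (r/2)" using holomorphic_on_subset[OF hol] s ball_subset_cball by blast
      show "continuous_on (cball z (r/2)) (\<lambda>w. F w n)" using holomorphic_on_subset[OF hol s] holomorphic_on_imp_continuous_on by blast
      show "0 < r/2" using r by simp
      fix x assume "cmod (z - x) = r/2"
      then show "cmod (F x n) \<le> B" using s by (intro bnd) (auto simp: dist_norm)
    qed
    then show ?thesis by simp
  qed
  then have D: "bounded (range ?D)" unfolding bounded_range_cseq by blast
  let ?q = "\<lambda>w. (\<lambda>n. 1 / (w - z) * (F w n - F z n) - ?D n)"
  have F: "bounded (range (F w))" if "w \<in> ball z r" for w unfolding bounded_range_cseq using bnd that by blast
  have ev: "\<forall>\<^sub>F w in at z. w \<in> ball z (r/2) - {z}"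
    using r by (intro eventually_at_in_open) auto
  have "((\<lambda>w. vnorm Sigma_space (?q w)) \<longlongrightarrow> 0) (at z)"
  proof (rule Lim_null_comparison)
    show "\<forall>\<^sub>F w in at z. norm (vnorm Sigma_space (?q w)) \<le> 8 * B / r\<^sup>2 * cmod (w - z)"
      using ev
    proof eventually_elim
      case (elim w)
      have "w \<in> ball z r" "z \<in> ball z r" using elim r by auto
      then have q: "bounded (range (?q w))" by (intro bounded_range_diff bounded_range_mult F D)
      have "supn (?q w) \<le> 8 * B / r\<^sup>2 * cmod (w - z)"
        by (rule supn_least, rule uniform_difference_quotient[OF hol _ r]) (use bnd elim in auto)
      then show ?case unfolding vnorm_Sigma[OF q] using supn_nonneg[OF q] by (simp only: real_norm_def abs_of_nonneg)
    qed
    have "((\<lambda>w. 8 * B / r\<^sup>2 * cmod (w - z)) \<longlongrightarrow> 8 * B / r\<^sup>2 * cmod (z - z)) (at z)"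
      by (intro tendsto_intros)
    then show "((\<lambda>w. 8 * B / r\<^sup>2 * cmod (w - z)) \<longlongrightarrow> 0) (at z)" by simp
  qed
  then show ?thesis unfolding has_vderiv_def using D by simp
qed

lemma vderiv_eq:
  assumes hol: "\<And>n. (\<lambda>w. F w n) holomorphic_on ball z r" and r: "0 < r"
    and bnd: "\<And>w n. w \<in> ball z r \<Longrightarrow> cmod (F w n) \<le> B"
  shows "vderiv Sigma_space F z = (\<lambda>n. deriv (\<lambda>w. F w n) z)"
  unfolding vderiv_def
proof (rule the_equality)
  show "has_vderiv Sigma_space F (\<lambda>n. deriv (\<lambda>w. F w n) z) z" by (rule has_vderivI[OF hol r bnd])
  fix D assume D: "has_vderiv Sigma_space F D z"
  have "((\<lambda>w. F w n) has_field_derivative D n) (at z)" for n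
    by (rule has_vderiv_coord[OF D, of "ball z r"]) (use bnd r in \<open>auto simp: bounded_range_cseq\<close>)
  then show "D = (\<lambda>n. deriv (\<lambda>w. F w n) z)" by (intro ext DERIV_imp_deriv[symmetric])
qed

section \<open>The Calderon space\<close>

text \<open>Translates the vector-valued conditions into coordinates. The boundedness facts hold on
  the whole plane because functions are extended by zero.\<close>

lemma calderonD:
  assumes F: "F \<in> vcarrier calderon"
  shows "z \<notin> strip \<Longrightarrow> F z n = 0"
    and "bounded (range (F z))"
    and "\<exists>B. \<forall>z n. cmod (F z n) \<le> B"
    and "z \<in> strip \<Longrightarrow> ((\<lambda>w. supn (\<lambda>n. F w n - F z n)) \<longlongrightarrow> 0) (at z within strip)"
    and "(\<lambda>z. F z n) holomorphic_on open_strip"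
    and "continuous_on strip (\<lambda>z. F z n)"
    and "C0_curve linf (\<lambda>t. F (Complex 0 t))" "C0_curve l1 (\<lambda>t. F (Complex 1 t))"
proof -
  show z0: "F z n = 0" if "z \<notin> strip" for z n using F that by (auto simp: calderon_def)
  show bF: "bounded (range (F z))" for z
    using F by (cases "z \<in> strip") (auto simp: calderon_def)
  obtain B where "\<And>z. z \<in> strip \<Longrightarrow> vnorm Sigma_space (F z) \<le> B" using F by (auto simp: calderon_def)
  then have B: "supn (F z) \<le> B" if "z \<in> strip" for z using vnorm_Sigma[OF bF] that by metis
  have "cmod (F z n) \<le> max B 0" for z n
  proof (cases "z \<in> strip")
    case True
    then show ?thesis using B supn_upper[OF bF, of z n] by fastforce
  qed (simp add: z0)
  then show "\<exists>B. \<forall>z n. cmod (F z n) \<le> B" by blast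
  show lim: "((\<lambda>w. supn (\<lambda>n. F w n - F z n)) \<longlongrightarrow> 0) (at z within strip)" if "z \<in> strip" for z
  proof -
    have "((\<lambda>w. vnorm Sigma_space (vsub Sigma_space (F w) (F z))) \<longlongrightarrow> 0) (at z within strip)"
      using F that by (auto simp: calderon_def)
    moreover have "vnorm Sigma_space (vsub Sigma_space (F w) (F z)) = supn (\<lambda>n. F w n - F z n)" for w
      by (simp add: vnorm_Sigma bF bounded_range_diff)
    ultimately show ?thesis by simp
  qed
  show "(\<lambda>z. F z n) holomorphic_on open_strip" for n
    unfolding holomorphic_on_open[OF open_open_strip]
  proof
    fix z assume "z \<in> open_strip"
    then obtain D where D: "has_vderiv Sigma_space F D z" using F by (auto simp: calderon_def)
    show "\<exists>f'. ((\<lambda>z. F z n) has_field_derivative f') (at z)"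
      using has_vderiv_coord[OF D bF open_UNIV UNIV_I] by blast
  qed
  show "continuous_on strip (\<lambda>z. F z n)" for n unfolding continuous_on
  proof
    fix z assume z: "z \<in> strip"
    have "((\<lambda>w. F w n - F z n) \<longlongrightarrow> 0) (at z within strip)"
      by (rule Lim_null_comparison[OF always_eventually lim[OF z]])
        (use supn_upper[OF bounded_range_diff[OF bF bF]] in auto)
    then show "((\<lambda>w. F w n) \<longlongrightarrow> F z n) (at z within strip)" by (simp add: LIM_zero_iff)
  qed
  show "C0_curve linf (\<lambda>t. F (Complex 0 t))" "C0_curve l1 (\<lambda>t. F (Complex 1 t))"
    using F by (auto simp: calderon_def)
qed

lemma calderonI:
  assumes off: "\<And>z. z \<notin> strip \<Longrightarrow> F z = (\<lambda>n. 0)" and bnd: "\<And>z n. z \<in> strip \<Longrightarrow> cmod (F z n) \<le> B"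
    and lim: "\<And>z. z \<in> strip \<Longrightarrow> ((\<lambda>w. supn (\<lambda>n. F w n - F z n)) \<longlongrightarrow> 0) (at z within strip)"
    and hol: "\<And>n. (\<lambda>z. F z n) holomorphic_on open_strip"
    and c0: "C0_curve linf (\<lambda>t. F (Complex 0 t))" and c1: "C0_curve l1 (\<lambda>t. F (Complex 1 t))"
  shows "F \<in> vcarrier calderon"
proof -
  have bF: "bounded (range (F z))" for z
    using bnd[of z] off[of z] by (cases "z \<in> strip") (auto simp: bounded_range_cseq)
  have "\<exists>D. has_vderiv Sigma_space F D z" if z: "z \<in> open_strip" for z
  proof -
    obtain r where r: "0 < r" "ball z r \<subseteq> open_strip" using open_open_strip z open_contains_ball by blast
    have "has_vderiv Sigma_space F (\<lambda>n. deriv (\<lambda>w. F w n) z) z"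
    proof (rule has_vderivI[OF holomorphic_on_subset[OF hol r(2)] r(1)])
      show "cmod (F w n) \<le> B" if "w \<in> ball z r" for w n
        using that r open_strip_subset by (intro bnd) auto
    qed
    then show ?thesis by blast
  qed
  moreover have "vnorm Sigma_space (F z) \<le> B" if "z \<in> strip" for z
    using vnorm_Sigma[OF bF, of z] supn_least[OF bnd[OF that]] by simp
  moreover have "vnorm Sigma_space (vsub Sigma_space (F w) (F z)) = supn (\<lambda>n. F w n - F z n)" for w z
    by (simp add: vnorm_Sigma bF bounded_range_diff)
  ultimately show ?thesis using off bF lim c0 c1 unfolding calderon_def by auto
qed

lemma Delta_0 [simp]: "Delta 0 F = F (1/2)"
  by (simp add: Delta_def)

lemma Delta_1_2:
  assumes F: "F \<in> vcarrier calderon"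
  shows "Delta (Suc 0) F n = deriv (\<lambda>z. F z n) (1/2)"
    and "Delta 2 F n = (deriv ^^ 2) (\<lambda>z. F z n) (1/2) / 2"
proof -
  obtain B where B: "\<And>z n. cmod (F z n) \<le> B" using calderonD(3)[OF F] by blast
  have d1: "vderiv Sigma_space F z = (\<lambda>n. deriv (\<lambda>w. F w n) z)" if z: "z \<in> open_strip" for z
  proof -
    obtain r where r: "0 < r" "ball z r \<subseteq> open_strip" using open_open_strip z open_contains_ball by blast
    show ?thesis by (rule vderiv_eq[OF holomorphic_on_subset[OF calderonD(5)[OF F] r(2)] r(1) B])
  qed
  show "Delta (Suc 0) F n = deriv (\<lambda>z. F z n) (1/2)"
    by (simp only: Delta_def funpow.simps o_apply id_apply d1[OF half_in_open_strip] fact_Suc) simp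
  \<comment> \<open>The outer \<open>vderiv\<close> requires a bound for the inner one near 1/2.
    Discs of radius 1/8 about points of this ball stay within distance 1/4 of 1/2, so Cauchy's
    estimate gives the bound 8 B.\<close>
  let ?b = "ball (1/2 :: complex) (1/8)"
  have sub: "cball w (1/8) \<subseteq> open_strip" if "w \<in> ?b" for w
  proof -
    have "cball w (1/8) \<subseteq> cball (1/2) (1/4)"
    proof
      fix x assume "x \<in> cball w (1/8)"
      then show "x \<in> cball (1/2) (1/4)" using that dist_triangle[of "1/2" x w] by simp
    qed
    then show ?thesis using cball_half_subset by blast
  qed
  have wb: "w \<in> open_strip" if "w \<in> ?b" for w using sub[OF that] by (meson centre_in_cball subsetD zero_le_divide_1_iff zero_le_numeral)
  have eq: "vderiv Sigma_space F w n = deriv (\<lambda>w. F w n) w" if "w \<in> ?b" for w n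
    using d1 wb[OF that] by simp
  have holF: "deriv (\<lambda>w. F w n) holomorphic_on ?b" for n
    by (rule holomorphic_on_subset[OF holomorphic_deriv[OF calderonD(5)[OF F] open_open_strip]]) (use wb in blast)
  have "vderiv Sigma_space (vderiv Sigma_space F) (1/2) = (\<lambda>n. deriv (\<lambda>w. vderiv Sigma_space F w n) (1/2))"
  proof (rule vderiv_eq)
    show "(\<lambda>w. vderiv Sigma_space F w n) holomorphic_on ?b" for n
      by (rule holomorphic_transform[OF holF]) (simp add: eq)
    show "cmod (vderiv Sigma_space F w n) \<le> 8 * B" if w: "w \<in> ?b" for w n
    proof -
      have "cmod ((deriv ^^ 1) (\<lambda>w. F w n) w) \<le> fact 1 * B / (1/8)^1"
      proof (rule Cauchy_inequality)
        show "(\<lambda>w. F w n) holomorphic_on ball w (1/8)" using calderonD(5)[OF F] holomorphic_on_subset sub[OF w] ball_subset_cball by blast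
        then show "continuous_on (cball w (1/8)) (\<lambda>w. F w n)"
          using calderonD(6)[OF F] sub[OF w] open_strip_subset continuous_on_subset by blast
      qed (use B in auto)
      then show ?thesis using eq[OF w] by simp
    qed
  qed auto
  \<comment> \<open>The two functions are known to agree near 1/2 only, so their derivatives are
    compared through a neighbourhood.\<close>
  moreover have "deriv (\<lambda>w. vderiv Sigma_space F w n) (1/2) = deriv (deriv (\<lambda>w. F w n)) (1/2)" for n
  proof (rule deriv_cong_ev)
    have "\<forall>\<^sub>F w in nhds (1/2). w \<in> ?b" by (intro eventually_nhds_in_open) auto
    then show "\<forall>\<^sub>F w in nhds (1/2). vderiv Sigma_space F w n = deriv (\<lambda>w. F w n) w"
      by eventually_elim (rule eq)
  qed simp
  ultimately show "Delta 2 F n = (deriv ^^ 2) (\<lambda>z. F z n) (1/2) / 2"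
    by (simp only: Delta_def funpow.simps o_apply id_apply numeral_2_eq_2 fact_Suc) simp
qed

text \<open>Compactness of an interval covers the bounded parameters and the condition at infinity
  the others; monotonicity in the index allows the maximum of finitely many local indices. It turns
  bounds and cut-offs found near each \<open>t\<close> into ones valid for the whole boundary
  line.\<close>

lemma uniform_from_local:
  fixes P :: "nat \<Rightarrow> real \<Rightarrow> bool"
  assumes mono: "\<And>K L s. K \<le> L \<Longrightarrow> P K s \<Longrightarrow> P L s"
    and loc: "\<And>t. \<exists>K. \<forall>\<^sub>F s in nhds t. P K s" and inf: "\<exists>K. \<forall>\<^sub>F s in at_infinity. P K s"
  shows "\<exists>K. \<forall>s. P K s"
proof -
  from inf obtain K0 b where b: "\<And>s. b \<le> \<bar>s\<bar> \<Longrightarrow> P K0 s" by (auto simp: eventually_at_infinity)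
  have "\<forall>t. \<exists>K U. open U \<and> t \<in> U \<and> (\<forall>s\<in>U. P K s)" using loc unfolding eventually_nhds by meson
  then obtain K U where U: "\<And>t. open (U t)" "\<And>t. t \<in> U t" "\<And>t s. s \<in> U t \<Longrightarrow> P (K t) s" by metis
  obtain T where T: "finite T" "{-b..b} \<subseteq> (\<Union>t\<in>T. U t)"
    by (rule compactE_image[of "{-b..b}" "{-b..b}" U]) (use U in auto)
  have "P (Max (insert K0 (K ` T))) s" for s
  proof (cases "b \<le> \<bar>s\<bar>")
    case True
    then show ?thesis using mono[OF _ b[OF True]] T(1) by simp
  next
    case False
    then have "s \<in> {-b..b}" by auto
    then obtain t where "t \<in> T" "s \<in> U t" using T by blast
    then have "K t \<le> Max (insert K0 (K ` T))" using T(1) by (intro Max_ge) auto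
    then show ?thesis using mono U(3)[OF \<open>s \<in> U t\<close>] by blast
  qed
  then show ?thesis by blast
qed

section \<open>Sums and multipliers\<close>

lemma supn_triangle:
  assumes "bounded (range x)" "bounded (range y)"
  shows "supn (\<lambda>n. x n + y n) \<le> supn x + supn y"
proof (rule supn_least)
  fix n show "cmod (x n + y n) \<le> supn x + supn y"
    using norm_triangle_ineq[of "x n" "y n"] supn_upper[OF assms(1), of n] supn_upper[OF assms(2), of n] by linarith
qed

lemma summable_cmod_add:
  assumes "summable (\<lambda>n. cmod (x n))" "summable (\<lambda>n. cmod (y n))"
  shows "summable (\<lambda>n. cmod (x n + y n))"
  by (rule summable_comparison_test[OF _ summable_add[OF assms]]) (auto simp: norm_triangle_ineq)

lemma summable_cmod_diff:
  assumes "summable (\<lambda>n. cmod (x n))" "summable (\<lambda>n. cmod (y n))"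
  shows "summable (\<lambda>n. cmod (x n - y n))"
  using summable_cmod_add[OF assms(1), of "\<lambda>n. - y n"] assms(2) by simp

lemma sumn_triangle:
  assumes "summable (\<lambda>n. cmod (x n))" "summable (\<lambda>n. cmod (y n))"
  shows "sumn (\<lambda>n. x n + y n) \<le> sumn x + sumn y"
  unfolding sumn_def suminf_add[OF assms]
  by (intro suminf_le summable_cmod_add summable_add assms norm_triangle_ineq)

lemma summable_cmod_mult:
  assumes "summable (\<lambda>n. cmod (x n))" "\<And>n. cmod (m n) \<le> c"
  shows "summable (\<lambda>n. cmod (m n * x n))"
  by (rule summable_comparison_test[OF _ summable_mult[OF assms(1), of c]])
    (auto simp: norm_mult assms(2) mult_right_mono)

lemma sumn_mult:
  assumes "summable (\<lambda>n. cmod (x n))" "\<And>n. cmod (m n) \<le> c"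
  shows "sumn (\<lambda>n. m n * x n) \<le> c * sumn x"
  unfolding sumn_def suminf_mult[OF assms(1), symmetric]
  by (intro suminf_le summable_cmod_mult[OF assms] summable_mult assms) (simp add: norm_mult assms(2) mult_right_mono)

lemma bounded_range_multiplier:
  fixes x :: cseq
  assumes "bounded (range x)" "\<And>n. cmod (m n) \<le> c"
  shows "bounded (range (\<lambda>n. m n * x n))"
proof -
  have "cmod (m n * x n) \<le> c * supn x" for n
    unfolding norm_mult using order_trans[OF norm_ge_zero assms(2)]
    by (intro mult_mono assms supn_upper) auto
  then show ?thesis unfolding bounded_range_cseq by blast
qed

lemma supn_mult:
  assumes "bounded (range x)" "\<And>n. cmod (m n) \<le> c"
  shows "supn (\<lambda>n. m n * x n) \<le> c * supn x"
proof (rule supn_least)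
  show "cmod (m n * x n) \<le> c * supn x" for n
    unfolding norm_mult using order_trans[OF norm_ge_zero assms(2)]
    by (intro mult_mono assms supn_upper) auto
qed

lemma tendsto_supn_add:
  assumes "((\<lambda>s. supn (f s)) \<longlongrightarrow> 0) \<F>" "((\<lambda>s. supn (g s)) \<longlongrightarrow> 0) \<F>"
    and b: "\<And>s. bounded (range (f s))" "\<And>s. bounded (range (g s))"
  shows "((\<lambda>s. supn (\<lambda>n. f s n + g s n)) \<longlongrightarrow> 0) \<F>"
proof (rule Lim_null_comparison[OF always_eventually])
  show "\<forall>s. norm (supn (\<lambda>n. f s n + g s n)) \<le> supn (f s) + supn (g s)"
    using supn_triangle[OF b] supn_nonneg[OF bounded_range_add[OF b]] by simp
  show "((\<lambda>s. supn (f s) + supn (g s)) \<longlongrightarrow> 0) \<F>" using tendsto_add[OF assms(1,2)] by simp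
qed

lemma tendsto_sumn_add:
  assumes "((\<lambda>s. sumn (f s)) \<longlongrightarrow> 0) \<F>" "((\<lambda>s. sumn (g s)) \<longlongrightarrow> 0) \<F>"
    and b: "\<And>s. summable (\<lambda>n. cmod (f s n))" "\<And>s. summable (\<lambda>n. cmod (g s n))"
  shows "((\<lambda>s. sumn (\<lambda>n. f s n + g s n)) \<longlongrightarrow> 0) \<F>"
proof (rule Lim_null_comparison[OF always_eventually])
  show "\<forall>s. norm (sumn (\<lambda>n. f s n + g s n)) \<le> sumn (f s) + sumn (g s)"
    using sumn_triangle[OF b] sumn_nonneg[OF summable_cmod_add[OF b]] by simp
  show "((\<lambda>s. sumn (f s) + sumn (g s)) \<longlongrightarrow> 0) \<F>" using tendsto_add[OF assms(1,2)] by simp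
qed

lemma tendsto_supn_mult:
  assumes "((\<lambda>s. supn (f s)) \<longlongrightarrow> 0) \<F>" and b: "\<And>s. bounded (range (f s))" and m: "\<And>n. cmod (m n) \<le> c"
  shows "((\<lambda>s. supn (\<lambda>n. m n * f s n)) \<longlongrightarrow> 0) \<F>"
proof (rule Lim_null_comparison[OF always_eventually])
  show "\<forall>s. norm (supn (\<lambda>n. m n * f s n)) \<le> c * supn (f s)"
    using supn_mult[OF b m] supn_nonneg[OF bounded_range_multiplier[OF b m]] by simp
  show "((\<lambda>s. c * supn (f s)) \<longlongrightarrow> 0) \<F>" using tendsto_mult_left[OF assms(1), of c] by simp
qed

lemma tendsto_sumn_mult:
  assumes "((\<lambda>s. sumn (f s)) \<longlongrightarrow> 0) \<F>" and b: "\<And>s. summable (\<lambda>n. cmod (f s n))" and m: "\<And>n. cmod (m n) \<le> c"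
  shows "((\<lambda>s. sumn (\<lambda>n. m n * f s n)) \<longlongrightarrow> 0) \<F>"
proof (rule Lim_null_comparison[OF always_eventually])
  show "\<forall>s. norm (sumn (\<lambda>n. m n * f s n)) \<le> c * sumn (f s)"
    using sumn_mult[OF b m] sumn_nonneg[OF summable_cmod_mult[OF b m]] by simp
  show "((\<lambda>s. c * sumn (f s)) \<longlongrightarrow> 0) \<F>" using tendsto_mult_left[OF assms(1), of c] by simp
qed

lemma C0_curve_linf:
  "C0_curve linf f \<longleftrightarrow> (\<forall>t. bounded (range (f t))) \<and> (\<forall>t. ((\<lambda>s. supn (\<lambda>n. f s n - f t n)) \<longlongrightarrow> 0) (at t)) \<and>
     ((\<lambda>t. supn (f t)) \<longlongrightarrow> 0) at_infinity"
  by (simp add: C0_curve_def)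

lemma C0_curve_l1:
  "C0_curve l1 f \<longleftrightarrow> (\<forall>t. summable (\<lambda>n. cmod (f t n))) \<and> (\<forall>t. ((\<lambda>s. sumn (\<lambda>n. f s n - f t n)) \<longlongrightarrow> 0) (at t)) \<and>
     ((\<lambda>t. sumn (f t)) \<longlongrightarrow> 0) at_infinity"
  by (simp add: C0_curve_def)

lemma calderon_add:
  assumes F: "F \<in> vcarrier calderon" and G: "G \<in> vcarrier calderon"
  shows "(\<lambda>z n. F z n + G z n) \<in> vcarrier calderon"
proof -
  note b = calderonD(2)[OF F] calderonD(2)[OF G]
  obtain B1 where B1: "\<And>z n. cmod (F z n) \<le> B1" using calderonD(3)[OF F] by blast
  obtain B2 where B2: "\<And>z n. cmod (G z n) \<le> B2" using calderonD(3)[OF G] by blast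
  have eq: "(\<lambda>n. F w n + G w n - (F z n + G z n)) = (\<lambda>n. (F w n - F z n) + (G w n - G z n))" for w z
    by auto
  have C: "C0_curve linf (\<lambda>t. F (Complex 0 t))" "C0_curve linf (\<lambda>t. G (Complex 0 t))"
    "C0_curve l1 (\<lambda>t. F (Complex 1 t))" "C0_curve l1 (\<lambda>t. G (Complex 1 t))"
    using calderonD(7,8) F G by auto
  show ?thesis
  proof (rule calderonI)
    show "(\<lambda>n. F z n + G z n) = (\<lambda>n. 0)" if "z \<notin> strip" for z
      using calderonD(1)[OF F that] calderonD(1)[OF G that] by simp
    show "cmod (F z n + G z n) \<le> B1 + B2" for z n
      using norm_triangle_ineq[of "F z n" "G z n"] B1[of z n] B2[of z n] by linarith
    show "((\<lambda>w. supn (\<lambda>n. F w n + G w n - (F z n + G z n))) \<longlongrightarrow> 0) (at z within strip)" if "z \<in> strip" for z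
      unfolding eq by (intro tendsto_supn_add calderonD(4) bounded_range_diff F G that b)
    show "(\<lambda>z. F z n + G z n) holomorphic_on open_strip" for n
      by (intro holomorphic_intros calderonD(5) F G)
    show "C0_curve linf (\<lambda>t n. F (Complex 0 t) n + G (Complex 0 t) n)"
      unfolding C0_curve_linf eq using C(1,2) unfolding C0_curve_linf
      by (intro conjI allI tendsto_supn_add bounded_range_add bounded_range_diff b) auto
    show "C0_curve l1 (\<lambda>t n. F (Complex 1 t) n + G (Complex 1 t) n)"
      unfolding C0_curve_l1 eq using C(3,4) unfolding C0_curve_l1
      by (intro conjI allI tendsto_sumn_add summable_cmod_add summable_cmod_diff) auto
  qed
qed

text \<open>Covers both multiplication by scalars and truncation to a set of coordinates.\<close>

lemma calderon_multiplier:
  assumes F: "F \<in> vcarrier calderon" and m: "\<And>n. cmod (m n) \<le> c"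
  shows "(\<lambda>z n. m n * F z n) \<in> vcarrier calderon"
proof -
  note b = calderonD(2)[OF F]
  obtain B where B: "\<And>z n. cmod (F z n) \<le> B" using calderonD(3)[OF F] by blast
  have eq: "(\<lambda>n. m n * F w n - m n * F z n) = (\<lambda>n. m n * (F w n - F z n))" for w z
    by (auto simp: algebra_simps)
  have c: "0 \<le> c" using m[of 0] norm_ge_zero order_trans by blast
  have C: "C0_curve linf (\<lambda>t. F (Complex 0 t))" "C0_curve l1 (\<lambda>t. F (Complex 1 t))"
    using calderonD(7,8) F by auto
  show ?thesis
  proof (rule calderonI)
    show "(\<lambda>n. m n * F z n) = (\<lambda>n. 0)" if "z \<notin> strip" for z
      using calderonD(1)[OF F that] by simp
    show "cmod (m n * F z n) \<le> c * B" for z n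
      unfolding norm_mult by (intro mult_mono m B c) auto
    show "((\<lambda>w. supn (\<lambda>n. m n * F w n - m n * F z n)) \<longlongrightarrow> 0) (at z within strip)" if "z \<in> strip" for z
      unfolding eq by (intro tendsto_supn_mult[OF _ _ m] calderonD(4) bounded_range_diff F that b)
    show "(\<lambda>z. m n * F z n) holomorphic_on open_strip" for n
      by (intro holomorphic_intros calderonD(5) F)
    show "C0_curve linf (\<lambda>t n. m n * F (Complex 0 t) n)"
      unfolding C0_curve_linf eq using C(1) unfolding C0_curve_linf
      by (intro conjI allI tendsto_supn_mult[OF _ _ m] bounded_range_multiplier[OF _ m] bounded_range_diff b) auto
    show "C0_curve l1 (\<lambda>t n. m n * F (Complex 1 t) n)"
      unfolding C0_curve_l1 eq using C(2) unfolding C0_curve_l1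
      by (intro conjI allI tendsto_sumn_mult[OF _ _ m] summable_cmod_mult[OF _ m] summable_cmod_diff) auto
  qed
qed

section \<open>The norm of the Calderon space\<close>

lemma calderon_summable: "F \<in> vcarrier calderon \<Longrightarrow> summable (\<lambda>n. cmod (F (Complex 1 t) n))"
  by (drule calderonD(8)) (simp add: C0_curve_l1)

lemma calderon_at_infinity:
  assumes "F \<in> vcarrier calderon" "0 < e"
  shows "\<forall>\<^sub>F t in at_infinity. supn (F (Complex 0 t)) < e" "\<forall>\<^sub>F t in at_infinity. sumn (F (Complex 1 t)) < e"
proof -
  have "((\<lambda>t. supn (F (Complex 0 t))) \<longlongrightarrow> 0) at_infinity" "((\<lambda>t. sumn (F (Complex 1 t))) \<longlongrightarrow> 0) at_infinity"
    using calderonD(7,8)[OF assms(1)] by (simp_all add: C0_curve_linf C0_curve_l1)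
  from this[THEN order_tendstoD(2), OF assms(2)] show "\<forall>\<^sub>F t in at_infinity. supn (F (Complex 0 t)) < e"
    "\<forall>\<^sub>F t in at_infinity. sumn (F (Complex 1 t)) < e" by auto
qed

lemma eventually_nhds_diff:
  fixes d :: "real \<Rightarrow> real"
  assumes "(d \<longlongrightarrow> 0) (at t)" "d t = 0" "0 < e"
  shows "\<forall>\<^sub>F s in nhds t. d s < e"
  unfolding eventually_nhds_conv_at using order_tendstoD(2)[OF assms(1,3)] assms by simp

text \<open>The definition bounds a function in \<open>Sigma_space\<close> only; for the ell_1 norm
  on the right line the bound comes from continuity and decay at infinity. It makes the suprema in
  the norm genuine ones.\<close>

lemma calderon_bdd:
  assumes F: "F \<in> vcarrier calderon"
  shows "\<exists>B. \<forall>t. supn (F (Complex 0 t)) \<le> B" and "\<exists>B. \<forall>t. sumn (F (Complex 1 t)) \<le> B"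
proof -
  show "\<exists>B. \<forall>t. supn (F (Complex 0 t)) \<le> B" using calderonD(3)[OF F] supn_least by meson
  have C: "C0_curve l1 (\<lambda>t. F (Complex 1 t))" using calderonD(8)[OF F] .
  have "\<exists>K::nat. \<forall>t. sumn (F (Complex 1 t)) \<le> real K"
  proof (rule uniform_from_local)
    show "sumn (F (Complex 1 s)) \<le> real L" if "K \<le> L" "sumn (F (Complex 1 s)) \<le> real K" for K L s
      using that by linarith
    have "\<forall>\<^sub>F s in at_infinity. sumn (F (Complex 1 s)) < 1"
      by (rule calderon_at_infinity(2)[OF F]) simp
    then show "\<exists>K. \<forall>\<^sub>F s in at_infinity. sumn (F (Complex 1 s)) \<le> real K"
      by (intro exI[of _ 1]) (auto elim: eventually_mono)
    fix t
    have "\<forall>\<^sub>F s in nhds t. sumn (\<lambda>n. F (Complex 1 s) n - F (Complex 1 t) n) < 1"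
      by (rule eventually_nhds_diff) (use C in \<open>auto simp: C0_curve_l1 sumn_def\<close>)
    moreover obtain K :: nat where K: "sumn (F (Complex 1 t)) + 1 \<le> real K" using real_arch_simple by blast
    ultimately show "\<exists>K. \<forall>\<^sub>F s in nhds t. sumn (F (Complex 1 s)) \<le> real K"
    proof (intro exI[of _ K], elim eventually_mono)
      fix s assume "sumn (\<lambda>n. F (Complex 1 s) n - F (Complex 1 t) n) < 1"
      moreover have "sumn (F (Complex 1 s)) \<le> sumn (\<lambda>n. F (Complex 1 s) n - F (Complex 1 t) n) + sumn (F (Complex 1 t))"
        using sumn_triangle[OF summable_cmod_diff[OF calderon_summable[OF F, of s] calderon_summable[OF F, of t]] calderon_summable[OF F, of t]] by simp
      ultimately show "sumn (F (Complex 1 s)) \<le> real K" using K by linarith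
    qed
  qed
  then show "\<exists>B. \<forall>t. sumn (F (Complex 1 t)) \<le> B" by blast
qed

lemma vnorm_calderon: "vnorm calderon F = max (SUP t. supn (F (Complex 0 t))) (SUP t. sumn (F (Complex 1 t)))"
  by (simp add: calderon_def)

lemma calderon_norm_upper:
  assumes F: "F \<in> vcarrier calderon"
  shows "cmod (F (Complex 0 t) n) \<le> vnorm calderon F" and "sumn (F (Complex 1 t)) \<le> vnorm calderon F"
    and "finite I \<Longrightarrow> (\<Sum>n\<in>I. cmod (F (Complex 1 t) n)) \<le> vnorm calderon F" and "0 \<le> vnorm calderon F"
proof -
  have "supn (F (Complex 0 t)) \<le> (SUP t. supn (F (Complex 0 t)))"
    by (rule cSUP_upper) (use calderon_bdd[OF F] in \<open>auto simp: bdd_above_def\<close>)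
  then show *: "cmod (F (Complex 0 t) n) \<le> vnorm calderon F"
    using supn_upper[OF calderonD(2)[OF F], of "Complex 0 t" n] unfolding vnorm_calderon by linarith
  then show "0 \<le> vnorm calderon F" using norm_ge_zero order_trans by blast
  have "sumn (F (Complex 1 t)) \<le> (SUP t. sumn (F (Complex 1 t)))"
    by (rule cSUP_upper) (use calderon_bdd[OF F] in \<open>auto simp: bdd_above_def\<close>)
  then show **: "sumn (F (Complex 1 t)) \<le> vnorm calderon F"
    unfolding vnorm_calderon by linarith
  show "finite I \<Longrightarrow> (\<Sum>n\<in>I. cmod (F (Complex 1 t) n)) \<le> vnorm calderon F"
    using ** sum_cmod_le_sumn[OF calderon_summable[OF F]] order_trans by blast
qed

lemma calderon_norm_least:
  assumes "\<And>t n. cmod (F (Complex 0 t) n) \<le> M" "\<And>t. sumn (F (Complex 1 t)) \<le> M"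
  shows "vnorm calderon F \<le> M"
  unfolding vnorm_calderon using assms by (intro max.boundedI cSUP_least supn_least) auto

lemma calderon_triangle:
  assumes F: "F \<in> vcarrier calderon" and G: "G \<in> vcarrier calderon"
  shows "vnorm calderon (\<lambda>z n. F z n + G z n) \<le> vnorm calderon F + vnorm calderon G"
proof (rule calderon_norm_least)
  fix t n
  show "cmod (F (Complex 0 t) n + G (Complex 0 t) n) \<le> vnorm calderon F + vnorm calderon G"
    using norm_triangle_ineq calderon_norm_upper(1)[OF F] calderon_norm_upper(1)[OF G] add_mono order_trans by meson
  show "sumn (\<lambda>n. F (Complex 1 t) n + G (Complex 1 t) n) \<le> vnorm calderon F + vnorm calderon G"
    using sumn_triangle[OF calderon_summable[OF F] calderon_summable[OF G]]
      calderon_norm_upper(2)[OF F] calderon_norm_upper(2)[OF G] add_mono order_trans by meson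
qed

section \<open>Functions with finitely many coordinates\<close>

lemma finite_support:
  fixes x :: cseq
  assumes "\<And>n. K \<le> n \<Longrightarrow> x n = 0"
  shows "summable (\<lambda>n. cmod (x n))" "sumn x = (\<Sum>n<K. cmod (x n))" "bounded (range x)" "supn x \<le> (\<Sum>n<K. cmod (x n))"
proof -
  have "(\<lambda>n. cmod (x n)) sums (\<Sum>n<K. cmod (x n))" by (rule sums_finite) (use assms in auto)
  then show s: "summable (\<lambda>n. cmod (x n))" "sumn x = (\<Sum>n<K. cmod (x n))"
    unfolding sumn_def by (auto simp: sums_iff)
  show "bounded (range x)" "supn x \<le> (\<Sum>n<K. cmod (x n))"
    using cmod_le_sumn[OF s(1)] s(2) supn_least by (auto simp: bounded_range_cseq)
qed

lemma continuous_Complex: "continuous_on UNIV (\<lambda>t. Complex a t)"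
  unfolding complex_eq_iff complex_of_real_def[symmetric] Complex_eq by (intro continuous_intros)

text \<open>With \<open>K\<close> coordinates both sequence norms are at most the finite sum of
  moduli, so scalar continuity and scalar decay on the boundary lines suffice.\<close>

lemma calderon_finite:
  fixes e :: "nat \<Rightarrow> complex \<Rightarrow> complex"
  assumes cont: "\<And>k. continuous_on strip (e k)" and hol: "\<And>k. e k holomorphic_on open_strip"
    and bnd: "\<And>k. \<exists>B. \<forall>z\<in>strip. cmod (e k z) \<le> B"
    and lim: "\<And>k. ((\<lambda>t. e k (Complex 0 t)) \<longlongrightarrow> 0) at_infinity" "\<And>k. ((\<lambda>t. e k (Complex 1 t)) \<longlongrightarrow> 0) at_infinity"
  shows "(\<lambda>z n. if z \<in> strip \<and> n < K then e n z else 0) \<in> vcarrier calderon" (is "?F \<in> _")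
proof -
  obtain B where B: "\<And>k z. z \<in> strip \<Longrightarrow> cmod (e k z) \<le> B k" using bnd by metis
  have supp: "?F z n = 0" "?F z n - ?F w n = 0" if "K \<le> n" for z w n using that by auto
  have lim_at: "((\<lambda>s. \<Sum>n<K. cmod (?F s n - ?F z n)) \<longlongrightarrow> 0) (at z within strip)" if z: "z \<in> strip" for z
  proof -
    have "((\<lambda>s. \<Sum>n<K. cmod (e n s - e n z)) \<longlongrightarrow> (\<Sum>n<K. cmod (e n z - e n z))) (at z within strip)"
      by (intro tendsto_intros) (use cont z in \<open>auto simp: continuous_on\<close>)
    moreover have "\<forall>\<^sub>F s in at z within strip. (\<Sum>n<K. cmod (?F s n - ?F z n)) = (\<Sum>n<K. cmod (e n s - e n z))"
      by (rule eventually_at_topological[THEN iffD2], intro exI[of _ UNIV]) (use z in auto)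
    ultimately show ?thesis by (simp add: tendsto_cong)
  qed
  have lim_curve: "((\<lambda>s. \<Sum>n<K. cmod (?F (Complex a s) n - ?F (Complex a t) n)) \<longlongrightarrow> 0) (at t)"
    if a: "0 \<le> a" "a \<le> 1" for a t
  proof -
    \<comment> \<open>The vertical curve stays in the strip and avoids its own point, so continuity
      along it is inherited from continuity on the strip.\<close>
    have "filterlim (\<lambda>s. Complex a s) (at (Complex a t) within strip) (at t)"
      unfolding filterlim_at
    proof
      show "((\<lambda>s. Complex a s) \<longlongrightarrow> Complex a t) (at t)"
        using continuous_Complex by (simp add: continuous_on_def)
      show "\<forall>\<^sub>F s in at t. Complex a s \<in> strip \<and> Complex a s \<noteq> Complex a t"
        using a by (auto simp: eventually_at_filter strip_iff)
    qed
    from filterlim_compose[OF lim_at this] a show ?thesis by (simp add: strip_iff)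
  qed
  have lim_inf: "((\<lambda>t. \<Sum>n<K. cmod (?F (Complex a t) n)) \<longlongrightarrow> 0) at_infinity" if a: "a = 0 \<or> a = 1" for a
  proof -
    have "((\<lambda>t. \<Sum>n<K. cmod (e n (Complex a t))) \<longlongrightarrow> (\<Sum>n<K. cmod 0)) at_infinity"
      by (intro tendsto_intros) (use a lim in auto)
    then show ?thesis using a by (auto simp: strip_iff)
  qed
  have sq: "((\<lambda>s. supn (f s)) \<longlongrightarrow> 0) \<F>" "((\<lambda>s. sumn (f s)) \<longlongrightarrow> 0) \<F>"
    if "((\<lambda>s. \<Sum>n<K. cmod (f s n)) \<longlongrightarrow> 0) \<F>" "\<And>s n. K \<le> n \<Longrightarrow> f s n = 0" for f :: "'b \<Rightarrow> cseq" and \<F>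
  proof -
    note f = finite_support[of K "f _", OF that(2)]
    show "((\<lambda>s. supn (f s)) \<longlongrightarrow> 0) \<F>"
      by (rule Lim_null_comparison[OF always_eventually that(1)]) (use f(4) supn_nonneg[OF f(3)] in simp)
    show "((\<lambda>s. sumn (f s)) \<longlongrightarrow> 0) \<F>" using that(1) f(2) by simp
  qed
  show ?thesis
  proof (rule calderonI)
    show "?F z = (\<lambda>n. 0)" if "z \<notin> strip" for z using that by simp
    show "cmod (?F z n) \<le> (\<Sum>k<K. \<bar>B k\<bar>)" if "z \<in> strip" for z n
    proof (cases "n < K")
      case True
      then have "\<bar>B n\<bar> \<le> (\<Sum>k<K. \<bar>B k\<bar>)" by (intro member_le_sum) auto
      then show ?thesis using True B[OF that, of n] that by simp
    qed (simp add: sum_nonneg)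
    show "((\<lambda>w. supn (\<lambda>n. ?F w n - ?F z n)) \<longlongrightarrow> 0) (at z within strip)" if "z \<in> strip" for z
      by (rule sq(1)[OF lim_at[OF that]]) auto
    show "(\<lambda>z. ?F z n) holomorphic_on open_strip" for n
    proof (cases "n < K")
      case True
      show ?thesis by (rule holomorphic_transform[OF hol[of n]]) (use True open_strip_subset in auto)
    next
      case False
      then show ?thesis by simp
    qed
    show "C0_curve linf (\<lambda>t. ?F (Complex 0 t))" unfolding C0_curve_linf
      by (intro conjI allI sq(1)[OF lim_curve] sq(1)[OF lim_inf] finite_support(3)[where K=K] supp) auto
    show "C0_curve l1 (\<lambda>t. ?F (Complex 1 t))" unfolding C0_curve_l1
      by (intro conjI allI sq(2)[OF lim_curve] sq(2)[OF lim_inf] finite_support(1)[where K=K] supp) auto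
  qed
qed

section \<open>Tails\<close>

definition cut :: "nat \<Rightarrow> nat \<Rightarrow> complex" where "cut K n = (if n < K then 0 else 1)"

lemma cut_le [simp]: "cmod (cut K n) \<le> 1" by (simp add: cut_def)

lemma sumn_cut_mono:
  assumes "summable (\<lambda>n. cmod (x n))" "K \<le> L"
  shows "sumn (\<lambda>n. cut L n * x n) \<le> sumn (\<lambda>n. cut K n * x n)"
proof -
  have "sumn (\<lambda>n. cut L n * (cut K n * x n)) \<le> 1 * sumn (\<lambda>n. cut K n * x n)"
    by (intro sumn_mult summable_cmod_mult[OF assms(1) cut_le] cut_le)
  moreover have "(\<lambda>n. cut L n * (cut K n * x n)) = (\<lambda>n. cut L n * x n)" using assms(2) by (auto simp: cut_def)
  ultimately show ?thesis by simp
qed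

lemma sumn_cut_small:
  assumes "summable (\<lambda>n. cmod (x n))" "0 < e"
  shows "\<exists>K. sumn (\<lambda>n. cut K n * x n) < e"
proof -
  obtain K where "\<forall>n\<ge>K. norm (\<Sum>i. cmod (x (i + n))) < e" using suminf_exist_split[OF assms(2,1)] by blast
  then have K: "(\<Sum>i. cmod (x (i + K))) < e" by (auto dest: spec[of _ K])
  have "sumn (\<lambda>n. cut K n * x n) = (\<Sum>i. cmod (cut K (i + K) * x (i + K))) + (\<Sum>i<K. cmod (cut K i * x i))"
    unfolding sumn_def by (intro suminf_split_initial_segment summable_cmod_mult[OF assms(1) cut_le])
  also have "\<dots> = (\<Sum>i. cmod (x (i + K)))" by (simp add: cut_def)
  finally have "sumn (\<lambda>n. cut K n * x n) < e" using K by linarith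
  then show ?thesis by blast
qed

text \<open>For a fixed \<open>t\<close> the tails of a summable sequence tend to zero; half of
  \<open>e\<close> is kept for the passage to nearby parameters, and
  \<open>uniform_from_local\<close> makes the cut-off independent of \<open>t\<close>.\<close>

lemma tail_l1:
  assumes F: "F \<in> vcarrier calderon" and e: "0 < e"
  shows "\<exists>K. \<forall>t. sumn (\<lambda>n. cut K n * F (Complex 1 t) n) \<le> e"
proof (rule uniform_from_local)
  have C: "C0_curve l1 (\<lambda>t. F (Complex 1 t))" using calderonD(8)[OF F] .
  note s = calderon_summable[OF F]
  note sc = summable_cmod_mult[OF s cut_le]
  show "sumn (\<lambda>n. cut L n * F (Complex 1 t) n) \<le> e" if "K \<le> L" "sumn (\<lambda>n. cut K n * F (Complex 1 t) n) \<le> e" for K L t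
    using sumn_cut_mono[OF s that(1)] that(2) order_trans by blast
  have "\<forall>\<^sub>F t in at_infinity. sumn (F (Complex 1 t)) < e"
    by (rule calderon_at_infinity(2)[OF F e])
  then show "\<exists>K. \<forall>\<^sub>F t in at_infinity. sumn (\<lambda>n. cut K n * F (Complex 1 t) n) \<le> e"
    by (intro exI[of _ 0]) (auto elim!: eventually_mono simp: cut_def)
  fix t
  obtain K where K: "sumn (\<lambda>n. cut K n * F (Complex 1 t) n) < e/2" using sumn_cut_small[OF s] e half_gt_zero by blast
  have "\<forall>\<^sub>F s in nhds t. sumn (\<lambda>n. F (Complex 1 s) n - F (Complex 1 t) n) < e/2"
    by (rule eventually_nhds_diff) (use C e in \<open>auto simp: C0_curve_l1 sumn_def\<close>)
  then show "\<exists>K. \<forall>\<^sub>F s in nhds t. sumn (\<lambda>n. cut K n * F (Complex 1 s) n) \<le> e"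
  proof (intro exI[of _ K], elim eventually_mono)
    fix u assume u: "sumn (\<lambda>n. F (Complex 1 u) n - F (Complex 1 t) n) < e/2"
    note sd = summable_cmod_diff[OF s[of u] s[of t]]
    have "sumn (\<lambda>n. cut K n * F (Complex 1 u) n) = sumn (\<lambda>n. cut K n * (F (Complex 1 u) n - F (Complex 1 t) n) + cut K n * F (Complex 1 t) n)"
      by (simp add: algebra_simps)
    also have "\<dots> \<le> sumn (\<lambda>n. cut K n * (F (Complex 1 u) n - F (Complex 1 t) n)) + sumn (\<lambda>n. cut K n * F (Complex 1 t) n)"
      by (intro sumn_triangle sc summable_cmod_mult[OF sd cut_le])
    also have "sumn (\<lambda>n. cut K n * (F (Complex 1 u) n - F (Complex 1 t) n)) \<le> 1 * sumn (\<lambda>n. F (Complex 1 u) n - F (Complex 1 t) n)"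
      by (intro sumn_mult sd cut_le)
    finally show "sumn (\<lambda>n. cut K n * F (Complex 1 u) n) \<le> e" using u K by simp
  qed
qed

lemma calderon_diff_le:
  "F \<in> vcarrier calderon \<Longrightarrow> cmod (F w n - F z n) \<le> supn (\<lambda>n. F w n - F z n)"
  by (rule supn_upper[OF bounded_range_diff[OF calderonD(2) calderonD(2)]])

text \<open>By the three lines theorem the coordinates of \<open>F (s + it)\<close> tend to zero for \<open>s > 0\<close>;
  continuity in the norm of \<open>\<Sigma>\<close> carries this over to \<open>s = 0\<close>.\<close>

lemma calderon_boundary_null:
  assumes F: "F \<in> vcarrier calderon" and e: "0 < e"
  shows "\<exists>K. \<forall>n\<ge>K. cmod (F (Complex 0 t) n) \<le> e"
proof -
  obtain B0 where "\<And>z n. cmod (F z n) \<le> B0" using calderonD(3)[OF F] by blast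
  then obtain B where B: "\<And>z n. cmod (F z n) \<le> B" "1 \<le> B" by (meson max.cobounded1 max.cobounded2 order_trans)
  have "((\<lambda>w. supn (\<lambda>n. F w n - F (Complex 0 t) n)) \<longlongrightarrow> 0) (at (Complex 0 t) within strip)"
    by (rule calderonD(4)[OF F]) (simp add: strip_iff)
  then have "\<forall>\<^sub>F w in at (Complex 0 t) within strip. supn (\<lambda>n. F w n - F (Complex 0 t) n) < e/2"
    using e by (intro order_tendstoD(2)) auto
  then obtain d where d: "0 < d" "\<And>w. w \<in> strip \<Longrightarrow> w \<noteq> Complex 0 t \<Longrightarrow> dist w (Complex 0 t) < d \<Longrightarrow>
      supn (\<lambda>n. F w n - F (Complex 0 t) n) < e/2"
    unfolding eventually_at by blast
  \<comment> \<open>Half of \<open>d\<close> gives a point with positive real part which is still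
    close enough to the boundary point for the continuity estimate.\<close>
  define s where "s = min 1 (d/2)"
  have s: "0 < s" "s \<le> 1" "s < d" using d(1) by (auto simp: s_def)
  define w where "w = Complex s t"
  have w: "w \<in> strip" "w \<noteq> Complex 0 t" "dist w (Complex 0 t) < d"
    using s by (auto simp: w_def strip_iff dist_norm cmod_def)
  \<comment> \<open>The weight exp (L z) compensates values of size exp (-L) on the right line and
    costs nothing on the left one. At real part \<open>s\<close> it yields the bound B exp (-s L),
    which this \<open>L\<close> makes equal to e/2.\<close>
  define L where "L = ln (2 * B / e) / s"
  have L: "B * exp (- s * L) = e/2" using s e B(2) by (simp add: L_def exp_minus)
  obtain K where K: "\<And>t. sumn (\<lambda>n. cut K n * F (Complex 1 t) n) \<le> exp (-L)" using tail_l1[OF F, of "exp (-L)"] by auto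
  have small: "cmod (F (Complex 1 t) n) \<le> exp (-L)" if "K \<le> n" for t n
  proof -
    have "cmod (cut K n * F (Complex 1 t) n) \<le> sumn (\<lambda>n. cut K n * F (Complex 1 t) n)"
      by (intro cmod_le_sumn summable_cmod_mult[OF calderon_summable[OF F] cut_le])
    then show ?thesis using K[of t] that by (simp add: cut_def)
  qed
  have "cmod (F (Complex 0 t) n) \<le> e" if n: "K \<le> n" for n
  proof -
    define S where "S z = F z n * exp (of_real L * z)" for z
    have "cmod (S w) \<le> B"
    proof (rule strip_max[OF _ _ _ _ _ w(1)])
      show "continuous_on strip S" unfolding S_def by (intro continuous_intros calderonD(6)[OF F])
      show "S holomorphic_on open_strip" unfolding S_def by (intro holomorphic_intros calderonD(5)[OF F])
      show "cmod (S z) \<le> B * exp \<bar>L\<bar>" if "z \<in> strip" for z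
      proof -
        have "\<bar>L * Re z\<bar> \<le> \<bar>L\<bar> * 1" unfolding abs_mult using that by (intro mult_left_mono) (auto simp: strip_def)
        then have "exp (L * Re z) \<le> exp \<bar>L\<bar>" by simp
        then show ?thesis unfolding S_def norm_mult using B by (intro mult_mono) auto
      qed
      show "cmod (S (Complex 0 t)) \<le> B" for t using B(1) by (simp add: S_def norm_mult)
      show "cmod (S (Complex 1 t)) \<le> B" for t
      proof -
        have "cmod (S (Complex 1 t)) \<le> exp (-L) * exp L" unfolding S_def norm_mult
          using small[OF n, of t] by (intro mult_mono) auto
        then show ?thesis using B(2) by (simp add: exp_minus)
      qed
    qed
    then have "cmod (F w n) * exp (s * L) \<le> B" by (simp add: S_def norm_mult w_def mult.commute)
    then have "cmod (F w n) \<le> B * exp (- s * L)" by (simp add: exp_minus field_simps)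
    moreover have "cmod (F w n - F (Complex 0 t) n) < e/2"
      using calderon_diff_le[OF F, of w n "Complex 0 t"] d(2)[OF w] by linarith
    ultimately show ?thesis using L norm_triangle_ineq3[of "F w n" "F (Complex 0 t) n"] by linarith
  qed
  then show ?thesis by blast
qed

text \<open>A bounded sequence has no small tails in general, so the pointwise input is
  \<open>calderon_boundary_null\<close>; the rest is the compactness argument of
  \<open>tail_l1\<close>.\<close>

lemma tail_linf:
  assumes F: "F \<in> vcarrier calderon" and e: "0 < e"
  shows "\<exists>K. \<forall>t. \<forall>n\<ge>K. cmod (F (Complex 0 t) n) \<le> e"
proof (rule uniform_from_local)
  have C: "C0_curve linf (\<lambda>t. F (Complex 0 t))" using calderonD(7)[OF F] .
  have up: "cmod (F (Complex 0 t) n) \<le> supn (F (Complex 0 t))" for t n using supn_upper calderonD(2)[OF F] by blast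
  show "\<forall>n\<ge>L. cmod (F (Complex 0 t) n) \<le> e" if "K \<le> L" "\<forall>n\<ge>K. cmod (F (Complex 0 t) n) \<le> e" for K L t
    using that by auto
  have "\<forall>\<^sub>F t in at_infinity. supn (F (Complex 0 t)) < e"
    by (rule calderon_at_infinity(1)[OF F e])
  then show "\<exists>K. \<forall>\<^sub>F t in at_infinity. \<forall>n\<ge>K. cmod (F (Complex 0 t) n) \<le> e"
    by (intro exI[of _ 0]) (auto elim!: eventually_mono intro: order_trans[OF up])
  fix t
  obtain K where K: "\<And>n. n \<ge> K \<Longrightarrow> cmod (F (Complex 0 t) n) \<le> e/2" using calderon_boundary_null[OF F] e half_gt_zero by blast
  have "\<forall>\<^sub>F s in nhds t. supn (\<lambda>n. F (Complex 0 s) n - F (Complex 0 t) n) < e/2"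
    by (rule eventually_nhds_diff) (use C e in \<open>auto simp: C0_curve_linf supn_def\<close>)
  then show "\<exists>K. \<forall>\<^sub>F s in nhds t. \<forall>n\<ge>K. cmod (F (Complex 0 s) n) \<le> e"
  proof (intro exI[of _ K], elim eventually_mono, intro allI impI)
    fix u n assume u: "supn (\<lambda>n. F (Complex 0 u) n - F (Complex 0 t) n) < e/2" and n: "K \<le> n"
    have "cmod (F (Complex 0 u) n - F (Complex 0 t) n) < e/2"
      using calderon_diff_le[OF F, of "Complex 0 u" n "Complex 0 t"] u by linarith
    then show "cmod (F (Complex 0 u) n) \<le> e" using K[OF n] norm_triangle_ineq2[of "F (Complex 0 u) n" "F (Complex 0 t) n"] by linarith
  qed
qed

text \<open>Functions with finitely many nonzero coordinates are dense in the Calderon space. The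
  claim is made for all large \<open>L\<close> so that finitely many functions can share one
  cut-off.\<close>

lemma calderon_tail:
  assumes F: "F \<in> vcarrier calderon" and e: "0 < e"
  shows "\<exists>K. \<forall>L\<ge>K. vnorm calderon (\<lambda>z n. cut L n * F z n) \<le> e"
proof -
  obtain K1 where K1: "\<And>t. sumn (\<lambda>n. cut K1 n * F (Complex 1 t) n) \<le> e" using tail_l1[OF F e] by blast
  obtain K2 where K2: "\<And>t n. n \<ge> K2 \<Longrightarrow> cmod (F (Complex 0 t) n) \<le> e" using tail_linf[OF F e] by blast
  have "vnorm calderon (\<lambda>z n. cut L n * F z n) \<le> e" if "max K1 K2 \<le> L" for L
  proof (rule calderon_norm_least)
    show "cmod (cut L n * F (Complex 0 t) n) \<le> e" for t n using K2[of n t] that e by (auto simp: cut_def)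
    show "sumn (\<lambda>n. cut L n * F (Complex 1 t) n) \<le> e" for t
      using sumn_cut_mono[OF calderon_summable[OF F, of t], of K1 L] K1[of t] that by linarith
  qed
  then show ?thesis by blast
qed

section \<open>Images of the maps Delta\<close>

lemma Delta_eq:
  assumes F: "F \<in> vcarrier calderon" and k: "k \<le> 2"
  shows "Delta k F n = (deriv ^^ k) (\<lambda>z. F z n) (1/2) / fact k"
proof -
  from k consider "k = 0" | "k = Suc 0" | "k = 2" by linarith
  then show ?thesis by cases (simp_all add: Delta_1_2[OF F])
qed

lemma Delta_add:
  assumes F: "F \<in> vcarrier calderon" and G: "G \<in> vcarrier calderon" and k: "k \<le> 2"
  shows "Delta k (\<lambda>z n. F z n + G z n) n = Delta k F n + Delta k G n"
  unfolding Delta_eq[OF F k] Delta_eq[OF G k] Delta_eq[OF calderon_add[OF F G] k]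
  by (subst higher_deriv_add[OF calderonD(5)[OF F] calderonD(5)[OF G] open_open_strip half_in_open_strip])
    (simp add: add_divide_distrib)

lemma calderon_scale: "F \<in> vcarrier calderon \<Longrightarrow> (\<lambda>z n. c * F z n) \<in> vcarrier calderon"
  by (rule calderon_multiplier[of F "\<lambda>_. c" "cmod c"]) auto

lemma Delta_scale:
  assumes F: "F \<in> vcarrier calderon" and k: "k \<le> 2"
  shows "Delta k (\<lambda>z n. c * F z n) n = c * Delta k F n"
proof -
  have cF: "(\<lambda>z n. c * F z n) \<in> vcarrier calderon" by (rule calderon_scale[OF F])
  show ?thesis unfolding Delta_eq[OF F k] Delta_eq[OF cF k]
    by (subst higher_deriv_cmult[OF calderonD(5)[OF F] half_in_open_strip open_open_strip]) simp
qed

lemma calderon_ops [simp]: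
  "vadd calderon F G = (\<lambda>z n. F z n + G z n)" "vscale calderon c F = (\<lambda>z n. c * F z n)"
  by (simp_all add: calderon_def)

text \<open>Covers \<open>calderon\<close> and the kernels of the maps \<open>Delta k\<close> alike,
  so that the facts on \<open>pair_image\<close> serve all three spaces of the theorem.\<close>

definition calderon_subspace :: "(complex \<Rightarrow> cseq) cnormed \<Rightarrow> bool" where
  "calderon_subspace K \<longleftrightarrow> (\<exists>S \<subseteq> vcarrier calderon. K = subspace_of calderon S) \<and> vclosed K"

lemma calderon_subspaceD:
  assumes "calderon_subspace K"
  shows "F \<in> vcarrier K \<Longrightarrow> F \<in> vcarrier calderon" "vnorm K = vnorm calderon"
    "vadd K = vadd calderon" "vscale K = vscale calderon" "vclosed K"
  using assms unfolding calderon_subspace_def subspace_of_def by auto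

lemma calderon_subspace_calderon: "calderon_subspace calderon"
proof -
  have "calderon = subspace_of calderon (vcarrier calderon)" by (simp add: subspace_of_def)
  moreover have "vclosed calderon" unfolding vclosed_def
    using calderon_add calderon_scale by simp
  ultimately show ?thesis unfolding calderon_subspace_def by blast
qed

lemma calderon_subspace_ker:
  assumes "k \<le> 2"
  shows "calderon_subspace (ker_Delta k)"
proof -
  have "vclosed (ker_Delta k)" unfolding vclosed_def ker_Delta_def subspace_of_def
    using calderon_add calderon_scale Delta_add Delta_scale assms by auto
  moreover have "\<exists>S\<subseteq>vcarrier calderon. ker_Delta k = subspace_of calderon S"
    unfolding ker_Delta_def by (intro exI[of _ "{F \<in> vcarrier calderon. Delta k F = (\<lambda>n. 0)}"]) simp
  ultimately show ?thesis unfolding calderon_subspace_def by simp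
qed

context
  fixes K and a b :: nat
  assumes K: "calderon_subspace K" and ab: "a \<le> 2" "b \<le> 2"
begin

lemma pair_image_norm_nonneg:
  assumes "p \<in> vcarrier (pair_image a b K)"
  shows "0 \<le> vnorm (pair_image a b K) p"
proof -
  have "0 \<le> Inf {vnorm K F |F. F \<in> vcarrier K \<and> (Delta a F, Delta b F) = p}"
    by (rule cInf_greatest) (use assms calderon_subspaceD(1,2)[OF K] calderon_norm_upper(4) in \<open>auto simp: pair_image_def\<close>)
  then show ?thesis by (simp add: pair_image_def)
qed

lemma pair_image_norm_le:
  assumes F: "F \<in> vcarrier K"
  shows "vnorm (pair_image a b K) (Delta a F, Delta b F) \<le> vnorm calderon F"
proof -
  have "Inf {vnorm K G |G. G \<in> vcarrier K \<and> (Delta a G, Delta b G) = (Delta a F, Delta b F)} \<le> vnorm K F"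
    by (rule cInf_lower) (use F calderon_subspaceD(1,2)[OF K] calderon_norm_upper(4) in \<open>auto intro!: bdd_belowI[of _ 0]\<close>)
  then show ?thesis using calderon_subspaceD(2)[OF K] by (simp add: pair_image_def)
qed

lemma pair_image_norm_ge:
  assumes "p \<in> vcarrier (pair_image a b K)"
    and "\<And>F. F \<in> vcarrier K \<Longrightarrow> (Delta a F, Delta b F) = p \<Longrightarrow> c \<le> vnorm calderon F"
  shows "c \<le> vnorm (pair_image a b K) p"
proof -
  have "c \<le> Inf {vnorm K F |F. F \<in> vcarrier K \<and> (Delta a F, Delta b F) = p}"
    by (rule cInf_greatest) (use assms calderon_subspaceD(2)[OF K] in \<open>auto simp: pair_image_def\<close>)
  then show ?thesis by (simp add: pair_image_def)
qed

lemma pair_image_lift: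
  assumes p: "p \<in> vcarrier (pair_image a b K)" and c: "vnorm (pair_image a b K) p < c"
  obtains F where "F \<in> vcarrier K" "(Delta a F, Delta b F) = p" "vnorm calderon F < c"
proof -
  have "\<exists>x\<in>{vnorm K F |F. F \<in> vcarrier K \<and> (Delta a F, Delta b F) = p}. x < c"
    by (rule cInf_lessD) (use p c in \<open>auto simp: pair_image_def\<close>)
  then show ?thesis using that calderon_subspaceD(2)[OF K] by auto
qed

text \<open>The quotient map is linear, so combinations in the image can be computed by combining
  lifts.\<close>

lemma bounded_operator_pair_image:
  "bounded_operator K (pair_image a b K) (\<lambda>F. (Delta a F, Delta b F))"
  unfolding bounded_operator_def
proof (intro conjI ballI allI exI[of _ 1])
  fix F G c assume F: "F \<in> vcarrier K" and G: "G \<in> vcarrier K"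
  show "(Delta a F, Delta b F) \<in> vcarrier (pair_image a b K)" using F by (simp add: pair_image_def)
  show "vnorm (pair_image a b K) (Delta a F, Delta b F) \<le> 1 * vnorm K F"
    using pair_image_norm_le[OF F] calderon_subspaceD(2)[OF K] by simp
  note FG = calderon_subspaceD(1)[OF K F] calderon_subspaceD(1)[OF K G]
  show "(Delta a (vadd K F G), Delta b (vadd K F G)) = vadd (pair_image a b K) (Delta a F, Delta b F) (Delta a G, Delta b G)"
    by (simp add: calderon_subspaceD(3)[OF K] pair_image_def fun_eq_iff Delta_add[OF FG ab(1)] Delta_add[OF FG ab(2)])
  show "(Delta a (vscale K c F), Delta b (vscale K c F)) = vscale (pair_image a b K) c (Delta a F, Delta b F)"
    by (simp add: calderon_subspaceD(4)[OF K] pair_image_def fun_eq_iff Delta_scale[OF FG(1) ab(1)] Delta_scale[OF FG(1) ab(2)])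
qed

lemma vclosed_pair_image: "vclosed (pair_image a b K)"
proof -
  have eq: "vcarrier (pair_image a b K) = (\<lambda>F. (Delta a F, Delta b F)) ` vcarrier K" by (simp add: pair_image_def)
  note T = bounded_operator_pair_image[unfolded bounded_operator_def]
  show ?thesis unfolding vclosed_def eq ball_simps
  proof (intro conjI ballI allI)
    fix F G c assume F: "F \<in> vcarrier K" and G: "G \<in> vcarrier K"
    have "vadd (pair_image a b K) (Delta a F, Delta b F) (Delta a G, Delta b G) = (Delta a (vadd K F G), Delta b (vadd K F G))"
      using T F G by metis
    then show "vadd (pair_image a b K) (Delta a F, Delta b F) (Delta a G, Delta b G) \<in> (\<lambda>F. (Delta a F, Delta b F)) ` vcarrier K"
      using calderon_subspaceD(5)[OF K] F G by (auto simp: vclosed_def)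
    have "vscale (pair_image a b K) c (Delta a F, Delta b F) = (Delta a (vscale K c F), Delta b (vscale K c F))"
      using T F by metis
    then show "vscale (pair_image a b K) c (Delta a F, Delta b F) \<in> (\<lambda>F. (Delta a F, Delta b F)) ` vcarrier K"
      using calderon_subspaceD(5)[OF K] F by (auto simp: vclosed_def)
  qed
qed

end

section \<open>The two-sided description of the Kalton-Peck norm\<close>

text \<open>With x = F (1/2), the function x_m |x_m|^(2z - 1) has value x_m and derivative 2 x_m ln
  |x_m| at 1/2. Its difference from F vanishes there, so \<open>strip_interpolation\<close> bounds
  the derivative of the difference in ell_2. In A + 1 + A^2 the first term comes from F, the 1 from
  the extremal function on the left line, and A^2 from its ell_1 sum on the right line. The bounds
  do not depend on \<open>K\<close>.\<close>

lemma calderon_lower: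
  assumes F: "F \<in> vcarrier calderon" and A: "vnorm calderon F \<le> A"
  shows "(\<Sum>m<K. (cmod (F (1/2) m))\<^sup>2) \<le> A\<^sup>2"
    and "(\<Sum>m<K. (cmod (Delta 1 F m - 2 * F (1/2) m * of_real (ln (cmod (F (1/2) m)))))\<^sup>2) \<le> (4 * (A + 1 + A\<^sup>2))\<^sup>2"
proof -
  obtain B where B: "\<And>z n. cmod (F z n) \<le> B" using calderonD(3)[OF F] by blast
  have A0: "0 \<le> A" using A calderon_norm_upper(4)[OF F] by linarith
  have bF: "cmod (F (Complex 0 t) m) \<le> A" "(\<Sum>m<K. cmod (F (Complex 1 t) m)) \<le> A" for t m
    using calderon_norm_upper(1,3)[OF F] A order_trans by (blast, meson finite_lessThan)
  show x2: "(\<Sum>m<K. (cmod (F (1/2) m))\<^sup>2) \<le> A\<^sup>2"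
    by (rule strip_interpolation(1)[where \<phi>="\<lambda>m z. F z m" and B=B])
      (use B bF A0 calderonD(5,6)[OF F] in auto)
  define x where "x m = F (1/2) m" for m
  define E where "E m z = x m * exp ((2 * z - 1) * of_real (ln (cmod (x m))))" for m z
  define H where "H m z = F z m - E m z" for m z
  have Eabs: "cmod (E m z) = cmod (x m) * exp ((2 * Re z - 1) * ln (cmod (x m)))" for m z
    by (simp add: E_def norm_mult)
  have E0: "cmod (E m (Complex 0 t)) \<le> 1" for m t
    by (cases "x m = 0") (simp_all add: Eabs exp_minus)
  have E1: "cmod (E m (Complex 1 t)) = (cmod (x m))\<^sup>2" for m t
    by (cases "x m = 0") (simp_all add: Eabs power2_eq_square)
  have dE: "(E m has_field_derivative 2 * x m * of_real (ln (cmod (x m)))) (at (1/2))" for m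
    unfolding E_def by (auto intro!: derivative_eq_intros)
  have dH: "deriv (H m) (1/2) = Delta 1 F m - 2 * x m * of_real (ln (cmod (x m)))" for m
  proof -
    have "((\<lambda>z. F z m) has_field_derivative Delta 1 F m) (at (1/2))"
      using holomorphic_derivI[OF calderonD(5)[OF F] open_open_strip half_in_open_strip] Delta_1_2(1)[OF F] by simp
    from DERIV_diff[OF this dE[of m]] show ?thesis unfolding H_def by (rule DERIV_imp_deriv)
  qed
  have "(\<Sum>m<K. (cmod (deriv (H m) (1/2)))\<^sup>2) \<le> (4 * (A + 1 + A\<^sup>2))\<^sup>2"
  proof (rule strip_interpolation(2))
    show "continuous_on strip (H m)" for m
      unfolding H_def E_def by (intro continuous_intros calderonD(6)[OF F])
    show "H m holomorphic_on open_strip" for m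
      unfolding H_def E_def by (intro holomorphic_intros calderonD(5)[OF F])
    show "cmod (H m z) \<le> B + (\<Sum>m<K. cmod (x m) * exp \<bar>ln (cmod (x m))\<bar>)" if m: "m \<in> {..<K}" and z: "z \<in> strip" for m z
    proof -
      have "\<bar>2 * Re z - 1\<bar> \<le> 1" using z by (auto simp: strip_def)
      then have "\<bar>(2 * Re z - 1) * ln (cmod (x m))\<bar> \<le> 1 * \<bar>ln (cmod (x m))\<bar>" unfolding abs_mult by (intro mult_right_mono) auto
      then have "exp ((2 * Re z - 1) * ln (cmod (x m))) \<le> exp \<bar>ln (cmod (x m))\<bar>" by simp
      then have "cmod (E m z) \<le> cmod (x m) * exp \<bar>ln (cmod (x m))\<bar>" unfolding Eabs by (simp add: mult_left_mono)
      also have "\<dots> \<le> (\<Sum>m<K. cmod (x m) * exp \<bar>ln (cmod (x m))\<bar>)" using m by (intro member_le_sum) auto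
      finally show ?thesis unfolding H_def using norm_triangle_ineq4[of "F z m" "E m z"] B[of z m] by linarith
    qed
    show "cmod (H m (Complex 0 t)) \<le> A + 1 + A\<^sup>2" for m t
      unfolding H_def using norm_triangle_ineq4[of "F (Complex 0 t) m" "E m (Complex 0 t)"] bF(1)[of t m] E0[of m t]
        zero_le_power2[of A] by linarith
    show "(\<Sum>m<K. cmod (H m (Complex 1 t))) \<le> A + 1 + A\<^sup>2" for t
    proof -
      have "(\<Sum>m<K. cmod (H m (Complex 1 t))) \<le> (\<Sum>m<K. cmod (F (Complex 1 t) m) + (cmod (x m))\<^sup>2)"
        unfolding H_def
      proof (rule sum_mono)
        show "cmod (F (Complex 1 t) m - E m (Complex 1 t)) \<le> cmod (F (Complex 1 t) m) + (cmod (x m))\<^sup>2" for m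
          using norm_triangle_ineq4[of "F (Complex 1 t) m" "E m (Complex 1 t)"] E1[of m t] by linarith
      qed
      also have "\<dots> \<le> A + A\<^sup>2" unfolding sum.distrib using bF(2)[of t] x2 unfolding x_def by linarith
      finally show ?thesis by simp
    qed
    show "H m (1/2) = 0" for m by (simp add: H_def E_def x_def)
  qed (use A0 in auto)
  then show "(\<Sum>m<K. (cmod (Delta 1 F m - 2 * F (1/2) m * of_real (ln (cmod (F (1/2) m)))))\<^sup>2) \<le> (4 * (A + 1 + A\<^sup>2))\<^sup>2"
    unfolding dH x_def .
qed

text \<open>The Gaussian decay is weakened to a rational one by exp u \<ge> 1 + u, so that later
  estimates are algebra in q = 1 + (Im w)^2 / 2: a factor of order q still leaves decay 1 / q. The
  4/3 bounds exp (1/4).\<close>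

lemma cmod_exp_square_le:
  fixes w :: complex
  assumes "\<bar>Re w\<bar> \<le> 1/2"
  shows "cmod (exp (w\<^sup>2)) \<le> (4/3) / (1 + (Im w)\<^sup>2 / 2)\<^sup>2"
proof -
  let ?q = "1 + (Im w)\<^sup>2 / 2"
  have q: "0 < ?q" by (simp add: add_pos_nonneg)
  have "\<bar>Re w\<bar>\<^sup>2 \<le> (1/2)\<^sup>2" by (intro power_mono assms) auto
  then have "(Re w)\<^sup>2 \<le> 1/4" by (simp add: power2_eq_square)
  then have "Re (w\<^sup>2) \<le> 1/4 - (Im w)\<^sup>2" by (simp add: power2_eq_square)
  then have "cmod (exp (w\<^sup>2)) \<le> exp (1/4 - (Im w)\<^sup>2)" by simp
  also have "\<dots> = exp (1/4) / (exp ((Im w)\<^sup>2 / 2))\<^sup>2" by (simp add: exp_diff power2_eq_square exp_add[symmetric])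
  also have "\<dots> \<le> (4/3) / ?q\<^sup>2"
  proof (rule frac_le)
    have "3/4 \<le> exp (-(1/4)::real)" using exp_ge_add_one_self[of "-(1/4)::real"] by simp
    then show "exp (1/4) \<le> (4/3::real)" by (simp add: exp_minus field_simps)
    show "?q\<^sup>2 \<le> (exp ((Im w)\<^sup>2 / 2))\<^sup>2" using q by (intro power_mono exp_ge_add_one_self) auto
  qed (use q in auto)
  finally show ?thesis .
qed

lemma strip_Re: "z \<in> strip \<Longrightarrow> \<bar>Re (z - 1/2)\<bar> \<le> 1/2"
proof -
  assume "z \<in> strip"
  moreover have "Re (z - 1/2) = Re z - 1/2" by simp
  ultimately show ?thesis unfolding strip_def mem_Collect_eq by linarith
qed

text \<open>Source of the explicit elements. The weight has value 1 and derivative 0 at 1/2, and it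
  admits coordinate functions of quadratic growth along the strip.\<close>

lemma calderon_gauss:
  fixes p :: "nat \<Rightarrow> complex \<Rightarrow> complex"
  assumes hol: "\<And>m. p m holomorphic_on UNIV"
    and bnd: "\<And>m. \<exists>c. \<forall>z\<in>strip. cmod (p m z) \<le> c * (1 + (Im z)\<^sup>2 / 2)"
  shows "(\<lambda>z n. if z \<in> strip \<and> n < K then exp ((z - 1/2)\<^sup>2) * p n z else 0) \<in> vcarrier calderon"
proof (rule calderon_finite)
  fix m
  obtain c where c: "\<And>z. z \<in> strip \<Longrightarrow> cmod (p m z) \<le> c * (1 + (Im z)\<^sup>2 / 2)" using bnd by blast
  have q: "0 < 1 + t\<^sup>2 / 2" for t :: real by (simp add: add_pos_nonneg)
  have le: "cmod (exp ((z - 1/2)\<^sup>2) * p m z) \<le> (4/3 * c) / (1 + (Im z)\<^sup>2 / 2)" if z: "z \<in> strip" for z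
  proof -
    from cmod_exp_square_le[OF strip_Re[OF z]] c[OF z]
    have "cmod (exp ((z - 1/2)\<^sup>2) * p m z) \<le> (4/3) / (1 + (Im z)\<^sup>2 / 2)\<^sup>2 * (c * (1 + (Im z)\<^sup>2 / 2))"
      unfolding norm_mult by (intro mult_mono) auto
    also have "\<dots> = (4/3 * c) / (1 + (Im z)\<^sup>2 / 2)" using q[of "Im z"] by (simp add: power2_eq_square)
    finally show ?thesis .
  qed
  have c0: "0 \<le> c" using c[of 0] norm_ge_zero[of "p m 0"] by (simp add: strip_def del: norm_ge_zero)
  show "continuous_on strip (\<lambda>z. exp ((z - 1/2)\<^sup>2) * p m z)"
    by (intro continuous_intros continuous_on_subset[OF holomorphic_on_imp_continuous_on[OF hol]]) auto
  show "(\<lambda>z. exp ((z - 1/2)\<^sup>2) * p m z) holomorphic_on open_strip"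
    by (intro holomorphic_intros holomorphic_on_subset[OF hol]) auto
  have "(4/3 * c) / (1 + t\<^sup>2 / 2) \<le> 4/3 * c" for t
    using c0 divide_left_mono[of 1 "1 + t\<^sup>2 / 2" "4/3 * c"] q[of t] by simp
  then show "\<exists>B. \<forall>z\<in>strip. cmod (exp ((z - 1/2)\<^sup>2) * p m z) \<le> B" using le order_trans by blast
  have lim: "((\<lambda>t. (4/3 * c) / (1 + t\<^sup>2 / 2)) \<longlongrightarrow> 0) (at_infinity :: real filter)"
  proof (rule Lim_null_comparison)
    show "\<forall>\<^sub>F t in at_infinity. norm ((4/3 * c) / (1 + t\<^sup>2 / 2)) \<le> (4/3 * c) * norm (inverse t)"
      unfolding eventually_at_infinity
    proof (intro exI[of _ 1] allI impI)
      fix t :: real assume "1 \<le> norm t"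
      then have t: "0 < \<bar>t\<bar>" by simp
      have "0 \<le> (\<bar>t\<bar> - 1)\<^sup>2" by simp
      then have "\<bar>t\<bar> \<le> 1 + t\<^sup>2 / 2" unfolding power2_diff by simp
      then have "(4/3 * c) / (1 + t\<^sup>2 / 2) \<le> (4/3 * c) / \<bar>t\<bar>" using t c0 q[of t] by (intro divide_left_mono) auto
      moreover have "0 \<le> (4/3 * c) / (1 + t\<^sup>2 / 2)" using c0 q[of t] by (intro divide_nonneg_pos) auto
      ultimately have "\<bar>(4/3 * c) / (1 + t\<^sup>2 / 2)\<bar> \<le> (4/3 * c) / \<bar>t\<bar>" by (simp only: abs_of_nonneg)
      then show "norm ((4/3 * c) / (1 + t\<^sup>2 / 2)) \<le> (4/3 * c) * norm (inverse t)"
        by (simp only: real_norm_def abs_inverse divide_inverse[of _ "\<bar>t\<bar>"])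
    qed
    have "((\<lambda>t. norm (inverse t)) \<longlongrightarrow> 0) (at_infinity :: real filter)" using tendsto_norm_zero[OF tendsto_inverse_0] .
    from tendsto_mult_left[OF this, of "4/3 * c"] show "((\<lambda>t. (4/3 * c) * norm (inverse t)) \<longlongrightarrow> 0) (at_infinity :: real filter)" by simp
  qed
  show "((\<lambda>t. exp ((Complex 0 t - 1/2)\<^sup>2) * p m (Complex 0 t)) \<longlongrightarrow> 0) at_infinity"
    using le[of "Complex 0 _"] by (intro Lim_null_comparison[OF always_eventually lim]) (simp add: strip_iff)
  show "((\<lambda>t. exp ((Complex 1 t - 1/2)\<^sup>2) * p m (Complex 1 t)) \<longlongrightarrow> 0) at_infinity"
    using le[of "Complex 1 _"] by (intro Lim_null_comparison[OF always_eventually lim]) (simp add: strip_iff)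
qed

text \<open>The first three bounds enter norm estimates, the last two are growth conditions for
  \<open>calderon_gauss\<close>. All follow from |exp (w^2)| \<le> (4/3) / q^2 with q = 1 + (Im w)^2
  / 2, and 2 and 3 are rounded values.\<close>

lemma gauss_weights:
  assumes "\<bar>Re w\<bar> \<le> 1/2"
  shows "cmod (exp (w\<^sup>2)) \<le> 2" "cmod (exp (w\<^sup>2)) * cmod w \<le> 2" "cmod (exp (w\<^sup>2)) * cmod (1 - w\<^sup>2) \<le> 3"
    "cmod w \<le> 1 + (Im w)\<^sup>2 / 2" "cmod (1 - w\<^sup>2) \<le> 2 * (1 + (Im w)\<^sup>2 / 2)"
proof -
  define q where "q = 1 + (Im w)\<^sup>2 / 2"
  have q: "1 \<le> q" by (simp add: q_def)
  have e: "cmod (exp (w\<^sup>2)) \<le> (4/3) / q\<^sup>2" using cmod_exp_square_le[OF assms] by (simp add: q_def)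
  have "\<bar>Re w\<bar>\<^sup>2 \<le> (1/2)\<^sup>2" by (intro power_mono assms) auto
  then have w2: "(cmod w)\<^sup>2 \<le> 1/4 + (Im w)\<^sup>2" unfolding cmod_power2 by (simp add: power2_eq_square)
  have "0 \<le> (cmod w - 1)\<^sup>2" by simp
  then have "2 * cmod w \<le> 1 + (cmod w)\<^sup>2" unfolding power2_diff by simp
  then have w1: "cmod w \<le> q" using w2 by (simp add: q_def)
  have "cmod (1 - w\<^sup>2) \<le> 1 + (cmod w)\<^sup>2" using norm_triangle_ineq4[of 1 "w\<^sup>2"] by (simp add: norm_power)
  then have w3: "cmod (1 - w\<^sup>2) \<le> 2 * q" using w2 by (simp add: q_def)
  from w1 w3 show "cmod w \<le> 1 + (Im w)\<^sup>2 / 2" "cmod (1 - w\<^sup>2) \<le> 2 * (1 + (Im w)\<^sup>2 / 2)" by (simp_all add: q_def)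
  have q2: "1 \<le> q\<^sup>2" "q \<le> q\<^sup>2" using q by (auto simp: power2_eq_square mult_left_le intro: mult_ge1_I)
  have m: "cmod (exp (w\<^sup>2)) * X \<le> c" if "0 \<le> X" "4/3 * X \<le> c * q\<^sup>2" for X c
  proof -
    have "cmod (exp (w\<^sup>2)) * X \<le> (4/3) / q\<^sup>2 * X" using e that by (intro mult_right_mono) auto
    also have "\<dots> \<le> c" unfolding times_divide_eq_left using that(2) q2 by (subst pos_divide_le_eq) auto
    finally show ?thesis .
  qed
  show "cmod (exp (w\<^sup>2)) \<le> 2" using m[of 1 2] q2 by simp
  show "cmod (exp (w\<^sup>2)) * cmod w \<le> 2" by (rule m) (use w1 q2 q in auto)
  show "cmod (exp (w\<^sup>2)) * cmod (1 - w\<^sup>2) \<le> 3" by (rule m) (use w3 q2 q in auto)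
qed

text \<open>Converse of \<open>calderon_lower\<close>: a function with the same value and derivative
  as \<open>G\<close>, but of controlled norm. The part x (|x| / l)^(2z - 1) has modulus at most
  \<open>l\<close> on the left line, |x|^2 / l on the right line, and accounts for the logarithmic
  term of the derivative. The remainder \<open>r\<close> is supplied by z - 1/2 times its own
  extremal function, with the ell_2 norm of \<open>r\<close> as scale. The scale \<open>l\<close> is
  left free to suit the size of x.\<close>

lemma calderon_upper:
  assumes G: "G \<in> vcarrier calderon" and l: "0 < l"
  defines "x \<equiv> \<lambda>m. G (1/2) m" and "r \<equiv> \<lambda>m. Delta 1 G m - 2 * G (1/2) m * of_real (ln (cmod (G (1/2) m) / l))"
  shows "\<exists>E\<in>vcarrier calderon. Delta 0 E = Delta 0 G \<and> Delta 1 E = Delta 1 G \<and>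
    vnorm calderon E \<le> 2 * (l + (\<Sum>m<K. (cmod (x m))\<^sup>2) / l + sqrt (\<Sum>m<K. (cmod (r m))\<^sup>2)) +
      vnorm calderon (\<lambda>z n. cut K n * G z n)"
proof -
  define R where "R = sqrt (\<Sum>m<K. (cmod (r m))\<^sup>2)"
  have R0: "0 \<le> R" by (simp add: R_def sum_nonneg)
  have R2: "R\<^sup>2 = (\<Sum>m<K. (cmod (r m))\<^sup>2)" unfolding R_def by (simp add: sum_nonneg)
  have rR: "cmod (r m) \<le> R" if "m < K" for m
  proof -
    have "(cmod (r m))\<^sup>2 \<le> R\<^sup>2" unfolding R2 using that by (intro member_le_sum) auto
    then show ?thesis using R0 power2_le_imp_le by blast
  qed
  define p1 where "p1 m z = x m * exp (2 * (z - 1/2) * of_real (ln (cmod (x m) / l)))" for m and z :: complex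
  define p2 where "p2 m z = r m * exp (2 * (z - 1/2) * of_real (ln (cmod (r m) / R)))" for m and z :: complex
  define p where "p m z = p1 m z + (z - 1/2) * p2 m z" for m z
  have p1abs: "cmod (p1 m z) = cmod (x m) * exp ((2 * Re z - 1) * ln (cmod (x m) / l))" for m z
    by (simp add: p1_def norm_mult algebra_simps)
  have p2abs: "cmod (p2 m z) = cmod (r m) * exp ((2 * Re z - 1) * ln (cmod (r m) / R))" for m z
    by (simp add: p2_def norm_mult algebra_simps)
  have ex: "exp ((2 * Re z - 1) * y) \<le> exp \<bar>y\<bar>" if "z \<in> strip" for z y
  proof -
    have "\<bar>2 * Re z - 1\<bar> \<le> 1" using that by (auto simp: strip_def)
    then have "\<bar>(2 * Re z - 1) * y\<bar> \<le> 1 * \<bar>y\<bar>" unfolding abs_mult by (intro mult_right_mono) auto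
    then show ?thesis by simp
  qed
  define E where "E = (\<lambda>z n. if z \<in> strip \<and> n < K then exp ((z - 1/2)\<^sup>2) * p n z else 0)"
  have E: "E \<in> vcarrier calderon" unfolding E_def
  proof (rule calderon_gauss)
    show "p m holomorphic_on UNIV" for m unfolding p_def p1_def p2_def by (intro holomorphic_intros)
    show "\<exists>c. \<forall>z\<in>strip. cmod (p m z) \<le> c * (1 + (Im z)\<^sup>2 / 2)" for m
    proof (intro exI ballI)
      fix z assume z: "z \<in> strip"
      let ?c1 = "cmod (x m) * exp \<bar>ln (cmod (x m) / l)\<bar>" and ?c2 = "cmod (r m) * exp \<bar>ln (cmod (r m) / R)\<bar>"
      have "cmod (p m z) \<le> cmod (p1 m z) + cmod (z - 1/2) * cmod (p2 m z)" unfolding p_def norm_mult[symmetric] by (rule norm_triangle_ineq)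
      also have "\<dots> \<le> ?c1 * (1 + (Im z)\<^sup>2 / 2) + (1 + (Im z)\<^sup>2 / 2) * ?c2"
      proof (intro add_mono mult_mono)
        have "cmod (p1 m z) \<le> ?c1 * 1" unfolding p1abs mult_1_right by (intro mult_left_mono ex[OF z]) simp
        also have "\<dots> \<le> ?c1 * (1 + (Im z)\<^sup>2 / 2)" by (intro mult_left_mono) auto
        finally show "cmod (p1 m z) \<le> ?c1 * (1 + (Im z)\<^sup>2 / 2)" .
        show "cmod (z - 1/2) \<le> 1 + (Im z)\<^sup>2 / 2" using gauss_weights(4)[OF strip_Re[OF z]] by simp
        show "cmod (p2 m z) \<le> ?c2" unfolding p2abs by (intro mult_left_mono ex[OF z]) simp
      qed auto
      finally show "cmod (p m z) \<le> (?c1 + ?c2) * (1 + (Im z)\<^sup>2 / 2)" by (simp add: algebra_simps)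
    qed
  qed
  \<comment> \<open>Coordinates from \<open>K\<close> on are taken over from \<open>G\<close>, so
    value and derivative agree there, at the price of the tail norm.\<close>
  define T where "T = (\<lambda>z n. cut K n * G z n)"
  have T: "T \<in> vcarrier calderon" unfolding T_def by (rule calderon_multiplier[OF G cut_le])
  define S where "S = (\<lambda>z n. E z n + T z n)"
  have S: "S \<in> vcarrier calderon" unfolding S_def by (rule calderon_add[OF E T])
  have p_half: "p m (1/2) = x m" for m by (simp add: p_def p1_def)
  have "S (1/2) = G (1/2)" by (auto simp: S_def T_def E_def cut_def p_half x_def)
  then have S0: "Delta 0 S = Delta 0 G" by simp
  have dG: "((\<lambda>z. G z m) has_field_derivative Delta 1 G m) (at (1/2))" for m
    using holomorphic_derivI[OF calderonD(5)[OF G] open_open_strip half_in_open_strip] Delta_1_2(1)[OF G] by simp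
  have S1: "Delta 1 S = Delta 1 G"
  proof
    fix m
    have ev: "\<forall>\<^sub>F z in nhds (1/2). z \<in> open_strip" by (intro eventually_nhds_in_open open_open_strip half_in_open_strip)
    have "((\<lambda>z. S z m) has_field_derivative Delta 1 G m) (at (1/2))"
    proof (cases "m < K")
      case True
      \<comment> \<open>The Gaussian factor contributes nothing to the first derivative, and the
        factor z - 1/2 leaves exactly r_m.\<close>
      have d: "((\<lambda>z. exp ((z - 1/2)\<^sup>2) * p m z) has_field_derivative x m * (2 * of_real (ln (cmod (x m) / l))) + r m) (at (1/2))"
        unfolding p_def p1_def p2_def by (auto intro!: derivative_eq_intros)
      have r: "x m * (2 * of_real (ln (cmod (x m) / l))) + r m = Delta 1 G m" by (simp add: r_def x_def)
      have "\<forall>\<^sub>F z in nhds (1/2). S z m = exp ((z - 1/2)\<^sup>2) * p m z"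
        using ev by eventually_elim (use True open_strip_subset in \<open>auto simp: S_def E_def T_def cut_def\<close>)
      from DERIV_cong_ev[OF refl this r[symmetric]] d show ?thesis by blast
    next
      case False
      then have "(\<lambda>z. S z m) = (\<lambda>z. G z m)" by (auto simp: S_def E_def T_def cut_def)
      then show ?thesis using dG by simp
    qed
    then show "Delta 1 S m = Delta 1 G m" using Delta_1_2(1)[OF S, of m] by (simp add: DERIV_imp_deriv)
  qed
  let ?X = "\<Sum>m<K. (cmod (x m))\<^sup>2"
  have X0: "0 \<le> ?X" by (simp add: sum_nonneg)
  have Eabs: "cmod (E z m) \<le> 2 * cmod (p1 m z) + 2 * cmod (p2 m z)" if z: "z \<in> strip" and m: "m < K" for z m
  proof -
    let ?w = "z - 1/2"
    have "cmod (E z m) \<le> cmod (exp (?w\<^sup>2)) * (cmod (p1 m z) + cmod ?w * cmod (p2 m z))"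
      using z m unfolding E_def p_def by (auto simp: norm_mult intro!: mult_left_mono norm_triangle_le)
    also have "\<dots> = cmod (exp (?w\<^sup>2)) * cmod (p1 m z) + (cmod (exp (?w\<^sup>2)) * cmod ?w) * cmod (p2 m z)" by (simp add: algebra_simps)
    also have "\<dots> \<le> 2 * cmod (p1 m z) + 2 * cmod (p2 m z)"
      using gauss_weights(1,2)[OF strip_Re[OF z]] by (intro add_mono mult_right_mono) auto
    finally show ?thesis .
  qed
  \<comment> \<open>\<open>R\<close> may be zero, but then all r_m with m < K vanish; divisions by
    \<open>R\<close> matter only when r_m is nonzero.\<close>
  have rpos: "0 < cmod (r m) \<and> 0 < R" if "r m \<noteq> 0" "m < K" for m using rR[OF that(2)] that(1) by (metis less_le_trans zero_less_norm_iff)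
  have "vnorm calderon E \<le> 2 * (l + ?X / l + R)"
  proof (rule calderon_norm_least)
    fix t n
    show "cmod (E (Complex 0 t) n) \<le> 2 * (l + ?X / l + R)"
    proof (cases "n < K")
      case True
      have "cmod (p1 n (Complex 0 t)) \<le> l" using l by (cases "x n = 0") (simp_all add: p1abs exp_minus field_simps)
      moreover have "cmod (p2 n (Complex 0 t)) \<le> R" using R0 rpos[OF _ True] by (cases "r n = 0") (simp_all add: p2abs exp_minus field_simps)
      moreover have "0 \<le> ?X / l" using X0 l by simp
      ultimately show ?thesis using Eabs[of "Complex 0 t" n] True by (simp add: strip_iff)
    next
      case False
      then show ?thesis using X0 l R0 by (simp add: E_def)
    qed
    have "sumn (E (Complex 1 t)) = (\<Sum>m<K. cmod (E (Complex 1 t) m))" by (rule finite_support(2)) (simp add: E_def)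
    also have "\<dots> \<le> (\<Sum>m<K. 2 * (cmod (x m))\<^sup>2 / l + 2 * (cmod (r m))\<^sup>2 / R)"
    proof (rule sum_mono)
      fix m assume "m \<in> {..<K}"
      then have m: "m < K" by simp
      have "cmod (p1 m (Complex 1 t)) = (cmod (x m))\<^sup>2 / l" using l by (cases "x m = 0") (simp_all add: p1abs power2_eq_square)
      moreover have "cmod (p2 m (Complex 1 t)) = (cmod (r m))\<^sup>2 / R" using rpos[OF _ m] by (cases "r m = 0") (simp_all add: p2abs power2_eq_square)
      ultimately show "cmod (E (Complex 1 t) m) \<le> 2 * (cmod (x m))\<^sup>2 / l + 2 * (cmod (r m))\<^sup>2 / R"
        using Eabs[of "Complex 1 t" m] m by (simp add: strip_iff)
    qed
    also have "\<dots> = 2 * ?X / l + 2 * R\<^sup>2 / R" unfolding R2 sum.distrib by (simp add: sum_distrib_left sum_divide_distrib)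
    also have "\<dots> \<le> 2 * (l + ?X / l + R)" using l R0 by (simp add: power2_eq_square)
    finally show "sumn (E (Complex 1 t)) \<le> 2 * (l + ?X / l + R)" .
  qed
  then have "vnorm calderon S \<le> 2 * (l + ?X / l + R) + vnorm calderon T"
    using calderon_triangle[OF E T] unfolding S_def by linarith
  then show ?thesis using S S0 S1 unfolding R_def T_def by blast
qed

section \<open>Logarithmic type 2 of the Kalton-Peck space\<close>

text \<open>For t = a / s \<ge> 1 / N the logarithm is at most ln N in modulus. For smaller t one
  has t^2 ln^2 t \<le> 4 t \<le> 4 / N, and this error, summed over N coordinates, costs only 4
  s^2.\<close>

lemma square_ln_square_le:
  fixes a s N :: real
  assumes a: "0 \<le> a" "a \<le> s" and s: "0 < s" and N: "1 \<le> N"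
  shows "a\<^sup>2 * (ln (a / s))\<^sup>2 \<le> a\<^sup>2 * (ln N)\<^sup>2 + 4 * s\<^sup>2 / N"
proof (cases "a = 0")
  case True
  then show ?thesis using N by simp
next
  case False
  define t where "t = a / s"
  have t: "0 < t" "t \<le> 1" "a = t * s" using False a s by (auto simp: t_def)
  show ?thesis
  proof (cases "1 / N \<le> t")
    case True
    have "ln (1 / N) \<le> ln t" using True N t by (subst ln_le_cancel_iff) auto
    then have "- ln N \<le> ln t" using N by (simp add: ln_div)
    then have "\<bar>ln t\<bar> \<le> \<bar>ln N\<bar>" using t N by (simp add: abs_if)
    then have "(ln t)\<^sup>2 \<le> (ln N)\<^sup>2" by (simp add: abs_le_square_iff)
    then have "a\<^sup>2 * (ln t)\<^sup>2 \<le> a\<^sup>2 * (ln N)\<^sup>2" by (intro mult_left_mono) auto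
    moreover have "0 \<le> 4 * s\<^sup>2 / N" using N by simp
    ultimately show ?thesis unfolding t_def by linarith
  next
    case False
    \<comment> \<open>The square root improves |ln t| \<le> 1 / t to |ln t| = 2 |ln u| \<le> 2 /
      sqrt t.\<close>
    define u where "u = sqrt t"
    have u: "0 < u" "u\<^sup>2 = t" "u \<le> 1" using t by (auto simp: u_def)
    have "ln (1 / u) \<le> 1 / u" using ln_le_minus_one[of "1/u"] u by simp
    then have "\<bar>ln u\<bar> \<le> 1 / u" using u by (simp add: ln_div abs_if)
    then have "\<bar>ln u\<bar>\<^sup>2 \<le> (1 / u)\<^sup>2" by (intro power_mono) auto
    then have "(ln u)\<^sup>2 \<le> 1 / t" using u(2) by (simp add: power_divide)
    moreover have "ln t = 2 * ln u" using u ln_realpow[of u 2] by simp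
    ultimately have "(ln t)\<^sup>2 \<le> 4 / t" by simp
    then have "t\<^sup>2 * (ln t)\<^sup>2 \<le> t\<^sup>2 * (4 / t)" by (intro mult_left_mono) auto
    also have "\<dots> = 4 * t" using t by (simp add: power2_eq_square)
    also have "\<dots> \<le> 4 / N" using False by simp
    finally have "s\<^sup>2 * (t\<^sup>2 * (ln t)\<^sup>2) \<le> s\<^sup>2 * (4 / N)" by (intro mult_left_mono) auto
    then have "a\<^sup>2 * (ln t)\<^sup>2 \<le> 4 * s\<^sup>2 / N" unfolding t(3) by (simp add: power_mult_distrib algebra_simps)
    moreover have "0 \<le> a\<^sup>2 * (ln N)\<^sup>2" by simp
    ultimately show ?thesis unfolding t_def by linarith
  qed
qed

lemma cmod_add_square_le: "(cmod (x + y))\<^sup>2 \<le> 2 * (cmod x)\<^sup>2 + 2 * (cmod y)\<^sup>2"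
proof -
  have "(cmod (x + y))\<^sup>2 \<le> (cmod x + cmod y)\<^sup>2" by (intro power_mono norm_triangle_ineq) auto
  also have "\<dots> \<le> 2 * (cmod x)\<^sup>2 + 2 * (cmod y)\<^sup>2"
    using zero_le_power2[of "cmod x - cmod y"] by (simp add: power2_eq_square algebra_simps)
  finally show ?thesis .
qed

text \<open>The commutator of the matrix with the Kalton-Peck map \<open>\<xi> \<mapsto> \<xi> ln |\<xi>|\<close>. Both copies of the map
  may be rescaled by the \<open>\<ell>\<^sub>2\<close> norm of \<open>\<xi>\<close>, which reduces the claim to the elementary estimate of
  \<open>t\<^sup>2 ln\<^sup>2 t\<close> on \<open>[0, 1]\<close>.\<close>

lemma bessel_matrix_commutator:
  fixes \<xi> :: "nat \<Rightarrow> complex" and n :: nat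
  assumes \<theta>: "bessel_matrix n \<theta>"
  defines "N \<equiv> real (Suc n)" and "\<eta> \<equiv> \<lambda>j. \<Sum>k\<le>n. \<theta> j k * \<xi> k"
  shows "(\<Sum>j\<le>n. (cmod ((\<Sum>k\<le>n. \<theta> j k * (\<xi> k * of_real (ln (cmod (\<xi> k))))) - \<eta> j * of_real (ln (cmod (\<eta> j) / sqrt N))))\<^sup>2)
    \<le> 4 * N * (\<Sum>k\<le>n. (cmod (\<xi> k))\<^sup>2) * ((ln N)\<^sup>2 + 4)"
proof (cases "(\<Sum>k\<le>n. (cmod (\<xi> k))\<^sup>2) = 0")
  case True
  then have "\<xi> k = 0" if "k \<le> n" for k using that by (simp add: sum_nonneg_eq_0_iff)
  then show ?thesis unfolding \<eta>_def by simp
next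
  case False
  define s where "s = sqrt (\<Sum>k\<le>n. (cmod (\<xi> k))\<^sup>2)"
  have s2: "s\<^sup>2 = (\<Sum>k\<le>n. (cmod (\<xi> k))\<^sup>2)" by (simp add: s_def sum_nonneg)
  have s: "0 < s" using False by (simp add: s_def sum_nonneg order_less_le)
  have N: "1 \<le> N" by (simp add: N_def)
  have \<theta>': "(\<Sum>j\<le>n. (cmod (\<Sum>k\<le>n. \<theta> j k * x k))\<^sup>2) \<le> N * (\<Sum>k\<le>n. (cmod (x k))\<^sup>2)" for x
    using \<theta> unfolding bessel_matrix_def N_def by blast
  define a where "a k = \<xi> k * of_real (ln (cmod (\<xi> k) / s))" for k
  \<comment> \<open>By the Bessel inequality |\<eta>_j| \<le> sqrt N * s, so both logarithms have
    arguments at most 1, as \<open>square_ln_square_le\<close> requires.\<close>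
  define b where "b j = \<eta> j * of_real (ln (cmod (\<eta> j) / (sqrt N * s)))" for j
  have \<eta>2: "(\<Sum>j\<le>n. (cmod (\<eta> j))\<^sup>2) \<le> N * s\<^sup>2" unfolding \<eta>_def s2 by (rule \<theta>')
  have a_eq: "a k = \<xi> k * of_real (ln (cmod (\<xi> k))) - of_real (ln s) * \<xi> k" for k
    using s by (cases "\<xi> k = 0") (simp_all add: a_def ln_div algebra_simps)
  have b_eq: "b j = \<eta> j * of_real (ln (cmod (\<eta> j) / sqrt N)) - of_real (ln s) * \<eta> j" for j
    using s N by (cases "\<eta> j = 0") (simp_all add: b_def ln_div ln_mult algebra_simps)
  have sum_a: "(\<Sum>k\<le>n. \<theta> j k * a k) = (\<Sum>k\<le>n. \<theta> j k * (\<xi> k * of_real (ln (cmod (\<xi> k))))) - of_real (ln s) * \<eta> j" for j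
    unfolding a_eq \<eta>_def by (simp add: sum_subtractf sum_distrib_left algebra_simps)
  have split: "(\<Sum>k\<le>n. \<theta> j k * (\<xi> k * of_real (ln (cmod (\<xi> k))))) - \<eta> j * of_real (ln (cmod (\<eta> j) / sqrt N))
      = (\<Sum>k\<le>n. \<theta> j k * a k) + - b j" for j
    unfolding sum_a b_eq by simp
  have "(\<Sum>k\<le>n. (cmod (a k))\<^sup>2) \<le> (\<Sum>k\<le>n. (cmod (\<xi> k))\<^sup>2 * (ln N)\<^sup>2 + 4 * s\<^sup>2 / N)"
  proof (rule sum_mono)
    fix k assume "k \<in> {..n}"
    then have "(cmod (\<xi> k))\<^sup>2 \<le> s\<^sup>2" unfolding s2 by (intro member_le_sum) auto
    then have "cmod (\<xi> k) \<le> s" by (rule power2_le_imp_le) (use s in simp)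
    from square_ln_square_le[OF norm_ge_zero this s N]
    show "(cmod (a k))\<^sup>2 \<le> (cmod (\<xi> k))\<^sup>2 * (ln N)\<^sup>2 + 4 * s\<^sup>2 / N"
      by (simp add: a_def norm_mult power_mult_distrib)
  qed
  also have "\<dots> = s\<^sup>2 * ((ln N)\<^sup>2 + 4)"
    unfolding sum.distrib sum_distrib_right[symmetric] s2[symmetric] by (simp add: N_def field_simps)
  finally have "N * (\<Sum>k\<le>n. (cmod (a k))\<^sup>2) \<le> N * (s\<^sup>2 * ((ln N)\<^sup>2 + 4))" using N by (intro mult_left_mono) auto
  then have A: "(\<Sum>j\<le>n. (cmod (\<Sum>k\<le>n. \<theta> j k * a k))\<^sup>2) \<le> N * s\<^sup>2 * ((ln N)\<^sup>2 + 4)"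
    using \<theta>'[of a] by (simp add: mult.assoc)
  have "(\<Sum>j\<le>n. (cmod (b j))\<^sup>2) \<le> (\<Sum>j\<le>n. (cmod (\<eta> j))\<^sup>2 * (ln N)\<^sup>2 + 4 * s\<^sup>2)"
  proof (rule sum_mono)
    fix j assume "j \<in> {..n}"
    then have "(cmod (\<eta> j))\<^sup>2 \<le> (\<Sum>j\<le>n. (cmod (\<eta> j))\<^sup>2)" by (intro member_le_sum) auto
    also have "\<dots> \<le> (sqrt N * s)\<^sup>2" using \<eta>2 N by (simp add: power_mult_distrib)
    finally have le: "cmod (\<eta> j) \<le> sqrt N * s" by (rule power2_le_imp_le) (use s N in simp)
    have "0 < sqrt N * s" using s N by simp
    from square_ln_square_le[OF norm_ge_zero le this N]
    show "(cmod (b j))\<^sup>2 \<le> (cmod (\<eta> j))\<^sup>2 * (ln N)\<^sup>2 + 4 * s\<^sup>2"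
      using N by (simp add: b_def norm_mult power_mult_distrib)
  qed
  also have "\<dots> = (\<Sum>j\<le>n. (cmod (\<eta> j))\<^sup>2) * (ln N)\<^sup>2 + N * (4 * s\<^sup>2)"
    unfolding sum.distrib sum_distrib_right[symmetric] by (simp add: N_def)
  also have "\<dots> \<le> N * s\<^sup>2 * (ln N)\<^sup>2 + N * (4 * s\<^sup>2)"
    by (intro add_right_mono mult_right_mono \<eta>2) auto
  finally have B: "(\<Sum>j\<le>n. (cmod (b j))\<^sup>2) \<le> N * s\<^sup>2 * ((ln N)\<^sup>2 + 4)" by (simp add: algebra_simps)
  have "(\<Sum>j\<le>n. (cmod ((\<Sum>k\<le>n. \<theta> j k * a k) + - b j))\<^sup>2) \<le> (\<Sum>j\<le>n. 2 * (cmod (\<Sum>k\<le>n. \<theta> j k * a k))\<^sup>2 + 2 * (cmod (b j))\<^sup>2)"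
    using cmod_add_square_le[of _ "- b _"] by (intro sum_mono) simp
  also have "\<dots> \<le> 2 * (N * s\<^sup>2 * ((ln N)\<^sup>2 + 4)) + 2 * (N * s\<^sup>2 * ((ln N)\<^sup>2 + 4))"
    unfolding sum.distrib sum_distrib_left[symmetric] using A B by (intro add_mono mult_left_mono) auto
  finally show ?thesis unfolding split s2 by (simp add: algebra_simps)
qed

text \<open>The residual of the transformed pair is the transform of the old residual plus twice the
  commutator. With |u + v|^2 \<le> 2 |u|^2 + 2 |v|^2, the 32 is 2 * 4 times the 4 of
  \<open>bessel_matrix_commutator\<close>.\<close>

lemma bessel_matrix_residual:
  fixes \<xi> y :: "nat \<Rightarrow> complex" and n :: nat
  assumes \<theta>: "bessel_matrix n \<theta>"
  defines "N \<equiv> real (Suc n)" and "\<eta> \<equiv> \<lambda>j. \<Sum>k\<le>n. \<theta> j k * \<xi> k"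
  shows "(\<Sum>j\<le>n. (cmod ((\<Sum>k\<le>n. \<theta> j k * y k) - 2 * \<eta> j * of_real (ln (cmod (\<eta> j) / sqrt N))))\<^sup>2)
    \<le> 2 * N * (\<Sum>k\<le>n. (cmod (y k - 2 * \<xi> k * of_real (ln (cmod (\<xi> k)))))\<^sup>2)
      + 32 * N * (\<Sum>k\<le>n. (cmod (\<xi> k))\<^sup>2) * ((ln N)\<^sup>2 + 4)"
proof -
  define r where "r k = y k - 2 * \<xi> k * of_real (ln (cmod (\<xi> k)))" for k
  define c where "c j = (\<Sum>k\<le>n. \<theta> j k * (\<xi> k * of_real (ln (cmod (\<xi> k))))) - \<eta> j * of_real (ln (cmod (\<eta> j) / sqrt N))" for j
  have "(\<Sum>k\<le>n. \<theta> j k * r k) = (\<Sum>k\<le>n. \<theta> j k * y k) - 2 * (\<Sum>k\<le>n. \<theta> j k * (\<xi> k * of_real (ln (cmod (\<xi> k)))))" for j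
    unfolding r_def by (simp add: sum_subtractf sum_distrib_left algebra_simps)
  then have eq: "(\<Sum>k\<le>n. \<theta> j k * y k) - 2 * \<eta> j * of_real (ln (cmod (\<eta> j) / sqrt N)) = (\<Sum>k\<le>n. \<theta> j k * r k) + 2 * c j" for j
    by (simp add: c_def algebra_simps)
  have "(\<Sum>j\<le>n. (cmod ((\<Sum>k\<le>n. \<theta> j k * r k) + 2 * c j))\<^sup>2) \<le> (\<Sum>j\<le>n. 2 * (cmod (\<Sum>k\<le>n. \<theta> j k * r k))\<^sup>2 + 8 * (cmod (c j))\<^sup>2)"
    using cmod_add_square_le[of _ "2 * c _"] by (intro sum_mono) (simp add: norm_mult power_mult_distrib)
  also have "\<dots> = 2 * (\<Sum>j\<le>n. (cmod (\<Sum>k\<le>n. \<theta> j k * r k))\<^sup>2) + 8 * (\<Sum>j\<le>n. (cmod (c j))\<^sup>2)"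
    by (simp add: sum.distrib sum_distrib_left)
  also have "\<dots> \<le> 2 * (N * (\<Sum>k\<le>n. (cmod (r k))\<^sup>2)) + 8 * (4 * N * (\<Sum>k\<le>n. (cmod (\<xi> k))\<^sup>2) * ((ln N)\<^sup>2 + 4))"
    using bessel_matrix_commutator[OF \<theta>, of \<xi>] \<theta> unfolding bessel_matrix_def c_def \<eta>_def N_def
    by (intro add_mono mult_left_mono) auto
  finally show ?thesis unfolding eq r_def by (simp add: mult.assoc)
qed

section \<open>Combinations of lifts and the estimate for the Kalton-Peck space\<close>

lemma vcomb_calderon: "vcomb calderon c F n = (\<lambda>z m. \<Sum>k\<le>n. c k * F k z m)"
  by (induction n) auto

lemma Delta_vcomb:
  assumes F: "\<And>k. k \<le> n \<Longrightarrow> F k \<in> vcarrier calderon" and a: "a \<le> 2"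
  shows "Delta a (vcomb calderon c F n) m = (\<Sum>k\<le>n. c k * Delta a (F k) m)"
  using F
proof (induction n)
  case 0
  then show ?case using Delta_scale[OF _ a] by simp
next
  case (Suc n)
  have "vcomb calderon c F n \<in> vcarrier calderon"
    by (rule vcomb_in_carrier) (use calderon_subspaceD(5)[OF calderon_subspace_calderon] Suc.prems in auto)
  from Delta_add[OF this calderon_scale[OF Suc.prems[OF order_refl]] a] Suc Delta_scale[OF Suc.prems[OF order_refl] a]
  show ?case by simp
qed

text \<open>Linearises the root, so that a bound for a sum of squares controls the sum of the roots;
  it takes the place of the Cauchy-Schwarz inequality.\<close>

lemma sqrt_le_amgm:
  fixes q c :: real
  assumes "0 \<le> q" "0 < c"
  shows "sqrt q \<le> (q / c + c) / 2"
proof -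
  have "0 \<le> (sqrt q - c)\<^sup>2" by simp
  then have "2 * sqrt q * c \<le> q + c * c" using assms by (simp add: power2_eq_square algebra_simps)
  then show ?thesis using assms by (simp add: field_simps)
qed

text \<open>Lifts of the \<open>v k\<close> are combined by the rows. \<open>calderon_lower\<close>
  gives ell_2 bounds for single lifts, the matrix inequalities carry them over to the rows one
  coordinate \<open>m\<close> at a time, and \<open>calderon_upper\<close> converts them back into
  norms.\<close>

lemma log_type2_Z2: "log_type2 Z2_space"
  unfolding log_type2_def
proof
  fix b :: real
  \<comment> \<open>Lifts of norm below b + 1 exist, although the infimum need not be
    attained.\<close>
  define A where "A = b + 1"
  define R0 where "R0 = 4 * (A + 1 + A\<^sup>2)"
  \<comment> \<open>\<open>R0\<close> is the constant of \<open>calderon_lower\<close>; 128 is the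
    32 of \<open>bessel_matrix_residual\<close> times the 4 in (ln N)^2 + 4 \<le> 4 (1 + ln
    N)^2.\<close>
  define C1 where "C1 = 2 * R0\<^sup>2 + 128 * A\<^sup>2"
  have C1: "0 \<le> C1" by (simp add: C1_def)
  note cc = calderon_subspace_calderon
  show "\<exists>C. \<forall>n \<theta> v. bessel_matrix n \<theta> \<longrightarrow>
     (\<forall>k\<le>n. v k \<in> vcarrier Z2_space \<and> vnorm Z2_space (v k) \<le> b) \<longrightarrow>
     (\<Sum>j\<le>n. vnorm Z2_space (vcomb Z2_space (\<theta> j) v n)) \<le>
       C * (real (Suc n) * sqrt (real (Suc n)) * (1 + ln (real (Suc n))))"
  \<comment> \<open>In the 4, the share 2 comes from the scale sqrt N, 1 from the summand
    \<open>c\<close> of the linearised root and 1 from the tails.\<close>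
  proof (intro exI[of _ "4 + 2 * A\<^sup>2 + C1"] allI impI)
    fix n \<theta> v
    assume \<theta>: "bessel_matrix n \<theta>" and v: "\<forall>k\<le>n. v k \<in> vcarrier Z2_space \<and> vnorm Z2_space (v k) \<le> b"
    define N L where "N = real (Suc n)" and "L = 1 + ln N"
    have N: "1 \<le> N" and L: "1 \<le> L" by (auto simp: N_def L_def)
    have sN: "1 \<le> sqrt N" "sqrt N * sqrt N = N" using N by auto
    have "\<forall>k. \<exists>F. k \<le> n \<longrightarrow> F \<in> vcarrier calderon \<and> (Delta 1 F, Delta 0 F) = v k \<and> vnorm calderon F < A"
    proof
      fix k
      show "\<exists>F. k \<le> n \<longrightarrow> F \<in> vcarrier calderon \<and> (Delta 1 F, Delta 0 F) = v k \<and> vnorm calderon F < A"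
      proof (cases "k \<le> n")
        case True
        then have vk: "v k \<in> vcarrier (pair_image 1 0 calderon)" "vnorm (pair_image 1 0 calderon) (v k) < A"
          using v unfolding Z2_space_def A_def by auto
        show ?thesis by (rule pair_image_lift[OF cc _ _ vk]) auto
      qed auto
    qed
    then obtain F where F: "\<And>k. k \<le> n \<Longrightarrow> F k \<in> vcarrier calderon" and Fv: "\<And>k. k \<le> n \<Longrightarrow> (Delta 1 (F k), Delta 0 (F k)) = v k"
      and FA: "\<And>k. k \<le> n \<Longrightarrow> vnorm calderon (F k) < A"
      by metis
    define G where "G j = vcomb calderon (\<theta> j) F n" for j
    have G: "G j \<in> vcarrier calderon" for j unfolding G_def
      by (rule vcomb_in_carrier[OF calderon_subspaceD(5)[OF cc] F])
    have vG: "vcomb Z2_space (\<theta> j) v n = (Delta 1 (G j), Delta 0 (G j))" for j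
    proof -
      have "(Delta 1 (G j), Delta 0 (G j)) = vcomb Z2_space (\<theta> j) (\<lambda>k. (Delta 1 (F k), Delta 0 (F k))) n"
        unfolding G_def Z2_space_def
        by (rule bounded_operator_vcomb[OF bounded_operator_pair_image[OF cc] calderon_subspaceD(5)[OF cc]]) (use F in auto)
      also have "\<dots> = vcomb Z2_space (\<theta> j) v n" by (rule vcomb_cong) (rule Fv)
      finally show ?thesis by simp
    qed
    have "\<forall>j. \<exists>K. \<forall>M\<ge>K. vnorm calderon (\<lambda>z m. cut M m * G j z m) \<le> 1"
      using calderon_tail[OF G] by simp
    then obtain Kf where Kf: "\<And>j M. M \<ge> Kf j \<Longrightarrow> vnorm calderon (\<lambda>z m. cut M m * G j z m) \<le> 1" by metis
    \<comment> \<open>One cut-off for all rows; the sum dominates each of the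
      \<open>Kf j\<close>.\<close>
    define K where "K = (\<Sum>j\<le>n. Kf j)"
    have tail: "vnorm calderon (\<lambda>z m. cut K m * G j z m) \<le> 1" if "j \<le> n" for j
      by (rule Kf) (use that in \<open>auto simp: K_def intro!: member_le_sum\<close>)
    define x y where "x k m = F k (1/2) m" and "y k m = Delta 1 (F k) m" for k m
    define X where "X j = (\<Sum>m<K. (cmod (G j (1/2) m))\<^sup>2)" for j
    define Q where "Q j = (\<Sum>m<K. (cmod (Delta 1 (G j) m - 2 * G j (1/2) m * of_real (ln (cmod (G j (1/2) m) / sqrt N))))\<^sup>2)" for j
    have X0: "0 \<le> X j" and Q0: "0 \<le> Q j" for j by (auto simp: X_def Q_def sum_nonneg)
    have Gx: "G j (1/2) m = (\<Sum>k\<le>n. \<theta> j k * x k m)" for j m by (simp add: G_def vcomb_calderon x_def)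
    have Gy: "Delta 1 (G j) m = (\<Sum>k\<le>n. \<theta> j k * y k m)" for j m unfolding G_def y_def by (rule Delta_vcomb[OF F]) auto
    have low: "(\<Sum>m<K. (cmod (x k m))\<^sup>2) \<le> A\<^sup>2"
      "(\<Sum>m<K. (cmod (y k m - 2 * x k m * of_real (ln (cmod (x k m)))))\<^sup>2) \<le> R0\<^sup>2" if "k \<le> n" for k
      unfolding x_def y_def R0_def using calderon_lower[OF F[OF that] less_imp_le[OF FA[OF that]]] by auto
    have swap: "(\<Sum>m<K. \<Sum>k\<le>n. f k m) \<le> N * c" if "\<And>k. k \<le> n \<Longrightarrow> (\<Sum>m<K. f k m) \<le> c" for f :: "nat \<Rightarrow> nat \<Rightarrow> real" and c
    proof -
      have "(\<Sum>m<K. \<Sum>k\<le>n. f k m) = (\<Sum>k\<le>n. \<Sum>m<K. f k m)" by (rule sum.swap)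
      also have "\<dots> \<le> (\<Sum>k\<le>n. c)" by (rule sum_mono) (use that in auto)
      finally show ?thesis by (simp add: N_def)
    qed
    have \<theta>': "(\<Sum>j\<le>n. (cmod (\<Sum>k\<le>n. \<theta> j k * z k))\<^sup>2) \<le> N * (\<Sum>k\<le>n. (cmod (z k))\<^sup>2)" for z
      using \<theta> unfolding bessel_matrix_def N_def by blast
    have sumX: "(\<Sum>j\<le>n. X j) \<le> N * (N * A\<^sup>2)"
    proof -
      have "(\<Sum>j\<le>n. X j) = (\<Sum>m<K. \<Sum>j\<le>n. (cmod (G j (1/2) m))\<^sup>2)" unfolding X_def by (rule sum.swap)
      also have "\<dots> \<le> (\<Sum>m<K. N * (\<Sum>k\<le>n. (cmod (x k m))\<^sup>2))"
        unfolding Gx by (rule sum_mono, rule \<theta>')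
      also have "\<dots> \<le> N * (N * A\<^sup>2)" unfolding sum_distrib_left[symmetric]
        using N by (intro mult_left_mono swap low) auto
      finally show ?thesis .
    qed
    have sumQ: "(\<Sum>j\<le>n. Q j) \<le> N\<^sup>2 * L\<^sup>2 * C1"
    proof -
      have "(\<Sum>j\<le>n. Q j) = (\<Sum>m<K. \<Sum>j\<le>n. (cmod (Delta 1 (G j) m - 2 * G j (1/2) m * of_real (ln (cmod (G j (1/2) m) / sqrt N))))\<^sup>2)"
        unfolding Q_def by (rule sum.swap)
      also have "\<dots> \<le> (\<Sum>m<K. 2 * N * (\<Sum>k\<le>n. (cmod (y k m - 2 * x k m * of_real (ln (cmod (x k m)))))\<^sup>2)
          + 32 * N * (\<Sum>k\<le>n. (cmod (x k m))\<^sup>2) * ((ln N)\<^sup>2 + 4))"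
        unfolding Gx Gy N_def by (intro sum_mono bessel_matrix_residual \<theta>)
      also have "\<dots> = 2 * N * (\<Sum>m<K. \<Sum>k\<le>n. (cmod (y k m - 2 * x k m * of_real (ln (cmod (x k m)))))\<^sup>2)
          + 32 * N * (\<Sum>m<K. \<Sum>k\<le>n. (cmod (x k m))\<^sup>2) * ((ln N)\<^sup>2 + 4)"
        by (simp only: sum.distrib sum_distrib_left sum_distrib_right)
      also have "\<dots> \<le> 2 * N * (N * R0\<^sup>2) + 32 * N * (N * A\<^sup>2) * ((ln N)\<^sup>2 + 4)"
        using N by (intro add_mono mult_left_mono mult_right_mono swap low) auto
      also have "\<dots> \<le> 2 * N * (N * R0\<^sup>2) * L\<^sup>2 + 32 * N * (N * A\<^sup>2) * (4 * L\<^sup>2)"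
      proof (intro add_mono mult_left_mono)
        have "1 \<le> L\<^sup>2" using L by simp
        then have "2 * N * (N * R0\<^sup>2) * 1 \<le> 2 * N * (N * R0\<^sup>2) * L\<^sup>2" using N by (intro mult_left_mono) auto
        then show "2 * N * (N * R0\<^sup>2) \<le> 2 * N * (N * R0\<^sup>2) * L\<^sup>2" by simp
        show "(ln N)\<^sup>2 + 4 \<le> 4 * L\<^sup>2" unfolding L_def using N by (simp add: power2_eq_square algebra_simps)
      qed (use N in auto)
      also have "\<dots> = N\<^sup>2 * L\<^sup>2 * C1" by (simp add: C1_def power2_eq_square algebra_simps)
      finally show ?thesis .
    qed
    \<comment> \<open>The average of the \<open>Q j\<close> is at most N L^2 C1, so sqrt N * L is
      the typical size of their roots.\<close>
    define c where "c = sqrt N * L"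
    have c: "0 < c" using N L by (simp add: c_def)
    have each: "vnorm Z2_space (vcomb Z2_space (\<theta> j) v n) \<le> 2 * sqrt N + 2 * (X j / sqrt N) + (Q j / c + c) + 1" if j: "j \<le> n" for j
    proof -
      \<comment> \<open>The average of the \<open>X j\<close> is at most N A^2, so l = sqrt N
        balances the terms of l + X j / l; it is also the scale inside the logarithm of
        \<open>Q j\<close>.\<close>
      have "0 < sqrt N" using N by simp
      from calderon_upper[OF G this, of j K] obtain E where E: "E \<in> vcarrier calderon" "Delta 0 E = Delta 0 (G j)" "Delta 1 E = Delta 1 (G j)"
        "vnorm calderon E \<le> 2 * (sqrt N + X j / sqrt N + sqrt (Q j)) + vnorm calderon (\<lambda>z m. cut K m * G j z m)"
        unfolding X_def Q_def by blast
      have "vnorm Z2_space (Delta 1 E, Delta 0 E) \<le> vnorm calderon E"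
        unfolding Z2_space_def by (rule pair_image_norm_le[OF cc _ _ E(1)]) auto
      then have "vnorm Z2_space (vcomb Z2_space (\<theta> j) v n) \<le> vnorm calderon E" unfolding vG E(2,3) .
      then show ?thesis using E(4) tail[OF j] sqrt_le_amgm[OF Q0 c, of j] by argo
    qed
    have "(\<Sum>j\<le>n. vnorm Z2_space (vcomb Z2_space (\<theta> j) v n)) \<le> (\<Sum>j\<le>n. 2 * sqrt N + 2 * (X j / sqrt N) + (Q j / c + c) + 1)"
      by (rule sum_mono, rule each) simp
    also have "\<dots> = N * (2 * sqrt N) + 2 * ((\<Sum>j\<le>n. X j) / sqrt N) + ((\<Sum>j\<le>n. Q j) / c + N * c) + N"
      by (simp add: sum.distrib sum_distrib_left sum_divide_distrib N_def)
    also have "\<dots> \<le> N * (2 * sqrt N) + 2 * (N * (N * A\<^sup>2) / sqrt N) + (N\<^sup>2 * L\<^sup>2 * C1 / c + N * c) + N"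
      using sumX sumQ N c by (intro add_mono mult_left_mono divide_right_mono) auto
    also have "N * (N * A\<^sup>2) / sqrt N = N * sqrt N * A\<^sup>2" using sN N by (simp add: field_simps)
    also have "N\<^sup>2 * L\<^sup>2 * C1 / c = N * sqrt N * L * C1"
    proof -
      have "N\<^sup>2 * L\<^sup>2 * C1 = (N * sqrt N * L * C1) * c" unfolding c_def using sN(2) by (simp add: power2_eq_square)
      then show ?thesis using c by (metis less_irrefl nonzero_mult_div_cancel_right)
    qed
    also have "N * (2 * sqrt N) + 2 * (N * sqrt N * A\<^sup>2) + (N * sqrt N * L * C1 + N * c) + N
        \<le> (4 + 2 * A\<^sup>2 + C1) * (N * sqrt N * L)"
    proof -
      let ?T = "N * sqrt N * L"
      have t1: "N * sqrt N \<le> ?T" using L N by simp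
      have t2: "N \<le> N * sqrt N" using sN N by simp
      have "N * sqrt N * A\<^sup>2 \<le> ?T * A\<^sup>2" by (intro mult_right_mono t1) auto
      moreover have "N * c = ?T" by (simp add: c_def)
      moreover have "(4 + 2 * A\<^sup>2 + C1) * ?T = 4 * ?T + 2 * (?T * A\<^sup>2) + ?T * C1" by (simp add: algebra_simps)
      moreover have "N * (2 * sqrt N) = 2 * (N * sqrt N)" by simp
      ultimately show ?thesis using t1 t2 by linarith
    qed
    finally show "(\<Sum>j\<le>n. vnorm Z2_space (vcomb Z2_space (\<theta> j) v n)) \<le>
       (4 + 2 * A\<^sup>2 + C1) * (real (Suc n) * sqrt (real (Suc n)) * (1 + ln (real (Suc n))))"
      unfolding N_def L_def .
  qed
qed

section \<open>The discrete Fourier matrix\<close>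

definition dft :: "nat \<Rightarrow> nat \<Rightarrow> nat \<Rightarrow> complex" where
  "dft n j k = exp (2 * of_real pi * \<i> * of_nat (j * k) / of_nat (Suc n))"

lemma cmod_dft [simp]: "cmod (dft n j k) = 1"
  by (simp add: dft_def)

lemma dft_sym: "dft n j k = dft n k j"
  by (simp add: dft_def mult.commute)

text \<open>For distinct columns the quotient of the two roots of unity is an N-th root of unity
  other than 1, so its geometric sum vanishes.\<close>

lemma dft_orthogonal:
  assumes "k \<le> n" "l \<le> n"
  shows "(\<Sum>j\<le>n. dft n j k * cnj (dft n j l)) = (if k = l then of_nat (Suc n) else 0)"
proof -
  define \<rho> where "\<rho> k = exp (2 * of_real pi * \<i> * of_nat k / of_nat (Suc n))" for k
  have dft_power: "dft n j k = \<rho> k ^ j" for j k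
    unfolding dft_def \<rho>_def exp_of_nat_mult[symmetric] by (simp add: algebra_simps)
  have \<rho>1: "\<rho> k * cnj (\<rho> k) = 1" for k
    unfolding complex_norm_square[symmetric] by (simp add: \<rho>_def)
  have \<rho>N: "\<rho> k ^ Suc n = 1" for k unfolding \<rho>_def by (rule complex_root_unity) simp
  define q where "q = \<rho> k * cnj (\<rho> l)"
  have "(\<Sum>j\<le>n. dft n j k * cnj (dft n j l)) = (\<Sum>j<Suc n. q ^ j)"
    by (simp add: dft_power q_def power_mult_distrib lessThan_Suc_atMost)
  also have "\<dots> = (if k = l then of_nat (Suc n) else 0)"
  proof (cases "k = l")
    case True
    then show ?thesis by (simp add: q_def \<rho>1)
  next
    case False
    have "q \<noteq> 1"
    proof
      assume "q = 1"
      then have "q * \<rho> l = \<rho> l" by simp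
      then have "\<rho> k = \<rho> l" using \<rho>1[of l] unfolding q_def by (metis mult.assoc mult.commute mult_1_right)
      then have "k mod Suc n = l mod Suc n" unfolding \<rho>_def by (subst (asm) complex_root_unity_eq) auto
      then show False using False assms by simp
    qed
    then have "(\<Sum>j<Suc n. q ^ j) = (q ^ Suc n - 1) / (q - 1)" by (rule geometric_sum)
    moreover have "q ^ Suc n = 1"
      unfolding q_def power_mult_distrib complex_cnj_power[symmetric] \<rho>N by simp
    ultimately have "(\<Sum>j<Suc n. q ^ j) = 0" by (simp only: diff_self div_0)
    then show ?thesis using False by (simp only: if_False)
  qed
  finally show ?thesis .
qed

text \<open>Parseval's identity, computed in the complex numbers, where squared moduli expand into
  products with conjugates.\<close>

lemma bessel_matrix_dft: "bessel_matrix n (dft n)"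
  unfolding bessel_matrix_def
proof
  fix x :: "nat \<Rightarrow> complex"
  have "complex_of_real (\<Sum>j\<le>n. (cmod (\<Sum>k\<le>n. dft n j k * x k))\<^sup>2)
      = (\<Sum>j\<le>n. \<Sum>k\<le>n. \<Sum>l\<le>n. x k * cnj (x l) * (dft n j k * cnj (dft n j l)))"
    by (simp only: of_real_sum complex_norm_square cnj_sum complex_cnj_mult sum_product) (simp add: algebra_simps)
  also have "\<dots> = (\<Sum>k\<le>n. \<Sum>l\<le>n. x k * cnj (x l) * (\<Sum>j\<le>n. dft n j k * cnj (dft n j l)))"
    unfolding sum_distrib_left by (rule trans[OF sum.swap], rule sum.cong[OF refl], rule sum.swap)
  also have "\<dots> = (\<Sum>k\<le>n. \<Sum>l\<le>n. if k = l then x k * cnj (x k) * of_nat (Suc n) else 0)"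
    by (intro sum.cong refl) (simp only: dft_orthogonal atMost_iff, simp)
  also have "\<dots> = (\<Sum>k\<le>n. x k * cnj (x k) * of_nat (Suc n))"
    by (intro sum.cong refl) simp
  also have "\<dots> = complex_of_real (real (Suc n) * (\<Sum>k\<le>n. (cmod (x k))\<^sup>2))"
    unfolding complex_norm_square[symmetric] sum_distrib_right[symmetric] by simp
  finally show "(\<Sum>j\<le>n. (cmod (\<Sum>k\<le>n. dft n j k * x k))\<^sup>2) \<le> real (Suc n) * (\<Sum>k\<le>n. (cmod (x k))\<^sup>2)"
    unfolding of_real_eq_iff by simp
qed

section \<open>Failure for the other spaces\<close>

lemma higher_deriv_sum:
  fixes f :: "'b \<Rightarrow> complex \<Rightarrow> complex"
  assumes "finite I" "\<And>i. i \<in> I \<Longrightarrow> f i holomorphic_on S" "open S" "z \<in> S"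
  shows "(deriv ^^ n) (\<lambda>w. \<Sum>i\<in>I. f i w) z = (\<Sum>i\<in>I. (deriv ^^ n) (f i) z)"
  using assms(1,2)
proof (induction I rule: finite_induct)
  case (insert i I)
  have "(deriv ^^ n) (\<lambda>w. f i w + (\<Sum>i\<in>I. f i w)) z = (deriv ^^ n) (f i) z + (deriv ^^ n) (\<lambda>w. \<Sum>i\<in>I. f i w) z"
    by (rule higher_deriv_add[OF _ _ assms(3,4)]) (use insert.prems in \<open>auto intro!: holomorphic_intros\<close>)
  then show ?case using insert by simp
qed simp

text \<open>Testing \<open>F\<close> against \<open>z \<mapsto> N\<^bsup>z - 1\<^esup> \<theta>\<close>, which has modulus at most \<open>1/N\<close> in every coordinate for
  \<open>Re z = 0\<close> and at most \<open>1\<close> for \<open>Re z = 1\<close>, and differentiating twice at \<open>1/2\<close>.\<close>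

definition log_test :: "nat \<Rightarrow> (nat \<Rightarrow> complex) \<Rightarrow> cseq \<Rightarrow> cseq \<Rightarrow> cseq \<Rightarrow> complex" where
  "log_test n \<theta> x0 x1 x2 = (\<Sum>m\<le>n. \<theta> m * (of_real ((ln (real (Suc n)))\<^sup>2) * x0 m +
     of_real (2 * ln (real (Suc n))) * x1 m + 2 * x2 m)) / of_real (sqrt (real (Suc n)))"

text \<open>\<open>log_test\<close> is the second derivative at 1/2 of the sum of the \<theta>_m F_m
  times N^(z - 1), by the Leibniz rule. On the left line N bounded coordinates meet the factor 1 /
  N; on the right line the ell_1 norm of F is the bound. The 32 is 2! * 4^2 from
  \<open>strip_cauchy\<close>.\<close>

lemma cmod_log_test_le:
  assumes F: "F \<in> vcarrier calderon" and \<theta>: "\<And>m. m \<le> n \<Longrightarrow> cmod (\<theta> m) \<le> 1"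
  shows "cmod (log_test n \<theta> (Delta 0 F) (Delta 1 F) (Delta 2 F)) \<le> 32 * vnorm calderon F"
proof -
  define N l where "N = real (Suc n)" and "l = ln N"
  have N: "1 \<le> N" by (simp add: N_def)
  obtain B where B: "\<And>z n. cmod (F z n) \<le> B" using calderonD(3)[OF F] by blast
  have B0: "0 \<le> B" using B[of 0 0] norm_ge_zero order_trans by blast
  define g where "g z = exp ((z - 1) * of_real l)" for z :: complex
  define f where "f z = (\<Sum>m\<le>n. \<theta> m * F z m)" for z
  have dg: "(deriv ^^ i) g = (\<lambda>z. of_real l ^ i * g z)" for i
  proof (induction i)
    case (Suc i)
    have "((\<lambda>z. of_real l ^ i * g z) has_field_derivative of_real l ^ Suc i * g z) (at z)" for z
      unfolding g_def by (auto intro!: derivative_eq_intros)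
    then show ?case using Suc by (auto simp: DERIV_imp_deriv)
  qed simp
  have hol_f: "f holomorphic_on open_strip" unfolding f_def by (intro holomorphic_intros calderonD(5)[OF F])
  have hol_g: "g holomorphic_on open_strip" unfolding g_def by (intro holomorphic_intros)
  have df: "(deriv ^^ i) f (1/2) = (\<Sum>m\<le>n. \<theta> m * (fact i * Delta i F m))" if i: "i \<le> 2" for i
  proof -
    have "(deriv ^^ i) f (1/2) = (\<Sum>m\<le>n. (deriv ^^ i) (\<lambda>z. \<theta> m * F z m) (1/2))"
      unfolding f_def by (rule higher_deriv_sum[OF _ _ open_open_strip half_in_open_strip]) (auto intro!: holomorphic_intros calderonD(5)[OF F])
    also have "\<dots> = (\<Sum>m\<le>n. \<theta> m * (fact i * Delta i F m))"
      by (intro sum.cong refl) (simp add: higher_deriv_cmult[OF calderonD(5)[OF F] half_in_open_strip open_open_strip] Delta_eq[OF F i])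
    finally show ?thesis .
  qed
  have exp_half: "exp (l / 2) = sqrt N" using N unfolding l_def by (simp add: ln_sqrt[symmetric])
  have g_half: "g (1/2) = 1 / of_real (sqrt N)"
  proof -
    have "g (1/2) = of_real (exp (- (l / 2)))" unfolding g_def exp_of_real[symmetric] by simp
    also have "\<dots> = of_real (1 / sqrt N)" unfolding exp_minus exp_half by (simp only: inverse_eq_divide)
    finally show ?thesis by (simp only: of_real_divide of_real_1)
  qed
  define S where "S z = f z * g z" for z
  have "(deriv ^^ 2) S (1/2) = (\<Sum>i = 0..2. of_nat (2 choose i) * (deriv ^^ i) f (1/2) * (deriv ^^ (2 - i)) g (1/2))"
    unfolding S_def by (rule higher_deriv_mult[OF hol_f hol_g open_open_strip half_in_open_strip])
  also have "\<dots> = (deriv ^^ 0) f (1/2) * (of_real l ^ 2 * g (1/2)) + 2 * (deriv ^^ 1) f (1/2) * (of_real l ^ 1 * g (1/2)) + (deriv ^^ 2) f (1/2) * g (1/2)"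
    unfolding dg by (simp add: numeral_2_eq_2)
  also have "\<dots> = log_test n \<theta> (Delta 0 F) (Delta 1 F) (Delta 2 F)"
    unfolding df[OF zero_le] df[OF one_le_numeral] df[OF order_refl] g_half log_test_def N_def[symmetric] l_def[symmetric]
    by (simp add: sum.distrib sum_distrib_left sum_distrib_right add_divide_distrib algebra_simps sum_divide_distrib)
  finally have eq: "(deriv ^^ 2) S (1/2) = log_test n \<theta> (Delta 0 F) (Delta 1 F) (Delta 2 F)" .
  have gabs: "cmod (g z) = exp ((Re z - 1) * l)" for z by (simp add: g_def)
  have fabs: "cmod (f z) \<le> (\<Sum>m\<le>n. cmod (F z m))" for z
    unfolding f_def by (rule sum_norm_le) (use \<theta> in \<open>auto simp: norm_mult intro!: mult_left_le_one_le\<close>)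
  have l0: "0 \<le> l" using N by (simp add: l_def)
  have "cmod ((deriv ^^ 2) S (1/2)) \<le> fact 2 * vnorm calderon F * 4 ^ 2"
  proof (rule strip_cauchy)
    show "continuous_on strip S" unfolding S_def f_def g_def by (intro continuous_intros calderonD(6)[OF F])
    show "S holomorphic_on open_strip" unfolding S_def by (intro holomorphic_intros hol_f hol_g)
    show "cmod (S z) \<le> N * B * 1" if z: "z \<in> strip" for z
      unfolding S_def norm_mult
    proof (rule mult_mono)
      show "cmod (f z) \<le> N * B"
        using fabs[of z] sum_mono[of "{..n}" "\<lambda>m. cmod (F z m)" "\<lambda>_. B"] B by (simp add: N_def)
      show "cmod (g z) \<le> 1" unfolding gabs using z l0 by (simp add: strip_def mult_nonpos_nonneg)
    qed (use N B0 in auto)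
    fix t
    have "cmod (f (Complex 0 t)) \<le> N * vnorm calderon F"
      using fabs[of "Complex 0 t"] sum_mono[of "{..n}" "\<lambda>m. cmod (F (Complex 0 t) m)" "\<lambda>_. vnorm calderon F"]
        calderon_norm_upper(1)[OF F] by (simp add: N_def)
    moreover have g0: "cmod (g (Complex 0 t)) = 1 / N" unfolding gabs l_def using N by (simp add: exp_minus divide_inverse)
    ultimately show "cmod (S (Complex 0 t)) \<le> vnorm calderon F"
      unfolding S_def norm_mult g0 using N by (simp add: field_simps)
    have "cmod (f (Complex 1 t)) \<le> vnorm calderon F"
      using fabs[of "Complex 1 t"] calderon_norm_upper(3)[OF F, of "{..n}" t] by simp
    then show "cmod (S (Complex 1 t)) \<le> vnorm calderon F" unfolding S_def norm_mult gabs by simp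
  qed
  then show ?thesis unfolding eq by simp
qed

text \<open>With w = z - 1/2, the factor 1 - w^2 cancels the first term of the Gaussian: exp (w^2)
  (1 - w^2) = 1 - w^4 / 2 + ..., so the derivatives of order one and two vanish at 1/2. The bump
  thus lies in the kernels of both \<open>Delta 1\<close> and \<open>Delta 2\<close>. Division by 6
  keeps its norm at most 1.\<close>

definition bump :: "nat \<Rightarrow> complex \<Rightarrow> cseq" where
  "bump k = (\<lambda>z m. if z \<in> strip \<and> m < Suc k then exp ((z - 1/2)\<^sup>2) * (if m = k then (1 - (z - 1/2)\<^sup>2) / 6 else 0) else 0)"

lemma bump_calderon: "bump k \<in> vcarrier calderon"
  unfolding bump_def
proof (rule calderon_gauss)
  fix m
  show "(\<lambda>z. if m = k then (1 - (z - 1/2)\<^sup>2) / 6 else 0 :: complex) holomorphic_on UNIV"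
    by (cases "m = k") (auto intro!: holomorphic_intros)
  show "\<exists>c. \<forall>z\<in>strip. cmod (if m = k then (1 - (z - 1/2)\<^sup>2) / 6 else 0) \<le> c * (1 + (Im z)\<^sup>2 / 2)"
  proof (intro exI[of _ 2] ballI)
    fix z assume "z \<in> strip"
    from gauss_weights(5)[OF strip_Re[OF this]]
    have "cmod (1 - (z - 1/2)\<^sup>2) \<le> 2 * (1 + (Im z)\<^sup>2 / 2)" by simp
    moreover have "cmod ((1 - (z - 1/2)\<^sup>2) / 6) \<le> cmod (1 - (z - 1/2)\<^sup>2)" by (simp add: norm_divide)
    ultimately have le: "cmod ((1 - (z - 1/2)\<^sup>2) / 6) \<le> 2 * (1 + (Im z)\<^sup>2 / 2)" by linarith
    show "cmod (if m = k then (1 - (z - 1/2)\<^sup>2) / 6 else 0) \<le> 2 * (1 + (Im z)\<^sup>2 / 2)"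
      using le order_trans[OF norm_ge_zero le] by (cases "m = k") (simp_all only: if_True if_False norm_zero simp_thms)
  qed
qed

lemma cmod_bump_le: "cmod (bump k z m) \<le> (if m = k then 1 else 0)"
proof (cases "z \<in> strip \<and> m = k")
  case True
  then have "cmod (bump k z m) = cmod (exp ((z - 1/2)\<^sup>2)) * cmod (1 - (z - 1/2)\<^sup>2) / 6"
    by (simp add: bump_def norm_mult norm_divide)
  then show ?thesis using gauss_weights(3)[OF strip_Re, of z] True by simp
qed (auto simp: bump_def)

lemma vnorm_bump_le: "vnorm calderon (bump k) \<le> 1"
proof (rule calderon_norm_least)
  show "cmod (bump k (Complex 0 t) n) \<le> 1" for t n
    using cmod_bump_le[of k "Complex 0 t" n] by (simp split: if_splits)
  fix t
  have "sumn (bump k (Complex 1 t)) = (\<Sum>m<Suc k. cmod (bump k (Complex 1 t) m))"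
    by (rule finite_support(2)) (simp add: bump_def)
  also have "\<dots> \<le> (\<Sum>m<Suc k. if m = k then 1 else 0)" by (intro sum_mono cmod_bump_le)
  finally show "sumn (bump k (Complex 1 t)) \<le> 1" by simp
qed

lemma Delta_bump:
  "Delta 0 (bump k) = (\<lambda>m. if m = k then 1/6 else 0)" "Delta 1 (bump k) = (\<lambda>m. 0)" "Delta 2 (bump k) = (\<lambda>m. 0)"
proof -
  show "Delta 0 (bump k) = (\<lambda>m. if m = k then 1/6 else 0)" by (auto simp: bump_def)
  define h where "h z = exp ((z - 1/2)\<^sup>2) * ((1 - (z - 1/2)\<^sup>2) / 6)" for z :: complex
  define g where "g z = (z - 1/2) ^ 3 * exp ((z - 1/2)\<^sup>2) * (- 1 / 3)" for z :: complex
  have "(h has_field_derivative g z) (at z)" for z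
    unfolding h_def g_def by (rule derivative_eq_intros refl | simp)+ (simp add: field_simps power2_eq_square power3_eq_cube)
  then have d1: "deriv h = g" by (auto simp: DERIV_imp_deriv)
  have "(g has_field_derivative 0) (at (1/2))"
    unfolding g_def by (auto intro!: derivative_eq_intros)
  then have d2: "deriv g (1/2) = 0" by (rule DERIV_imp_deriv)
  have high: "(deriv ^^ i) (\<lambda>z. bump k z m) (1/2) = (if m = k then (deriv ^^ i) h (1/2) else 0)" if "0 < i" for i m
  proof -
    have ev: "\<forall>\<^sub>F z in nhds (1/2). z \<in> open_strip" by (intro eventually_nhds_in_open open_open_strip half_in_open_strip)
    have "\<forall>\<^sub>F z in nhds (1/2). bump k z m = (if m = k then h z else 0)"
      using ev by eventually_elim (use open_strip_subset in \<open>auto simp: bump_def h_def\<close>)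
    then have "(deriv ^^ i) (\<lambda>z. bump k z m) (1/2) = (deriv ^^ i) (\<lambda>z. if m = k then h z else 0) (1/2)"
      by (rule higher_deriv_cong_ev) simp
    then show ?thesis using that by (cases "m = k") auto
  qed
  show "Delta 1 (bump k) = (\<lambda>m. 0)"
    using high[of 1] by (auto simp: Delta_eq[OF bump_calderon] d1 g_def)
  show "Delta 2 (bump k) = (\<lambda>m. 0)"
    using high[of 2] by (auto simp: Delta_eq[OF bump_calderon] numeral_2_eq_2 d1 d2)
qed

section \<open>Criterion for failure, and dual spaces\<close>

lemma no_log_square_bound: "\<exists>n. C * (1 + ln (real (Suc n))) < c * (ln (real (Suc n)))\<^sup>2" if c: "0 < c" for C c :: real
proof -
  define x where "x = 2 * \<bar>C\<bar> / c + 1"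
  have x: "1 \<le> x" using c by (simp add: x_def)
  obtain n where n: "exp x \<le> real n" using real_arch_simple by blast
  define y where "y = ln (real (Suc n))"
  have "ln (exp x) \<le> y" unfolding y_def using n by (subst ln_le_cancel_iff) auto
  then have y: "x \<le> y" "1 \<le> y" using x by auto
  have "2 * \<bar>C\<bar> < c * y" using y(1) c by (simp add: x_def field_simps)
  then have "2 * \<bar>C\<bar> * y < c * y * y" using y(2) by (intro mult_strict_right_mono) auto
  moreover have "C * (1 + y) \<le> \<bar>C\<bar> * (2 * y)" using y(2) by (intro mult_mono) auto
  ultimately show ?thesis unfolding y_def[symmetric] power2_eq_square by (intro exI[of _ n]) (simp add: y_def algebra_simps)
qed

lemma vcomb_scalars: "vcomb scalars c x n = (\<Sum>k\<le>n. c k * x k)"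
  by (induction n) (simp_all add: scalars_def)

text \<open>Every one of the N rows is large, so the sum over rows is of order N^(3/2) ln^2 N. The
  vectors may depend on \<open>n\<close>, as the functionals used in the dual spaces do.\<close>

lemma not_log_type2I:
  assumes c: "0 < c"
    and v: "\<And>n k. k \<le> n \<Longrightarrow> v n k \<in> vcarrier X \<and> vnorm X (v n k) \<le> b"
    and low: "\<And>n j. j \<le> n \<Longrightarrow> c * (sqrt (real (Suc n)) * (ln (real (Suc n)))\<^sup>2) \<le> vnorm X (vcomb X (dft n j) (v n) n)"
  shows "\<not> log_type2 X"
proof
  assume "log_type2 X"
  then obtain C where C: "\<And>n \<theta> v. bessel_matrix n \<theta> \<Longrightarrow>
     (\<forall>k\<le>n. v k \<in> vcarrier X \<and> vnorm X (v k) \<le> b) \<Longrightarrow>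
     (\<Sum>j\<le>n. vnorm X (vcomb X (\<theta> j) v n)) \<le>
       C * (real (Suc n) * sqrt (real (Suc n)) * (1 + ln (real (Suc n))))"
    unfolding log_type2_def by meson
  obtain n where n: "C * (1 + ln (real (Suc n))) < c * (ln (real (Suc n)))\<^sup>2" using no_log_square_bound[OF c] by blast
  let ?N = "real (Suc n)"
  have "?N * (c * (sqrt ?N * (ln ?N)\<^sup>2)) = (\<Sum>j\<le>n. c * (sqrt ?N * (ln ?N)\<^sup>2))" by simp
  also have "\<dots> \<le> (\<Sum>j\<le>n. vnorm X (vcomb X (dft n j) (v n) n))" by (intro sum_mono low) simp
  also have "\<dots> \<le> C * (?N * sqrt ?N * (1 + ln ?N))" by (intro C bessel_matrix_dft) (use v in blast)
  finally have "(?N * sqrt ?N) * (c * (ln ?N)\<^sup>2) \<le> (?N * sqrt ?N) * (C * (1 + ln ?N))" by (simp only: mult_ac)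
  moreover have "(?N * sqrt ?N) * (C * (1 + ln ?N)) < (?N * sqrt ?N) * (c * (ln ?N)\<^sup>2)"
    by (rule mult_strict_left_mono[OF n]) simp
  ultimately show False by linarith
qed

lemma bounded_functional:
  "bounded_operator X scalars f \<longleftrightarrow>
     (\<forall>x\<in>vcarrier X. \<forall>y\<in>vcarrier X. f (vadd X x y) = f x + f y) \<and>
     (\<forall>d. \<forall>x\<in>vcarrier X. f (vscale X d x) = d * f x) \<and> (\<exists>B. \<forall>x\<in>vcarrier X. cmod (f x) \<le> B * vnorm X x)"
  by (simp add: bounded_operator_def scalars_def)

lemma vclosed_dual_space: "vclosed (dual_space X)"
proof -
  have add: "bounded_operator X scalars (\<lambda>x. f x + g x)" if f: "bounded_operator X scalars f" and g: "bounded_operator X scalars g" for f g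
  proof -
    obtain B1 where B1: "\<And>x. x \<in> vcarrier X \<Longrightarrow> cmod (f x) \<le> B1 * vnorm X x" using f unfolding bounded_functional by blast
    obtain B2 where B2: "\<And>x. x \<in> vcarrier X \<Longrightarrow> cmod (g x) \<le> B2 * vnorm X x" using g unfolding bounded_functional by blast
    have "cmod (f x + g x) \<le> (B1 + B2) * vnorm X x" if "x \<in> vcarrier X" for x
      using norm_triangle_ineq[of "f x" "g x"] B1[OF that] B2[OF that] by (simp add: distrib_right)
    then have "\<exists>B. \<forall>x\<in>vcarrier X. cmod (f x + g x) \<le> B * vnorm X x" by blast
    with f g show ?thesis unfolding bounded_functional by (simp add: algebra_simps)
  qed
  have scale: "bounded_operator X scalars (\<lambda>x. c * f x)" if f: "bounded_operator X scalars f" for f c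
  proof -
    obtain B1 where B1: "\<And>x. x \<in> vcarrier X \<Longrightarrow> cmod (f x) \<le> B1 * vnorm X x" using f unfolding bounded_functional by blast
    have "cmod (c * f x) \<le> (cmod c * B1) * vnorm X x" if "x \<in> vcarrier X" for x
      using mult_left_mono[OF B1[OF that] norm_ge_zero[of c]] by (simp add: norm_mult mult.assoc)
    then have "\<exists>B. \<forall>x\<in>vcarrier X. cmod (c * f x) \<le> B * vnorm X x" by blast
    with f show ?thesis unfolding bounded_functional by (simp add: algebra_simps)
  qed
  show ?thesis unfolding vclosed_def dual_space_def using add scale by auto
qed

lemma dual_norm_upper:
  assumes g: "g \<in> vcarrier (dual_space X)" and p: "p \<in> vcarrier X" "vnorm X p \<le> 1"
    and nonneg: "\<And>x. x \<in> vcarrier X \<Longrightarrow> 0 \<le> vnorm X x"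
  shows "cmod (g p) \<le> vnorm (dual_space X) g"
proof -
  obtain B where B: "\<And>x. x \<in> vcarrier X \<Longrightarrow> cmod (g x) \<le> B * vnorm X x"
  proof -
    have "bounded_operator X scalars g" using g by (simp add: dual_space_def)
    then show thesis using that unfolding bounded_functional by blast
  qed
  have "cmod (g x) \<le> \<bar>B\<bar>" if "x \<in> vcarrier X" "vnorm X x \<le> 1" for x
  proof -
    have "B * vnorm X x \<le> \<bar>B\<bar> * 1" using that nonneg[OF that(1)] by (intro mult_mono) auto
    then show ?thesis using B[OF that(1)] by simp
  qed
  then have "bdd_above {cmod (g x) |x. x \<in> vcarrier X \<and> vnorm X x \<le> 1}" by (intro bdd_aboveI[of _ "\<bar>B\<bar>"]) auto
  then have "cmod (g p) \<le> Sup {cmod (g x) |x. x \<in> vcarrier X \<and> vnorm X x \<le> 1}" by (intro cSup_upper) (use p in auto)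
  then show ?thesis by (simp add: dual_space_def)
qed

lemma vcomb_dual_space: "vcomb (dual_space X) c f n = (\<lambda>x. \<Sum>k\<le>n. c k * f k x)"
  by (induction n) (simp_all add: dual_space_def)

section \<open>Both spaces at once: (0, 1, 2) stands for \<open>bigcirc_space\<close> and (2, 0, 1)
  for \<open>wedge_space\<close>\<close>

context
  fixes a b c :: nat
  assumes abc: "(a, b, c) \<in> {(0, 1, 2), (2, 0, 1)}"
begin

private abbreviation "X \<equiv> pair_image a b (ker_Delta c)"

text \<open>Recovers the full jet of order two from a pair: the missing index is \<open>c\<close>,
  whose entry is zero on the kernel of \<open>Delta c\<close>.\<close>

private definition coords :: "cseq \<times> cseq \<Rightarrow> nat \<Rightarrow> cseq" where
  "coords p i = (if i = a then fst p else if i = b then snd p else (\<lambda>m. 0))"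

text \<open>The value 0 off the carrier is the convention for elements of
  \<open>dual_space\<close>.\<close>

private definition test :: "nat \<Rightarrow> (nat \<Rightarrow> complex) \<Rightarrow> cseq \<times> cseq \<Rightarrow> complex" where
  "test n \<theta> p = (if p \<in> vcarrier X then log_test n \<theta> (coords p 0) (coords p 1) (coords p 2) else 0)"

private lemma le2: "a \<le> 2" "b \<le> 2" "c \<le> 2" and ne: "a \<noteq> b" "a \<noteq> c" "b \<noteq> c"
  using abc by auto

private lemmas K = calderon_subspace_ker[OF le2(3)]

private lemma coords_Delta:
  assumes "F \<in> vcarrier (ker_Delta c)" "i \<le> 2"
  shows "coords (Delta a F, Delta b F) i = Delta i F"
proof -
  have "i = a \<or> i = b \<or> i = c" using abc assms(2) by auto
  moreover have "Delta c F = (\<lambda>m. 0)" using assms(1) by (simp add: ker_Delta_def subspace_of_def)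
  ultimately show ?thesis using ne by (auto simp: coords_def)
qed

text \<open>The value of \<open>test\<close> depends on the pair only, while
  \<open>cmod_log_test_le\<close> holds for each lift; passing to the infimum over lifts gives the
  quotient norm.\<close>

private lemma cmod_test_le:
  assumes p: "p \<in> vcarrier X" and \<theta>: "\<And>m. m \<le> n \<Longrightarrow> cmod (\<theta> m) \<le> 1"
  shows "cmod (test n \<theta> p) \<le> 32 * vnorm X p"
proof -
  have "cmod (test n \<theta> p) / 32 \<le> vnorm X p"
  proof (rule pair_image_norm_ge[OF K le2(1,2) p])
    fix F assume F: "F \<in> vcarrier (ker_Delta c)" "(Delta a F, Delta b F) = p"
    have "cmod (test n \<theta> p) \<le> 32 * vnorm calderon F"
      using cmod_log_test_le[OF calderon_subspaceD(1)[OF K F(1)] \<theta>, of n] p coords_Delta[OF F(1)]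
      unfolding F(2)[symmetric] test_def by simp
    then show "cmod (test n \<theta> p) / 32 \<le> vnorm calderon F" by simp
  qed
  then show ?thesis by simp
qed

private lemma test_dual:
  assumes \<theta>: "\<And>m. m \<le> n \<Longrightarrow> cmod (\<theta> m) \<le> 1"
  shows "bounded_operator X scalars (test n \<theta>)"
  unfolding bounded_operator_def
proof (intro conjI ballI allI exI[of _ 32])
  fix p q d assume p: "p \<in> vcarrier X" and q: "q \<in> vcarrier X"
  have cl: "vadd X p q \<in> vcarrier X" "vscale X d p \<in> vcarrier X"
    using vclosed_pair_image[OF K le2(1,2)] p q by (auto simp: vclosed_def)
  have lin: "coords (vadd X p q) i = (\<lambda>m. coords p i m + coords q i m)" "coords (vscale X d p) i = (\<lambda>m. d * coords p i m)" for i
    by (auto simp: coords_def pair_image_def)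
  show "test n \<theta> p \<in> vcarrier scalars" by (simp add: scalars_def)
  show "test n \<theta> (vadd X p q) = vadd scalars (test n \<theta> p) (test n \<theta> q)"
    using cl p q unfolding test_def lin log_test_def
    by (simp add: scalars_def algebra_simps sum.distrib add_divide_distrib sum_divide_distrib)
  show "test n \<theta> (vscale X d p) = vscale scalars d (test n \<theta> p)"
    using cl p q unfolding test_def lin log_test_def
    by (simp add: scalars_def algebra_simps sum_distrib_left)
  show "vnorm scalars (test n \<theta> p) \<le> 32 * vnorm X p" using cmod_test_le[OF p \<theta>, of n] by (simp add: scalars_def)
qed

text \<open>The pair with e_k / 6 in the place of \<open>Delta 0\<close> and 0 in the other.\<close>

private definition unit :: "nat \<Rightarrow> cseq \<times> cseq" where
  "unit k = (Delta a (bump k), Delta b (bump k))"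

private lemma bump_ker: "bump k \<in> vcarrier (ker_Delta c)"
proof -
  have "c = 1 \<or> c = 2" using abc by auto
  then show ?thesis using bump_calderon Delta_bump by (auto simp: ker_Delta_def subspace_of_def)
qed

private lemma unit: "unit k \<in> vcarrier X" "vnorm X (unit k) \<le> 1"
proof -
  show "unit k \<in> vcarrier X" using bump_ker by (auto simp: unit_def pair_image_def)
  show "vnorm X (unit k) \<le> 1"
    using pair_image_norm_le[OF K le2(1,2) bump_ker] vnorm_bump_le order_trans unfolding unit_def by blast
qed

private lemma test_unit:
  assumes "k \<le> n"
  shows "test n \<theta> (unit k) = \<theta> k * of_real ((ln (real (Suc n)))\<^sup>2 / (6 * sqrt (real (Suc n))))"
proof -
  have "test n \<theta> (unit k) = log_test n \<theta> (Delta 0 (bump k)) (Delta 1 (bump k)) (Delta 2 (bump k))"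
    using unit(1) coords_Delta[OF bump_ker] unfolding test_def unit_def by simp
  also have "\<dots> = (\<Sum>m\<le>n. if m = k then \<theta> k * of_real ((ln (real (Suc n)))\<^sup>2) / 6 else 0) / of_real (sqrt (real (Suc n)))"
    unfolding log_test_def Delta_bump by (intro arg_cong2[where f="(/)"] sum.cong) auto
  finally show ?thesis using assms by simp
qed

private lemma dft_sum:
  assumes "j \<le> n"
  shows "(\<Sum>m\<le>n. dft n j m * cnj (dft n j m)) = of_nat (Suc n)"
  by (simp add: complex_norm_square[symmetric])

private lemma growth: "real (Suc n) * ((ln (real (Suc n)))\<^sup>2 / (6 * sqrt (real (Suc n)))) = sqrt (real (Suc n)) * (ln (real (Suc n)))\<^sup>2 / 6"
proof -
  have "N * (l / (6 * sqrt N)) = sqrt N * l / 6" if "0 \<le> N" for N l :: real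
    using real_div_sqrt[OF that] by (metis mult.commute times_divide_eq_left times_divide_eq_right divide_divide_eq_left)
  then show ?thesis by simp
qed

text \<open>The 1/192 is the 1/6 from the bumps divided by the norm bound 32 of the test
  functionals.\<close>

lemma not_log_type2_pair: "\<not> log_type2 (pair_image a b (ker_Delta c))"
proof (rule not_log_type2I[of "1/192" "\<lambda>n. unit" _ 1])
  show "unit k \<in> vcarrier X \<and> vnorm X (unit k) \<le> 1" if "k \<le> n" for n k using unit by blast
  fix n j :: nat assume j: "j \<le> n"
  let ?N = "real (Suc n)"
  define p where "p = vcomb X (dft n j) unit n"
  have p: "p \<in> vcarrier X" unfolding p_def by (intro vcomb_in_carrier vclosed_pair_image[OF K le2(1,2)] unit)
  \<comment> \<open>Conjugating the row aligns all N terms, so that their moduli add up.\<close>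
  define \<theta> where "\<theta> m = cnj (dft n j m)" for m
  have \<theta>: "cmod (\<theta> m) \<le> 1" for m by (simp add: \<theta>_def)
  have "test n \<theta> p = (\<Sum>m\<le>n. dft n j m * test n \<theta> (unit m))"
    unfolding p_def using bounded_operator_vcomb[OF test_dual[OF \<theta>] vclosed_pair_image[OF K le2(1,2)], of n unit] unit
    by (simp add: vcomb_scalars)
  also have "\<dots> = (\<Sum>m\<le>n. dft n j m * cnj (dft n j m)) * of_real ((ln ?N)\<^sup>2 / (6 * sqrt ?N))"
    unfolding sum_distrib_right by (intro sum.cong refl) (simp add: test_unit \<theta>_def)
  also have "\<dots> = of_real (?N * ((ln ?N)\<^sup>2 / (6 * sqrt ?N)))" unfolding dft_sum[OF j] by simp
  finally have "cmod (test n \<theta> p) = sqrt ?N * (ln ?N)\<^sup>2 / 6" unfolding growth by (simp only: norm_of_real) simp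
  then show "1/192 * (sqrt ?N * (ln ?N)\<^sup>2) \<le> vnorm X (vcomb X (dft n j) unit n)"
    using cmod_test_le[OF p, of n \<theta>] \<theta> unfolding p_def by simp
qed simp

text \<open>The roles are exchanged: the functionals for the conjugate rows are now the vectors, and
  \<open>unit k\<close> tests their combination with row \<open>k\<close>. By the symmetry of the
  Fourier matrix its N terms are again aligned, and \<open>unit k\<close> lies in the unit ball, so
  no factor 32 is lost.\<close>

lemma not_log_type2_dual_pair: "\<not> log_type2 (dual_space (pair_image a b (ker_Delta c)))"
proof (rule not_log_type2I[of "1/6" "\<lambda>n j. test n (\<lambda>m. cnj (dft n j m))" _ 32])
  fix n k :: nat assume k: "k \<le> n"
  let ?N = "real (Suc n)" and ?f = "\<lambda>j. test n (\<lambda>m. cnj (dft n j m))"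
  have f: "?f j \<in> vcarrier (dual_space X)" for j
    using test_dual[of n "\<lambda>m. cnj (dft n j m)"] by (simp add: dual_space_def) (simp add: test_def)
  have "Sup {cmod (?f k x) |x. x \<in> vcarrier X \<and> vnorm X x \<le> 1} \<le> 32"
  proof (rule cSup_least)
    show "{cmod (?f k x) |x. x \<in> vcarrier X \<and> vnorm X x \<le> 1} \<noteq> {}" using unit by blast
    fix s assume "s \<in> {cmod (?f k x) |x. x \<in> vcarrier X \<and> vnorm X x \<le> 1}"
    then obtain x where x: "s = cmod (?f k x)" "x \<in> vcarrier X" "vnorm X x \<le> 1" by blast
    show "s \<le> 32" using cmod_test_le[OF x(2), of n "\<lambda>m. cnj (dft n k m)"] x by simp
  qed
  then show "?f k \<in> vcarrier (dual_space X) \<and> vnorm (dual_space X) (?f k) \<le> 32"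
    using f by (simp add: dual_space_def)
  have "vcomb (dual_space X) (dft n k) ?f n (unit k) = (\<Sum>j\<le>n. dft n k j * cnj (dft n k j)) * of_real ((ln ?N)\<^sup>2 / (6 * sqrt ?N))"
    unfolding sum_distrib_right vcomb_dual_space by (intro sum.cong refl) (simp add: test_unit[OF k] dft_sym[of n k])
  also have "\<dots> = of_real (?N * ((ln ?N)\<^sup>2 / (6 * sqrt ?N)))" unfolding dft_sum[OF k] by simp
  finally have "cmod (vcomb (dual_space X) (dft n k) ?f n (unit k)) = sqrt ?N * (ln ?N)\<^sup>2 / 6" unfolding growth by (simp only: norm_of_real) simp
  moreover have "cmod (vcomb (dual_space X) (dft n k) ?f n (unit k)) \<le> vnorm (dual_space X) (vcomb (dual_space X) (dft n k) ?f n)"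
    by (intro dual_norm_upper vcomb_in_carrier vclosed_dual_space f unit pair_image_norm_nonneg[OF K le2(1,2)])
  ultimately show "1/6 * (sqrt ?N * (ln ?N)\<^sup>2) \<le> vnorm (dual_space X) (vcomb (dual_space X) (dft n k) ?f n)" by simp
qed simp

lemma not_embeds_Z2:
  "\<not> isomorphic_to_subspace (pair_image a b (ker_Delta c)) Z2_space"
  "\<not> isomorphic_to_quotient (pair_image a b (ker_Delta c)) Z2_space"
  "\<not> isomorphic_to_subspace (dual_space (pair_image a b (ker_Delta c))) Z2_space"
  "\<not> isomorphic_to_quotient (dual_space (pair_image a b (ker_Delta c))) Z2_space"
proof -
  note cc = calderon_subspace_calderon
  have nn: "0 \<le> vnorm Z2_space y" if "y \<in> vcarrier Z2_space" for y
    using pair_image_norm_nonneg[OF cc] that unfolding Z2_space_def by simp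
  have cl: "vclosed Z2_space" unfolding Z2_space_def by (rule vclosed_pair_image[OF cc]) auto
  have zero: "vadd Z2_space y (vscale Z2_space 0 z) = y" for y z by (simp add: Z2_space_def pair_image_def)
  note X = vclosed_pair_image[OF K le2(1,2)] pair_image_norm_nonneg[OF K le2(1,2)]
  have dual_nn: "0 \<le> vnorm (dual_space X) g" if "g \<in> vcarrier (dual_space X)" for g
    using dual_norm_upper[OF that unit(1) unit(2) X(2)] norm_ge_zero order_trans by blast
  show "\<not> isomorphic_to_subspace X Z2_space" "\<not> isomorphic_to_quotient X Z2_space"
    using log_type2_subspace[OF log_type2_Z2 nn cl X] log_type2_quotient[OF log_type2_Z2 nn cl zero X] not_log_type2_pair by blast+
  show "\<not> isomorphic_to_subspace (dual_space X) Z2_space" "\<not> isomorphic_to_quotient (dual_space X) Z2_space"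
    using log_type2_subspace[OF log_type2_Z2 nn cl vclosed_dual_space dual_nn]
      log_type2_quotient[OF log_type2_Z2 nn cl zero vclosed_dual_space dual_nn] not_log_type2_dual_pair by blast+
qed

end

theorem proposition7p5:
  "(\<not> isomorphic_to_subspace bigcirc_space Z2_space \<and>
      \<not> isomorphic_to_quotient bigcirc_space Z2_space) \<and>
    (\<not> isomorphic_to_subspace (dual_space bigcirc_space) Z2_space \<and>
      \<not> isomorphic_to_quotient (dual_space bigcirc_space) Z2_space) \<and>
    (\<not> isomorphic_to_subspace wedge_space Z2_space \<and>
      \<not> isomorphic_to_quotient wedge_space Z2_space) \<and>
    (\<not> isomorphic_to_subspace (dual_space wedge_space) Z2_space \<and>
      \<not> isomorphic_to_quotient (dual_space wedge_space) Z2_space)"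
proof -
  show ?thesis unfolding bigcirc_space_def wedge_space_def
    using not_embeds_Z2[of 0 1 2] not_embeds_Z2[of 2 0 1] by simp
qed

end
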